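(* Let $K=K_1\cup\dots\cup K_{k_0}\subset\mathbb{R}^3$ ($k_0\ge 3$), where each $K_i$ is a closed ball with centre $O_i$ and radius $r_i>0$, all the centres $O_i$ lie in one plane $\Gamma\subset\mathbb{R}^3$, and $K$ satisfies the no-eclipse condition and the standing assumptions on the constants $d_0,r_0,c_2$ given in the context. Let $\mu$ be an arbitrary Gibbs measure for the shift $\sigma$ on $\Sigma_A$ (defined by a Hölder continuous function on $\Sigma_A$), regarded, via the conjugacy $R:M_0\to\Sigma_A$, as a $B$-invariant measure on the non-wandering set $M_0$ of the billiard ball map $B$. Let $\lambda_1\ge\lambda_2>0$ be the positive Lyapunov exponents of $B$ with respect to $\mu$. Then $\lambda_1>\lambda_2$.
   Context: No-eclipse condition: for every pair $K_i,K_j$ of different balls, the convex hull of $K_i\cup K_j$ has no common points with any other ball $K_l$ ($l\ne i,j$). Billiard. $\Omega=\overline{\mathbb{R}^3\setminus K}$; $\phi_t$ is the billiard flow on $S(\Omega)=\{(q,v):q\in\Omega,\ v\in\mathbb{S}^2\}$ (unit speed motion along straight lines with specular reflection at $\partial K$); $\nu_K(q)$ is the outward unit normal to $\partial K$ at $q$. Put $M_1=\{(q,v)\in\partial K\times\mathbb{S}^2:\langle v,\nu_K(q)\rangle>0\}$. If $x\in M_1$ and $\phi_t(x)\in M_1$ for some $t>0$, then $B(x)=\phi_t(x)$ for the smallest such $t>0$. The non-wandering set $M_0$ is the set of all $x\in M_1$ whose billiard trajectory $\{\phi_t(x)\}_{t\in\mathbb{R}}$ is bounded. Then $B:M_0\to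 M_0$ is a homeomorphism which is locally the restriction of a smooth map $M_1\to M_1$. Standing assumptions. There are constants $d_0>0$ and $r_0<d_0/3$ such that $d_0<|O_iO_j|\le 1$ for all $i\ne j$ and $r_i\le r_0$ for all $i$. For successive reflection points $q_1,q_2,q_3$ of a billiard trajectory in $\Omega$ let $\varphi$ be the angle between $\nu_K(q_2)$ and $(q_3-q_2)/\|q_3-q_2\|$. The no-eclipse condition implies that there is a constant $c_1>0$ with $\cos\varphi\ge c_1$ for all such triples. The configuration implies that there is a constant $c_2<1$ such that $\cos\varphi\le c_2$ whenever $q_1$ and $q_3$ belong to different balls. It is assumed that $c_2d_0>2r_0$. Symbolic coding. $A$ is the $k_0\times k_0$ matrix with $A(i,j)=1$ if $i\ne j$ and $A(i,i)=0$; $\Sigma_A=\{(i_j)_{j\in\mathbb{Z}}:1\le i_j\le k_0,\ A(i_j,i_{j+1})=1\ \forall j\}$, with shift $\sigma((i_j))=(i_{j+1})$ and, for $0<\theta<1$, the metric $d_\theta(z,w)=\theta^m$ where $m$ is maximal with $z_i=w_i$ for $|i|<m$ (and $d_\theta(z,z)=0$). $R:M_0\to\Sigma_A$ is defined by $R(x)=(i_j)_{j\in\mathbb{Z}}$ where the base point of $B^j(x)$ lies in $K_{i_j}$; it is a bijection (a homeomorphism) with $R\circ B=\sigma\circ R$. Gibbs measure. For a function $\phi$ on $\Sigma_A$ Hölder continuous with respect to some $d_\theta$, the Gibbs measure $\mu=\mu_\phi$ is the unique $\sigma$-invariant probability measure on $\Sigma_A$ for which there are constants $P$ and $C>0$ with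 $$C^{-1}\le\frac{\mu(\mathcal{C}[i_0,\dots,i_{n-1}])}{e^{S_n\phi(z)-nP}}\le C$$ for every cylinder $\mathcal{C}[i_0,\dots,i_{n-1}]=\{z\in\Sigma_A:z_j=i_j,\ 0\le j\le n-1\}$ and every $z$ in it, where $S_n\phi=\sum_{j=0}^{n-1}\phi\circ\sigma^j$. Such a measure is ergodic. Lyapunov exponents. These are the exponents given by Oseledets' theorem for the derivative cocycle $dB(x):T_xM_1\to T_{B(x)}M_1$, $x\in M_0$, over $(B,\mu)$. Counted with multiplicity there are four, $\lambda_1\ge\lambda_2>0>-\lambda_2\ge-\lambda_1$. *)

theory Defs
  imports "HOL-Probability.Probability"
begin

definition adj :: "nat \<Rightarrow> nat \<Rightarrow> nat" where
  "adj i j = (if i \<noteq> j then 1 else 0)"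

definition Sigma_A :: "nat \<Rightarrow> (int \<Rightarrow> nat) set" where
  "Sigma_A k0 = {z. \<forall>j. z j \<in> {1..k0} \<and> adj (z j) (z (j + 1)) = 1}"

definition shift :: "(int \<Rightarrow> nat) \<Rightarrow> (int \<Rightarrow> nat)" where
  "shift z = (\<lambda>j. z (j + 1))"

definition dist_theta :: "real \<Rightarrow> (int \<Rightarrow> nat) \<Rightarrow> (int \<Rightarrow> nat) \<Rightarrow> real" where
  "dist_theta \<theta> z w =
     (if z = w then 0 else \<theta> ^ (GREATEST m. \<forall>i. \<bar>i\<bar> < int m \<longrightarrow> z i = w i))"

definition holder_potential :: "nat \<Rightarrow> ((int \<Rightarrow> nat) \<Rightarrow> real) \<Rightarrow> bool" where
  "holder_potential k0 \<phi> \<longleftrightarrow>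
     (\<exists>\<theta> \<alpha> H. 0 < \<theta> \<and> \<theta> < 1 \<and> 0 < \<alpha> \<and>
        (\<forall>z\<in>Sigma_A k0. \<forall>w\<in>Sigma_A k0. \<bar>\<phi> z - \<phi> w\<bar> \<le> H * dist_theta \<theta> z w powr \<alpha>))"

definition cylinder :: "nat \<Rightarrow> nat list \<Rightarrow> (int \<Rightarrow> nat) set" where
  "cylinder k0 is = {z \<in> Sigma_A k0. \<forall>j<length is. z (int j) = is ! j}"

definition birkhoff_sum :: "nat \<Rightarrow> ((int \<Rightarrow> nat) \<Rightarrow> real) \<Rightarrow> (int \<Rightarrow> nat) \<Rightarrow> real" where
  "birkhoff_sum n \<phi> z = (\<Sum>j<n. \<phi> ((shift ^^ j) z))"

text \<open>The Borel sets of \<open>\<Sigma>\<^sub>A\<close> are taken in the product topology of \<open>int \<Rightarrow> nat\<close>,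
  which is the topology of every \<open>dist_theta \<theta>\<close> with \<open>0 < \<theta> < 1\<close> on \<open>\<Sigma>\<^sub>A\<close>.\<close>

definition gibbs_measure ::
    "nat \<Rightarrow> ((int \<Rightarrow> nat) \<Rightarrow> real) \<Rightarrow> (int \<Rightarrow> nat) measure \<Rightarrow> bool" where
  "gibbs_measure k0 \<phi> \<mu> \<longleftrightarrow>
     prob_space \<mu> \<and> space \<mu> = Sigma_A k0 \<and>
     sets \<mu> = sets (restrict_space borel (Sigma_A k0)) \<and>
     distr \<mu> \<mu> shift = \<mu> \<and>
     (\<exists>P C. 0 < C \<and>
        (\<forall>is. \<forall>z\<in>cylinder k0 is.
           (let q = measure \<mu> (cylinder k0 is)
                      / exp (birkhoff_sum (length is) \<phi> z - real (length is) * P)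
            in 1 / C \<le> q \<and> q \<le> C)))"

text \<open>A phase point \<open>(q, v)\<close> is a position together with a velocity; tangent vectors of the
  phase space are pairs of the same type.\<close>

type_synonym phase = "(real^3) \<times> (real^3)"

locale ball_billiard =
  fixes k0 :: nat and cen :: "nat \<Rightarrow> real^3" and rad :: "nat \<Rightarrow> real"
begin

definition Kball :: "nat \<Rightarrow> (real^3) set" where
  "Kball i = cball (cen i) (rad i)"

definition K :: "(real^3) set" where
  "K = (\<Union>i\<in>{1..k0}. Kball i)"

definition no_eclipse :: bool where
  "no_eclipse \<longleftrightarrow>
     (\<forall>i\<in>{1..k0}. \<forall>j\<in>{1..k0}. \<forall>l\<in>{1..k0}. i \<noteq> j \<and> l \<noteq> i \<and> l \<noteq> j \<longrightarrow>
        convex hull (Kball i \<union> Kball j) \<inter> Kball l = {})"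

text \<open>\<open>ball_index\<close> and \<open>normal\<close> are meaningful when the balls are pairwise disjoint.\<close>

definition ball_index :: "real^3 \<Rightarrow> nat" where
  "ball_index q = (THE i. i \<in> {1..k0} \<and> q \<in> Kball i)"

definition normal :: "real^3 \<Rightarrow> real^3" where
  "normal q = (q - cen (ball_index q)) /\<^sub>R rad (ball_index q)"

definition reflect :: "real^3 \<Rightarrow> real^3 \<Rightarrow> real^3" where
  "reflect q v = v - (2 * (v \<bullet> normal q)) *\<^sub>R normal q"

definition Omega :: "(real^3) set" where
  "Omega = closure (- K)"

definition S_Omega :: "phase set" where
  "S_Omega = Omega \<times> sphere 0 1"

text \<open>Trajectories are parametrised by all of \<open>\<real>\<close> and take the outgoing velocity at reflection
  times: just after \<open>t\<close> the motion is free with velocity \<open>v\<close>, just before \<open>t\<close> it was free with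
  velocity \<open>w\<close>, where \<open>w\<close> is the mirror image of \<open>v\<close> if the particle is on the boundary at
  time \<open>t\<close>. A tangential contact does not change the velocity.\<close>

definition billiard_trajectory :: "(real \<Rightarrow> phase) \<Rightarrow> bool" where
  "billiard_trajectory \<gamma> \<longleftrightarrow>
     (\<forall>t. \<gamma> t \<in> S_Omega) \<and>
     (\<forall>t. let q = fst (\<gamma> t); v = snd (\<gamma> t);
              w = (if q \<in> frontier K then reflect q v else v)
          in \<exists>\<epsilon>>0. (\<forall>s\<in>{0..<\<epsilon>}. \<gamma> (t + s) = (q + s *\<^sub>R v, v)) \<and>
                    (\<forall>s\<in>{0<..<\<epsilon>}. \<gamma> (t - s) = (q - s *\<^sub>R w, w)))"

text \<open>At the boundary an incoming vector is identified with the outgoing vector obtained from it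
  by reflection.\<close>

definition outgoing :: "phase \<Rightarrow> phase" where
  "outgoing x = (if fst x \<in> frontier K \<and> snd x \<bullet> normal (fst x) < 0
                 then (fst x, reflect (fst x) (snd x)) else x)"

definition billiard_flow :: "real \<Rightarrow> phase \<Rightarrow> phase" where
  "billiard_flow t x = (THE \<gamma>. billiard_trajectory \<gamma> \<and> \<gamma> 0 = outgoing x) t"

definition M1 :: "phase set" where
  "M1 = {(q, v). q \<in> frontier K \<and> v \<in> sphere 0 1 \<and> v \<bullet> normal q > 0}"

definition M0 :: "phase set" where
  "M0 = {x \<in> M1. bounded (range (\<lambda>t. billiard_flow t x))}"

definition billiard_map :: "phase \<Rightarrow> phase" where
  "billiard_map x =
     (if x \<in> M1 \<and> (\<exists>t>0. billiard_flow t x \<in> M1)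
      then billiard_flow (LEAST t. t > 0 \<and> billiard_flow t x \<in> M1) x
      else undefined)"

definition billiard_map_pow :: "int \<Rightarrow> phase \<Rightarrow> phase" where
  "billiard_map_pow n =
     (if 0 \<le> n then billiard_map ^^ nat n else inv_into M0 billiard_map ^^ nat (- n))"

definition successive_reflection_points :: "real^3 \<Rightarrow> real^3 \<Rightarrow> real^3 \<Rightarrow> bool" where
  "successive_reflection_points q1 q2 q3 \<longleftrightarrow>
     (\<exists>\<gamma> t1 t2 t3. billiard_trajectory \<gamma> \<and> t1 < t2 \<and> t2 < t3 \<and>
        {t \<in> {t1..t3}. fst (\<gamma> t) \<in> frontier K} = {t1, t2, t3} \<and>
        q1 = fst (\<gamma> t1) \<and> q2 = fst (\<gamma> t2) \<and> q3 = fst (\<gamma> t3))"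

text \<open>\<open>cos_reflection q2 q3\<close> is \<open>cos \<phi>\<close> for the angle \<open>\<phi>\<close> between the unit vectors
  \<open>normal q2\<close> and \<open>(q3 - q2) / norm (q3 - q2)\<close>.\<close>

definition cos_reflection :: "real^3 \<Rightarrow> real^3 \<Rightarrow> real" where
  "cos_reflection q2 q3 = normal q2 \<bullet> ((q3 - q2) /\<^sub>R norm (q3 - q2))"

definition coding :: "phase \<Rightarrow> int \<Rightarrow> nat" where
  "coding x = (\<lambda>j. ball_index (fst (billiard_map_pow j x)))"

definition phase_measure :: "(int \<Rightarrow> nat) measure \<Rightarrow> phase measure" where
  "phase_measure \<mu> = distr \<mu> (restrict_space borel M0) (inv_into M0 coding)"

definition tangent_space :: "phase \<Rightarrow> phase set" where
  "tangent_space x = {(a, b). a \<bullet> normal (fst x) = 0 \<and> b \<bullet> snd x = 0}"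

text \<open>\<open>frechet_derivative\<close> within the 4-dimensional submanifold \<open>M1\<close> picks a linear map on the
  ambient space; its restriction to \<open>tangent_space x\<close> does not depend on the choice, and
  the definitions below apply it only to tangent vectors.\<close>

definition dB :: "phase \<Rightarrow> phase \<Rightarrow> phase" where
  "dB x = frechet_derivative billiard_map (at x within M1)"

primrec dB_iter :: "nat \<Rightarrow> phase \<Rightarrow> phase \<Rightarrow> phase" where
  "dB_iter 0 x = id"
| "dB_iter (Suc n) x = dB ((billiard_map ^^ n) x) \<circ> dB_iter n x"

definition dB_pow :: "int \<Rightarrow> phase \<Rightarrow> phase \<Rightarrow> phase" where
  "dB_pow n x =
     (if 0 \<le> n then dB_iter (nat n) x
      else inv_into (tangent_space (billiard_map_pow n x))
             (dB_iter (nat (- n)) (billiard_map_pow n x)))"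

text \<open>\<open>\<kappa>s\<close> lists the exponents, each repeated according to its multiplicity, and \<open>E x \<kappa>\<close> is the
  Oseledets space of \<open>\<kappa>\<close> at \<open>x\<close>, which is \<open>{0}\<close> when \<open>\<kappa>\<close> is not in \<open>\<kappa>s\<close>. For a list of
  length 4 the dimensions add up to that of the tangent space, so the spanning condition makes
  the tangent space the direct sum of the spaces \<open>E x \<kappa>\<close>.\<close>

definition lyapunov_exponents :: "phase measure \<Rightarrow> real list \<Rightarrow> bool" where
  "lyapunov_exponents m \<kappa>s \<longleftrightarrow>
     (\<exists>E :: phase \<Rightarrow> real \<Rightarrow> phase set. AE x in m.
        span (\<Union>\<kappa>. E x \<kappa>) = tangent_space x \<and>
        (\<forall>\<kappa>. subspace (E x \<kappa>) \<and> dim (E x \<kappa>) = count_list \<kappa>s \<kappa> \<and>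
             dB x ` E x \<kappa> = E (billiard_map x) \<kappa> \<and>
             (\<forall>w\<in>E x \<kappa> - {0}.
                ((\<lambda>n. ln (norm (dB_pow n x w)) / real_of_int n) \<longlongrightarrow> \<kappa>) at_top \<and>
                ((\<lambda>n. ln (norm (dB_pow n x w)) / real_of_int n) \<longlongrightarrow> \<kappa>) at_bot)))"

end

end

theory Submission
  imports Defs "HOL-Analysis.Cross3"
begin

text \<open>
  The centres of the balls lie in a plane, and this forces every trapped trajectory into the plane. At a trapped
  point the tangent space then splits into vectors perpendicular to the plane and vectors in the plane, and the
  derivative of the billiard map preserves the splitting. Describe a vector of either kind by a displacement \<open>a\<close>
  transversal to the velocity and a rotation \<open>b\<close> of the velocity. Up to sign, a free flight of length \<open>\<tau>\<close> and the
  reflection that follows map \<open>(a, b)\<close> to \<open>(a', b + k a')\<close> with \<open>a' = a + \<tau> b\<close>. If the ball has radius \<open>r\<close> and \<open>c\<close> is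
  the cosine of the angle of reflection, then \<open>k = 2 c / r\<close> for perpendicular vectors and \<open>k = 2 / (c r)\<close> for vectors in
  the plane (\<open>dB_perp\<close>, \<open>dB_inplane\<close>). The second value is never smaller, and it is larger by a fixed amount whenever
  the balls before and after the reflection differ, because then \<open>c \<le> c2 < 1\<close>; call this a turn. So an expanding vector in the plane outgrows an
  expanding perpendicular vector by a factor that is exponential in the number of turns (\<open>wavefront_comparison\<close>,
  \<open>inplane_beats_perp\<close>).

  Suppose that the two positive exponents coincide. Then almost everywhere all vectors that do not contract grow at
  the same rate (\<open>growth_rate_of_non_contracting\<close>), in particular the two just compared, and so the frequency of turns
  tends to 0. This is impossible: the frequencies of turns have the same integral for all lengths, because the Gibbs
  measure is invariant, and this integral is positive, because cylinders have positive measure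
  (\<open>turns_not_negligible\<close>).

  To use this, one has to know that the Gibbs measure is carried over to the trapped set, that is, that the coding is
  a bijection with a measurable inverse. Trapped trajectories correspond to bi-infinite chains of reflection
  points. If two chains have the same itinerary, let \<open>w\<^sub>j\<close> be the differences of their positions and \<open>u\<^sub>j\<close> those of
  their velocities. The numbers \<open>w\<^sub>j \<bullet> u\<^sub>j\<close> are bounded and increase with \<open>j\<close>, because free motion is monotone and the
  balls are convex, and the increments control \<open>w\<^sub>j\<close> and \<open>u\<^sub>j\<close> (\<open>divergence_step\<close>). Hence the chains coincide, and chains
  whose itineraries agree on a long window are close (\<open>chains_close\<close>). The former also gives planarity, by comparison
  with the mirror image (\<open>chain_planar\<close>); the latter makes the inverse of the coding continuous. A chain with a given
  itinerary exists by minimising lengths of broken lines (\<open>chain_exists\<close>).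

  The trapped set is defined through the billiard flow, so the correspondence between chains and trajectories requires
  that trajectories exist for all initial points in \<open>M1\<close>, trapped or not, and are unique (\<open>trajectory_exists\<close>, \<open>trajectory_unique\<close>). The derivative of the billiard map is
  computed from a smooth formula that is valid near the trapped set; on tangent vectors it does not depend on the
  choice made by \<open>frechet_derivative\<close> (\<open>has_derivative_within_M1_unique\<close>).
\<close>

section \<open>Disjoint balls\<close>

lemma norm_add_scaleR_sq:
  fixes p v :: "'a::real_inner"
  assumes "norm v = 1"
  shows "(norm (p + s *\<^sub>R v))\<^sup>2 = (norm p)\<^sup>2 + 2 * s * (p \<bullet> v) + s\<^sup>2"
proof -
  have "v \<bullet> v = 1" using assms by (simp add: dot_square_norm)
  then show ?thesis
    unfolding power2_norm_eq_inner by (simp add: inner_simps algebra_simps power2_eq_square inner_commute)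
qed

locale separated_balls = ball_billiard k0 cen rad
  for k0 :: nat and cen :: "nat \<Rightarrow> real^3" and rad :: "nat \<Rightarrow> real" +
  fixes gap :: real
  assumes gap_pos: "gap > 0"
    and rad_pos: "i \<in> {1..k0} \<Longrightarrow> rad i > 0"
    and separated: "\<lbrakk>i \<in> {1..k0}; j \<in> {1..k0}; i \<noteq> j\<rbrakk> \<Longrightarrow> rad i + rad j + gap \<le> dist (cen i) (cen j)"
begin

lemma dist_balls_ge_gap:
  assumes "i \<in> {1..k0}" "j \<in> {1..k0}" "i \<noteq> j" "p \<in> Kball i" "q \<in> Kball j"
  shows "gap \<le> dist p q"
proof -
  have "dist (cen i) (cen j) \<le> dist (cen i) p + dist p q + dist (cen j) q"
    using dist_triangle[of "cen i" "cen j" p] dist_triangle[of p "cen j" q] by (simp add: dist_commute)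
  then show ?thesis using separated[OF assms(1-3)] assms(4,5) unfolding Kball_def mem_cball by linarith
qed

lemma ball_index_eq: "\<lbrakk>i \<in> {1..k0}; q \<in> Kball i\<rbrakk> \<Longrightarrow> ball_index q = i"
  unfolding ball_index_def
proof (intro the_equality)
  fix j assume "i \<in> {1..k0}" "q \<in> Kball i" "j \<in> {1..k0} \<and> q \<in> Kball j"
  then show "j = i" using dist_balls_ge_gap[of j i q q] gap_pos by force
qed simp

lemma closed_K: "closed K"
  unfolding K_def Kball_def by auto

lemma sphere_push_out:
  assumes i: "i \<in> {1..k0}" and q: "q \<in> sphere (cen i) (rad i)" and s: "0 < s" "s < gap"
  shows "q + (s / rad i) *\<^sub>R (q - cen i) \<notin> K"
proof
  let ?p = "q + (s / rad i) *\<^sub>R (q - cen i)"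
  have nq: "norm (q - cen i) = rad i" using q by (simp add: dist_norm norm_minus_commute)
  have r: "rad i > 0" using rad_pos i by auto
  assume "?p \<in> K"
  then obtain j where j: "j \<in> {1..k0}" "?p \<in> Kball j" unfolding K_def by auto
  show False
  proof (cases "j = i")
    case True
    have "?p - cen i = (1 + s / rad i) *\<^sub>R (q - cen i)" by (simp add: algebra_simps)
    then have "norm (?p - cen i) = \<bar>1 + s / rad i\<bar> * rad i" using nq by simp
    also have "\<dots> = rad i + s" using r s by (simp add: field_simps)
    finally have "norm (?p - cen i) = rad i + s" .
    then show False using j True s by (simp add: Kball_def dist_norm norm_minus_commute)
  next
    case False
    have "gap \<le> dist q ?p" using dist_balls_ge_gap[OF i j(1) _ _ j(2)] False q by (auto simp: Kball_def)
    also have "dist q ?p = s" using nq r s by (simp add: dist_norm)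
    finally show False using s by simp
  qed
qed

text \<open>A boundary point of a ball is not an interior point of the union, since the points just outside the ball
  are not in another ball either.\<close>

lemma interior_K: "interior K = (\<Union>i\<in>{1..k0}. ball (cen i) (rad i))"
proof
  have "(\<Union>i\<in>{1..k0}. ball (cen i) (rad i)) \<subseteq> K" unfolding K_def Kball_def by force
  then show "(\<Union>i\<in>{1..k0}. ball (cen i) (rad i)) \<subseteq> interior K"
    by (simp add: interior_maximal open_UN)
  show "interior K \<subseteq> (\<Union>i\<in>{1..k0}. ball (cen i) (rad i))"
  proof
    fix q assume q: "q \<in> interior K"
    then obtain i where i: "i \<in> {1..k0}" "q \<in> Kball i" using interior_subset K_def by blast
    show "q \<in> (\<Union>i\<in>{1..k0}. ball (cen i) (rad i))"
    proof (rule ccontr)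
      assume "q \<notin> (\<Union>i\<in>{1..k0}. ball (cen i) (rad i))"
      then have qs: "q \<in> sphere (cen i) (rad i)" using i by (force simp: Kball_def)
      obtain e where e: "e > 0" "ball q e \<subseteq> K" using q unfolding mem_interior by auto
      define s where "s = min e gap / 2"
      have s: "0 < s" "s < gap" "s < e" using e gap_pos by (auto simp: s_def)
      have "dist q (q + (s / rad i) *\<^sub>R (q - cen i)) = s"
        using qs rad_pos[OF i(1)] s by (simp add: dist_norm norm_minus_commute)
      then have "q + (s / rad i) *\<^sub>R (q - cen i) \<in> K" using e s by (auto intro!: subsetD[OF e(2)])
      then show False using sphere_push_out[OF i(1) qs s(1,2)] by simp
    qed
  qed
qed

lemma frontier_K: "frontier K = (\<Union>i\<in>{1..k0}. sphere (cen i) (rad i))"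
proof -
  have "frontier K = K - interior K" using closed_K by (simp add: frontier_def)
  also have "\<dots> = (\<Union>i\<in>{1..k0}. sphere (cen i) (rad i))"
  proof (rule set_eqI)
    fix q
    show "q \<in> K - interior K \<longleftrightarrow> q \<in> (\<Union>i\<in>{1..k0}. sphere (cen i) (rad i))"
    proof
      assume "q \<in> K - interior K"
      then show "q \<in> (\<Union>i\<in>{1..k0}. sphere (cen i) (rad i))"
        unfolding interior_K unfolding K_def Kball_def by force
    next
      assume "q \<in> (\<Union>i\<in>{1..k0}. sphere (cen i) (rad i))"
      then obtain i where i: "i \<in> {1..k0}" "q \<in> sphere (cen i) (rad i)" by auto
      have "q \<in> Kball i" using i by (auto simp: Kball_def)
      moreover have "\<not> dist (cen j) q < rad j" if j: "j \<in> {1..k0}" for j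
      proof
        assume a: "dist (cen j) q < rad j"
        then have "q \<in> Kball j" by (simp add: Kball_def)
        then have "j = i" using ball_index_eq \<open>q \<in> Kball i\<close> i j by metis
        then show False using a i by simp
      qed
      ultimately show "q \<in> K - interior K" using i unfolding interior_K unfolding K_def by auto
    qed
  qed
  finally show ?thesis .
qed

lemma Omega_eq: "Omega = - interior K"
  unfolding Omega_def by (simp add: closure_complement)

lemma sphere_ball_index: "\<lbrakk>i \<in> {1..k0}; q \<in> sphere (cen i) (rad i)\<rbrakk> \<Longrightarrow> ball_index q = i"
  using ball_index_eq by (auto simp: Kball_def)

lemma sphere_normal: "\<lbrakk>i \<in> {1..k0}; q \<in> sphere (cen i) (rad i)\<rbrakk> \<Longrightarrow> normal q = (q - cen i) /\<^sub>R rad i"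
  unfolding normal_def using sphere_ball_index by auto

lemma frontierE:
  assumes "q \<in> frontier K"
  obtains "ball_index q \<in> {1..k0}" "norm (q - cen (ball_index q)) = rad (ball_index q)"
    "q \<in> sphere (cen (ball_index q)) (rad (ball_index q))" "q \<in> Kball (ball_index q)" "rad (ball_index q) > 0"
proof -
  obtain i where i: "i \<in> {1..k0}" "q \<in> sphere (cen i) (rad i)" using assms unfolding frontier_K by auto
  then have "ball_index q = i" by (rule sphere_ball_index)
  then show thesis using that i rad_pos[OF i(1)] by (simp add: dist_norm norm_minus_commute Kball_def)
qed

lemma frontier_K_Omega: "q \<in> frontier K \<Longrightarrow> q \<in> Omega"
  unfolding Omega_eq frontier_def by auto

lemma norm_normal: "q \<in> frontier K \<Longrightarrow> norm (normal q) = 1"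
  by (erule frontierE) (simp add: normal_def)

lemma inner_normal_self: "q \<in> frontier K \<Longrightarrow> normal q \<bullet> normal q = 1"
  using norm_normal by (simp add: dot_square_norm)

lemma reflect_inner_normal: "q \<in> frontier K \<Longrightarrow> reflect q v \<bullet> normal q = - (v \<bullet> normal q)"
  by (simp add: reflect_def inner_diff_left inner_normal_self)

lemma reflect_reflect: "q \<in> frontier K \<Longrightarrow> reflect q (reflect q v) = v"
  by (subst reflect_def) (simp add: reflect_inner_normal, simp add: reflect_def)

lemma reflect_minus: "reflect q (- v) = - reflect q v"
  by (simp add: reflect_def)

lemma norm_reflect: "q \<in> frontier K \<Longrightarrow> norm (reflect q v) = norm v"
proof -
  assume q: "q \<in> frontier K"
  have "reflect q v \<bullet> reflect q v = v \<bullet> v"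
    by (simp add: reflect_def inner_diff_left inner_diff_right inner_normal_self[OF q] inner_commute[of "normal q" v])
  then show ?thesis by (simp add: norm_eq)
qed

lemma reflect_tangent: "v \<bullet> normal q = 0 \<Longrightarrow> reflect q v = v"
  by (simp add: reflect_def)

lemma M1_D:
  assumes "x \<in> M1"
  shows "fst x \<in> frontier K" "norm (snd x) = 1" "snd x \<bullet> normal (fst x) > 0"
  using assms by (auto simp: M1_def)

text \<open>Along the ray the squared distance to the centre is \<open>r\<^sup>2 + 2 s p \<bullet> v + s\<^sup>2\<close> with \<open>p \<bullet> v \<ge> 0\<close>.\<close>

lemma outgoing_ray_leaves:
  assumes q: "q \<in> frontier K" and v: "norm v = 1" "v \<bullet> normal q \<ge> 0" and s: "s > 0"
  shows "q + s *\<^sub>R v \<notin> Kball (ball_index q)"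
proof -
  let ?i = "ball_index q"
  have r: "rad ?i > 0" "norm (q - cen ?i) = rad ?i" using frontierE[OF q] by blast+
  have "(q - cen ?i) \<bullet> v \<ge> 0"
    using v r by (simp add: normal_def inner_commute zero_le_mult_iff)
  then have "(norm ((q - cen ?i) + s *\<^sub>R v))\<^sup>2 > (rad ?i)\<^sup>2"
    using norm_add_scaleR_sq[OF v(1), of "q - cen ?i" s] s r by (simp add: add_nonneg_pos)
  then have "norm ((q - cen ?i) + s *\<^sub>R v) > rad ?i" using r by (simp add: power2_less_imp_less)
  then show ?thesis by (simp add: Kball_def dist_norm norm_minus_commute algebra_simps)
qed

section \<open>Billiard trajectories\<close>

text \<open>The relation between the velocities before and after a passage through \<open>q\<close> is symmetric, because a
  reflection is an involution.\<close>

definition incoming :: "real^3 \<Rightarrow> real^3 \<Rightarrow> real^3" where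
  "incoming q v = (if q \<in> frontier K then reflect q v else v)"

lemma incoming_incoming: "incoming q (incoming q v) = v"
  by (simp add: incoming_def reflect_reflect)

lemma incoming_minus: "incoming q (- v) = - incoming q v"
  by (simp add: incoming_def reflect_minus)

lemma norm_incoming: "norm (incoming q v) = norm v"
  by (simp add: incoming_def norm_reflect)

definition arrival :: "phase \<Rightarrow> real^3" where
  "arrival x = incoming (fst x) (snd x)"

lemma arrival_inject: "\<lbrakk>arrival x = arrival y; fst x = fst y\<rbrakk> \<Longrightarrow> x = y"
  unfolding arrival_def by (metis incoming_incoming prod.expand)

definition free_after :: "(real \<Rightarrow> phase) \<Rightarrow> real \<Rightarrow> real \<Rightarrow> bool" where
  "free_after \<gamma> t \<epsilon> \<longleftrightarrow> (\<forall>s. 0 \<le> s \<and> s < \<epsilon> \<longrightarrow> \<gamma> (t + s) = (fst (\<gamma> t) + s *\<^sub>R snd (\<gamma> t), snd (\<gamma> t)))"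

definition free_before :: "(real \<Rightarrow> phase) \<Rightarrow> real \<Rightarrow> real \<Rightarrow> bool" where
  "free_before \<gamma> t \<epsilon> \<longleftrightarrow> (\<forall>s. 0 < s \<and> s < \<epsilon> \<longrightarrow> \<gamma> (t - s) = (fst (\<gamma> t) - s *\<^sub>R arrival (\<gamma> t), arrival (\<gamma> t)))"

lemma billiard_trajectory_iff:
  "billiard_trajectory \<gamma> \<longleftrightarrow> (\<forall>t. \<gamma> t \<in> S_Omega) \<and> (\<forall>t. \<exists>\<epsilon>>0. free_after \<gamma> t \<epsilon> \<and> free_before \<gamma> t \<epsilon>)"
  unfolding billiard_trajectory_def Let_def free_after_def free_before_def arrival_def incoming_def
  by (simp only: Ball_def atLeastLessThan_iff greaterThanLessThan_iff)

lemma billiard_trajectoryI: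
  assumes "\<And>t. \<gamma> t \<in> S_Omega" and a: "\<And>t. \<exists>\<epsilon>>0. free_after \<gamma> t \<epsilon>" and b: "\<And>t. \<exists>\<epsilon>>0. free_before \<gamma> t \<epsilon>"
  shows "billiard_trajectory \<gamma>"
  unfolding billiard_trajectory_iff
proof (intro conjI allI)
  fix t
  obtain d e where "d > 0" "free_after \<gamma> t d" "e > 0" "free_before \<gamma> t e" using a[of t] b[of t] by blast
  then show "\<exists>\<epsilon>>0. free_after \<gamma> t \<epsilon> \<and> free_before \<gamma> t \<epsilon>"
    unfolding free_after_def free_before_def by (intro exI[of _ "min d e"]) simp
qed fact

lemma trajectory_S_Omega: "billiard_trajectory \<gamma> \<Longrightarrow> \<gamma> t \<in> S_Omega"
  unfolding billiard_trajectory_iff by blast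

lemma free_agree:
  assumes "free_after \<gamma> t e" "free_before \<gamma> t e" "free_after \<eta> t d" "free_before \<eta> t d"
    and y: "dist y t < min e d"
  shows "\<gamma> y = \<eta> y \<longleftrightarrow> \<gamma> t = \<eta> t"
proof (cases "y \<ge> t")
  case True
  define s where "s = y - t"
  have s: "0 \<le> s" "s < e" "s < d" "y = t + s" using True y by (auto simp: s_def dist_real_def)
  have eq: "\<gamma> y = (fst (\<gamma> t) + s *\<^sub>R snd (\<gamma> t), snd (\<gamma> t))" "\<eta> y = (fst (\<eta> t) + s *\<^sub>R snd (\<eta> t), snd (\<eta> t))"
    using assms(1,3) s unfolding free_after_def by blast+
  show ?thesis
  proof
    assume "\<gamma> y = \<eta> y"
    then have *: "(fst (\<gamma> t) + s *\<^sub>R snd (\<gamma> t), snd (\<gamma> t)) = (fst (\<eta> t) + s *\<^sub>R snd (\<eta> t), snd (\<eta> t))"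
      unfolding eq .
    then have w: "snd (\<gamma> t) = snd (\<eta> t)" by simp
    have "fst (\<gamma> t) = fst (\<eta> t)" using * unfolding w by simp
    with w show "\<gamma> t = \<eta> t" by (simp add: prod_eq_iff)
  qed (simp add: eq)
next
  case False
  define s where "s = t - y"
  have s: "0 < s" "s < e" "s < d" "y = t - s" using False y by (auto simp: s_def dist_real_def)
  have eq: "\<gamma> y = (fst (\<gamma> t) - s *\<^sub>R arrival (\<gamma> t), arrival (\<gamma> t))" "\<eta> y = (fst (\<eta> t) - s *\<^sub>R arrival (\<eta> t), arrival (\<eta> t))"
    using assms(2,4) s unfolding free_before_def by blast+
  show ?thesis
  proof
    assume "\<gamma> y = \<eta> y"
    then have *: "(fst (\<gamma> t) - s *\<^sub>R arrival (\<gamma> t), arrival (\<gamma> t)) = (fst (\<eta> t) - s *\<^sub>R arrival (\<eta> t), arrival (\<eta> t))"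
      unfolding eq .
    then have w: "arrival (\<gamma> t) = arrival (\<eta> t)" by simp
    have "fst (\<gamma> t) = fst (\<eta> t)" using * unfolding w by simp
    with w show "\<gamma> t = \<eta> t" by (rule arrival_inject)
  qed (simp add: eq)
qed

text \<open>The set of times at which two trajectories agree is open and closed: the state at any time determines
  the motion on both sides of it, and is determined by the motion on either side.\<close>

lemma trajectory_unique:
  assumes g: "billiard_trajectory \<gamma>" and h: "billiard_trajectory \<eta>" and eq: "\<gamma> t0 = \<eta> t0"
  shows "\<gamma> = \<eta>"
proof -
  let ?S = "{t. \<gamma> t = \<eta> t}"
  have *: "\<exists>e>0. \<forall>y. dist y t < e \<longrightarrow> (y \<in> ?S \<longleftrightarrow> t \<in> ?S)" for t
  proof -
    obtain d e where d: "d > 0" "free_after \<gamma> t d" "free_before \<gamma> t d"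
      and e: "e > 0" "free_after \<eta> t e" "free_before \<eta> t e"
      using g h unfolding billiard_trajectory_iff by metis
    have "y \<in> ?S \<longleftrightarrow> t \<in> ?S" if "dist y t < min d e" for y
      unfolding mem_Collect_eq by (rule free_agree[OF d(2,3) e(2,3) that])
    moreover have "0 < min d e" using d(1) e(1) by simp
    ultimately show ?thesis by blast
  qed
  have "open ?S" unfolding open_dist using * by blast
  moreover have "closed ?S" unfolding closed_def open_dist using * by blast
  ultimately have "?S = UNIV" using eq clopen[of ?S] by blast
  then show ?thesis by auto
qed

lemma trajectory_shift:
  assumes "billiard_trajectory \<gamma>"
  shows "billiard_trajectory (\<lambda>t. \<gamma> (t + a))"
proof -
  have "free_after (\<lambda>t. \<gamma> (t + a)) t e = free_after \<gamma> (t + a) e \<and> free_before (\<lambda>t. \<gamma> (t + a)) t e = free_before \<gamma> (t + a) e" for t e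
  proof -
    have "t + s + a = t + a + s" "t - s + a = t + a - s" for s by simp_all
    then show ?thesis unfolding free_after_def free_before_def by (simp only:)
  qed
  then show ?thesis using assms unfolding billiard_trajectory_iff by simp
qed

lemma trajectory_reverse:
  assumes g: "billiard_trajectory \<gamma>"
  shows "billiard_trajectory (\<lambda>t. (fst (\<gamma> (- t)), - arrival (\<gamma> (- t))))"
    (is "billiard_trajectory ?r")
proof (rule billiard_trajectoryI)
  fix t
  show "?r t \<in> S_Omega" using trajectory_S_Omega[OF g, of "- t"]
    by (auto simp: S_Omega_def arrival_def norm_incoming)
  have local: "\<exists>e>0. free_after \<gamma> u e \<and> free_before \<gamma> u e" for u using g unfolding billiard_trajectory_iff by blast
  obtain e where e: "e > 0" "free_after \<gamma> (- t) e" "free_before \<gamma> (- t) e" using local by blast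
  \<comment> \<open>On the segment of flight before the time \<open>- t\<close> the velocity of arrival is the velocity itself.\<close>
  have "?r (t + s) = (fst (?r t) + s *\<^sub>R snd (?r t), snd (?r t))" if s: "0 \<le> s" "s < e" for s
  proof (cases "s = 0")
    case False
    then have gs: "\<gamma> (- t - s) = (fst (\<gamma> (- t)) - s *\<^sub>R arrival (\<gamma> (- t)), arrival (\<gamma> (- t)))"
      using e(3) s unfolding free_before_def by simp
    obtain d where d: "d > 0" "free_before \<gamma> (- t - s) d" using local by blast
    define u where "u = min d (e - s) / 2"
    have u: "0 < u" "u < d" "s + u < e" using d s by (auto simp: u_def min_def field_simps)
    have "snd (\<gamma> (- t - (s + u))) = arrival (\<gamma> (- t))" using e(3) u s unfolding free_before_def by simp
    moreover have "snd (\<gamma> (- t - s - u)) = arrival (\<gamma> (- t - s))" using d(2) u unfolding free_before_def by simp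
    ultimately have "arrival (\<gamma> (- t - s)) = arrival (\<gamma> (- t))" by (simp add: algebra_simps)
    then show ?thesis using gs by simp
  qed simp
  then show "\<exists>\<epsilon>>0. free_after ?r t \<epsilon>" using e(1) unfolding free_after_def by blast
  have ar: "arrival (?r t) = - snd (\<gamma> (- t))"
    by (simp add: arrival_def incoming_minus incoming_incoming)
  have "?r (t - s) = (fst (?r t) - s *\<^sub>R arrival (?r t), arrival (?r t))" if s: "0 < s" "s < e" for s
  proof -
    have gs: "\<gamma> (- t + s) = (fst (\<gamma> (- t)) + s *\<^sub>R snd (\<gamma> (- t)), snd (\<gamma> (- t)))"
      using e(2) s unfolding free_after_def by simp
    obtain d where d: "d > 0" "free_before \<gamma> (- t + s) d" using local by blast
    define u where "u = min d s / 2"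
    have u: "0 < u" "u < d" "u < s" using d s by (auto simp: u_def min_def)
    have "snd (\<gamma> (- t + (s - u))) = snd (\<gamma> (- t))" using e(2) u s unfolding free_after_def by simp
    moreover have "snd (\<gamma> (- t + s - u)) = arrival (\<gamma> (- t + s))" using d(2) u unfolding free_before_def by simp
    ultimately have "arrival (\<gamma> (- t + s)) = snd (\<gamma> (- t))" by (simp add: algebra_simps)
    moreover have "- (t - s) = - t + s" by simp
    ultimately show ?thesis using gs unfolding ar by simp
  qed
  then show "\<exists>\<epsilon>>0. free_before ?r t \<epsilon>" using e(1) unfolding free_before_def by blast
qed

end

lemma strict_mono_int_step:
  fixes t :: "int \<Rightarrow> real"
  assumes "\<And>j. t j < t (j + 1)" "i < j"
  shows "t i < t j"
  using assms(2)
proof (induction j rule: int_gr_induct)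
  case (step j)
  then show ?case using assms(1)[of j] by linarith
qed (use assms(1) in simp)

lemma int_index_exists:
  fixes t :: "int \<Rightarrow> real"
  assumes mono: "\<And>j. t j < t (j + 1)" and up: "\<exists>j. T < t j" and down: "\<exists>j. t j \<le> T"
  shows "\<exists>!j. t j \<le> T \<and> T < t (j + 1)"
proof -
  obtain a b where a: "t a \<le> T" and b: "T < t b" using up down by blast
  have lt: "i < j" if "t i \<le> T" "T < t j" for i j
    using that strict_mono_int_step[of t j i] mono by (cases i j rule: linorder_cases) force+
  define S where "S = {j \<in> {a..b}. t j \<le> T}"
  have "S \<subseteq> {a..b}" by (auto simp: S_def)
  then have S: "finite S" "a \<in> S" using a lt[OF a b] by (auto simp: S_def intro: finite_subset)
  have m: "Max S \<in> S" using S by (intro Max_in) auto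
  have "T < t (Max S + 1)"
  proof (rule ccontr)
    assume n: "\<not> T < t (Max S + 1)"
    then have "Max S + 1 < b" using lt b by force
    then have "Max S + 1 \<in> S" using n m by (auto simp: S_def)
    then show False using Max_ge[OF S(1)] by force
  qed
  moreover have "j = Max S" if "t j \<le> T" "T < t (j + 1)" for j
    using that lt[of j "Max S + 1"] lt[of "Max S" "j + 1"] calculation m by (simp add: S_def)
  ultimately show ?thesis using m by (intro ex1I[of _ "Max S"]) (simp_all add: S_def)
qed

context separated_balls
begin

text \<open>The gluing of free flights: on the half-open interval that starts at \<open>t j\<close> the particle moves from \<open>q j\<close> with
  velocity \<open>v j\<close>. Tangential contacts during a flight are harmless, since there the reflection changes nothing.\<close>

lemma glued_trajectory:
  fixes t :: "int \<Rightarrow> real" and q v :: "int \<Rightarrow> real^3"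
  assumes mono: "\<And>j. t j < t (j + 1)"
    and up: "\<And>T. \<exists>j. T < t j" and down: "\<And>T. \<exists>j. t j \<le> T"
    and step: "\<And>j. q (j + 1) = q j + (t (j + 1) - t j) *\<^sub>R v j"
    and unit: "\<And>j. norm (v j) = 1"
    and mem: "\<And>j. q j \<in> Omega"
    and seg: "\<And>j s. 0 < s \<Longrightarrow> s < t (j + 1) - t j \<Longrightarrow> q j + s *\<^sub>R v j \<in> Omega \<and>
        (q j + s *\<^sub>R v j \<in> frontier K \<longrightarrow> v j \<bullet> normal (q j + s *\<^sub>R v j) = 0)"
    and refl: "\<And>j. v (j - 1) = incoming (q j) (v j)"
  obtains \<gamma> where "billiard_trajectory \<gamma>"
    "\<And>j s. 0 \<le> s \<Longrightarrow> s < t (j + 1) - t j \<Longrightarrow> \<gamma> (t j + s) = (q j + s *\<^sub>R v j, v j)"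
proof -
  define idx where "idx T = (THE j. t j \<le> T \<and> T < t (j + 1))" for T
  define \<gamma> where "\<gamma> T = (q (idx T) + (T - t (idx T)) *\<^sub>R v (idx T), v (idx T))" for T
  have ex1: "\<exists>!j. t j \<le> T \<and> T < t (j + 1)" for T using int_index_exists[OF mono up down] .
  have g: "\<gamma> (t j + s) = (q j + s *\<^sub>R v j, v j)" if "0 \<le> s" "s < t (j + 1) - t j" for j s
  proof -
    have "idx (t j + s) = j" unfolding idx_def using ex1[of "t j + s"] that by (intro the1_equality) auto
    then show ?thesis by (simp add: \<gamma>_def)
  qed
  have "billiard_trajectory \<gamma>"
  proof (rule billiard_trajectoryI)
    fix T
    obtain j where j: "t j \<le> T" "T < t (j + 1)" using ex1 by blast
    define s where "s = T - t j"
    have s: "0 \<le> s" "s < t (j + 1) - t j" "T = t j + s" using j by (auto simp: s_def)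
    have gT: "\<gamma> T = (q j + s *\<^sub>R v j, v j)" using g s by simp
    show "\<gamma> T \<in> S_Omega" unfolding gT S_Omega_def using mem[of j] seg[of s j] s unit by (cases "s = 0") auto
    have "free_after \<gamma> T (t (j + 1) - t j - s)" unfolding free_after_def
    proof (intro allI impI)
      fix u assume "0 \<le> u \<and> u < t (j + 1) - t j - s"
      then show "\<gamma> (T + u) = (fst (\<gamma> T) + u *\<^sub>R snd (\<gamma> T), snd (\<gamma> T))"
        using g[of "s + u" j] gT s(1) unfolding s(3) by (simp add: algebra_simps)
    qed
    then show "\<exists>\<epsilon>>0. free_after \<gamma> T \<epsilon>" using s by (intro exI[of _ "t (j + 1) - t j - s"]) simp
    show "\<exists>\<epsilon>>0. free_before \<gamma> T \<epsilon>"
    proof (cases "s = 0")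
      case True
      have r: "arrival (\<gamma> T) = v (j - 1)" using refl[of j] gT True by (simp add: arrival_def)
      show ?thesis unfolding free_before_def r
      proof (intro exI[of _ "t j - t (j - 1)"] conjI allI impI)
        fix u assume u: "0 < u \<and> u < t j - t (j - 1)"
        have "\<gamma> (T - u) = (q (j - 1) + (t j - t (j - 1) - u) *\<^sub>R v (j - 1), v (j - 1))"
          using g[of "t j - t (j - 1) - u" "j - 1"] u s True by simp
        then show "\<gamma> (T - u) = (fst (\<gamma> T) - u *\<^sub>R v (j - 1), v (j - 1))"
          using step[of "j - 1"] gT True by (simp add: algebra_simps)
      qed (use mono[of "j - 1"] in simp)
    next
      case False
      have r: "arrival (\<gamma> T) = v j"
        using seg[of s j] s False gT by (auto simp: arrival_def incoming_def reflect_tangent)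
      show ?thesis unfolding free_before_def r
      proof (intro exI[of _ s] conjI allI impI)
        fix u assume u: "0 < u \<and> u < s"
        then have "\<gamma> (T - u) = (q j + (s - u) *\<^sub>R v j, v j)" using g[of "s - u" j] s by (simp add: algebra_simps)
        then show "\<gamma> (T - u) = (fst (\<gamma> T) - u *\<^sub>R v j, v j)" using gT by (simp add: algebra_simps)
      qed (use s False in auto)
    qed
  qed
  then show thesis using that g by blast
qed

section \<open>The first entry into a ball\<close>

definition hits :: "phase \<Rightarrow> bool" where
  "hits x \<longleftrightarrow> (\<exists>s>0. fst x + s *\<^sub>R snd x \<in> interior K)"

text \<open>The value 1 for a ray that never enters a ball serves to continue the recursion \<open>nxt\<close> for such a ray: it is
  then cut into pieces of unit length.\<close>

definition ret :: "phase \<Rightarrow> real" where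
  "ret x = (if hits x then Inf {s. s > 0 \<and> fst x + s *\<^sub>R snd x \<in> interior K} else 1)"

definition nxt :: "phase \<Rightarrow> phase" where
  "nxt x = (let q = fst x + ret x *\<^sub>R snd x in (q, if hits x then reflect q (snd x) else snd x))"

text \<open>If the velocity had a radial component, the particle would be inside the ball shortly after or shortly before.\<close>

lemma tangential_contact:
  assumes v: "norm v = 1" and q: "q \<in> frontier K" and e: "e > 0"
    and out: "\<And>s. \<bar>s\<bar> < e \<Longrightarrow> q + s *\<^sub>R v \<notin> interior K"
  shows "v \<bullet> normal q = 0"
proof (rule ccontr)
  let ?i = "ball_index q" let ?p = "q - cen ?i"
  assume a: "v \<bullet> normal q \<noteq> 0"
  have i: "?i \<in> {1..k0}" "norm ?p = rad ?i" "rad ?i > 0" using frontierE[OF q] by blast+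
  have pv: "?p \<bullet> v = rad ?i * (v \<bullet> normal q)" using i by (simp add: normal_def inner_commute)
  then have pv0: "?p \<bullet> v \<noteq> 0" using a i by simp
  \<comment> \<open>The sign makes the linear term of the squared distance negative, the size makes it win over \<open>s\<^sup>2\<close>.\<close>
  define s where "s = - sgn (?p \<bullet> v) * min (e / 2) \<bar>?p \<bullet> v\<bar>"
  have abs: "\<bar>s\<bar> = min (e / 2) \<bar>?p \<bullet> v\<bar>" using pv0 e by (simp add: s_def abs_mult abs_sgn_eq)
  have "s * (?p \<bullet> v) = - (\<bar>s\<bar> * \<bar>?p \<bullet> v\<bar>)"
    using pv0 unfolding abs by (simp add: s_def sgn_if)
  moreover have "s\<^sup>2 \<le> \<bar>s\<bar> * \<bar>?p \<bullet> v\<bar>"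
    using abs by (metis abs_ge_zero min.cobounded2 mult_left_mono power2_abs power2_eq_square)
  moreover have "\<bar>s\<bar> * \<bar>?p \<bullet> v\<bar> > 0" using abs pv0 e by simp
  ultimately have "2 * s * (?p \<bullet> v) + s\<^sup>2 < 0" by linarith
  then have "(norm (?p + s *\<^sub>R v))\<^sup>2 < (rad ?i)\<^sup>2" using norm_add_scaleR_sq[OF v, of ?p s] i by simp
  then have "norm (?p + s *\<^sub>R v) < rad ?i" using i by (simp add: power2_less_imp_less)
  then have "q + s *\<^sub>R v \<in> ball (cen ?i) (rad ?i)"
    by (simp add: dist_norm norm_minus_commute algebra_simps)
  then have "q + s *\<^sub>R v \<in> interior K" using i unfolding interior_K by blast
  moreover have "\<bar>s\<bar> < e" using abs e by linarith
  ultimately show False using out by blast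
qed

text \<open>A ray that starts outwards on one ball cannot come back to it, and every other ball is at least \<open>gap\<close> away.
  Just after the infimum of the times inside the balls the particle is inside a ball, so at that time it moves
  towards its centre.\<close>

lemma first_entry:
  assumes x: "x \<in> M1" and h: "hits x"
  defines "q' \<equiv> fst x + ret x *\<^sub>R snd x"
  shows "gap \<le> ret x" "q' \<in> frontier K" "snd x \<bullet> normal q' < 0"
    "\<And>s. 0 < s \<Longrightarrow> s < ret x \<Longrightarrow> fst x + s *\<^sub>R snd x \<notin> interior K"
    "ball_index q' \<noteq> ball_index (fst x)"
proof -
  let ?q = "fst x" let ?v = "snd x" let ?i = "ball_index ?q"
  let ?S = "{s. s > 0 \<and> ?q + s *\<^sub>R ?v \<in> interior K}"
  have nv: "norm ?v = 1" and qf: "?q \<in> frontier K" and vn: "?v \<bullet> normal ?q > 0"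
    using M1_D[OF x] by auto
  have i: "?i \<in> {1..k0}" "?q \<in> Kball ?i" using frontierE[OF qf] by blast+
  have S: "?S \<noteq> {}" using h by (auto simp: hits_def)
  have r: "ret x = Inf ?S" using h by (simp add: ret_def)
  have memS: "\<exists>l\<in>{1..k0}. l \<noteq> ?i \<and> ?q + s *\<^sub>R ?v \<in> ball (cen l) (rad l) \<and> gap \<le> s" if s: "s \<in> ?S" for s
  proof -
    obtain l where l: "l \<in> {1..k0}" "?q + s *\<^sub>R ?v \<in> ball (cen l) (rad l)"
      using s unfolding interior_K by blast
    have lK: "?q + s *\<^sub>R ?v \<in> Kball l" using l by (simp add: Kball_def)
    have "l \<noteq> ?i" using outgoing_ray_leaves[OF qf nv, of s] vn s lK by auto
    moreover have "gap \<le> dist ?q (?q + s *\<^sub>R ?v)"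
      using dist_balls_ge_gap[OF i(1) l(1) _ i(2) lK] \<open>l \<noteq> ?i\<close> by simp
    ultimately show ?thesis using l nv s by (auto simp: dist_norm)
  qed
  have bdd: "bdd_below ?S" by (rule bdd_belowI[of _ 0]) auto
  show "gap \<le> ret x" unfolding r using memS by (intro cInf_greatest[OF S]) blast
  then have rpos: "ret x > 0" using gap_pos by linarith
  show before: "?q + s *\<^sub>R ?v \<notin> interior K" if "0 < s" "s < ret x" for s
    using that cInf_lower[OF _ bdd, of s] unfolding r by force
  have nint: "q' \<notin> interior K"
  proof
    assume "q' \<in> interior K"
    then obtain e where e: "e > 0" "ball q' e \<subseteq> interior K" using openE[OF open_interior] by blast
    define s where "s = ret x - min e (ret x) / 2"
    have s: "0 < s" "s < ret x" "ret x - s < e" using e rpos by (auto simp: s_def min_def field_simps)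
    have "dist q' (?q + s *\<^sub>R ?v) = norm ((ret x - s) *\<^sub>R ?v)"
      by (simp add: q'_def dist_norm algebra_simps)
    also have "\<dots> < e" using s nv by simp
    finally have "?q + s *\<^sub>R ?v \<in> interior K" using e by auto
    then show False using before s by blast
  qed
  have near: "\<exists>s\<in>?S. ret x < s \<and> s < ret x + e" if "e > 0" for e
  proof -
    have "Inf ?S < ret x + e" using that r by simp
    then obtain s where s: "s \<in> ?S" "s < ret x + e" using cInf_lessD[OF S] by blast
    have "ret x \<le> s" unfolding r using cInf_lower[OF s(1) bdd] .
    moreover have "s \<noteq> ret x" using s nint by (auto simp: q'_def)
    ultimately show ?thesis using s by (intro bexI[of _ s]) auto
  qed
  have "q' \<in> closure (interior K)"
  proof (unfold closure_approachable, intro allI impI)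
    fix e :: real assume "e > 0"
    then obtain s where s: "s \<in> ?S" "ret x < s" "s < ret x + e" using near by blast
    have "dist (?q + s *\<^sub>R ?v) q' = norm ((s - ret x) *\<^sub>R ?v)"
      by (simp add: q'_def dist_norm algebra_simps)
    also have "\<dots> < e" using s nv by simp
    finally show "\<exists>y\<in>interior K. dist y q' < e" using s by blast
  qed
  then have qK: "q' \<in> K" using closed_K interior_subset[of K] closure_minimal by blast
  then show qf': "q' \<in> frontier K" using nint by (simp add: frontier_def closed_K)
  let ?l = "ball_index q'" let ?p = "q' - cen ?l"
  have l: "?l \<in> {1..k0}" "norm ?p = rad ?l" "rad ?l > 0" "q' \<in> Kball ?l" using frontierE[OF qf'] by blast+
  obtain s where s: "s \<in> ?S" "ret x < s" "s < ret x + gap" using near[OF gap_pos] by blast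
  obtain m where m: "m \<in> {1..k0}" "m \<noteq> ?i" "?q + s *\<^sub>R ?v \<in> ball (cen m) (rad m)" using memS[OF s(1)] by blast
  have dq: "?q + s *\<^sub>R ?v = q' + (s - ret x) *\<^sub>R ?v" by (simp add: q'_def algebra_simps)
  have "m = ?l"
  proof (rule ccontr)
    assume "m \<noteq> ?l"
    then have "gap \<le> dist q' (?q + s *\<^sub>R ?v)"
      using dist_balls_ge_gap[OF l(1) m(1) _ l(4)] m(3) by (simp add: Kball_def)
    then show False unfolding dq using s nv by (simp add: dist_norm)
  qed
  then show "?l \<noteq> ?i" using m by simp
  have "norm (?p + (s - ret x) *\<^sub>R ?v) < rad ?l"
    using m(3) unfolding dq \<open>m = ?l\<close> by (simp add: dist_norm norm_minus_commute algebra_simps)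
  then have "(norm (?p + (s - ret x) *\<^sub>R ?v))\<^sup>2 < (rad ?l)\<^sup>2"
    by (intro power_strict_mono) auto
  then have "2 * (s - ret x) * (?p \<bullet> ?v) + (s - ret x)\<^sup>2 < 0"
    using norm_add_scaleR_sq[OF nv, of ?p "s - ret x"] l by simp
  then have "2 * (s - ret x) * (?p \<bullet> ?v) < 0" using zero_le_power2[of "s - ret x"] by linarith
  then have "?p \<bullet> ?v < 0" using s by (simp add: mult_less_0_iff)
  then show "?v \<bullet> normal q' < 0" using l by (simp add: normal_def inner_commute mult_less_0_iff)
qed

text \<open>Just behind a point of transversal arrival the ray is inside the ball, so the infimum is attained at that point.\<close>

lemma first_entry_eqI:
  assumes v: "norm (snd x) = 1" and t: "t > 0" and q': "fst x + t *\<^sub>R snd x \<in> frontier K"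
    and inc: "snd x \<bullet> normal (fst x + t *\<^sub>R snd x) < 0"
    and out: "\<And>s. 0 < s \<Longrightarrow> s < t \<Longrightarrow> fst x + s *\<^sub>R snd x \<notin> interior K"
  shows "hits x" "ret x = t" "nxt x = (fst x + t *\<^sub>R snd x, reflect (fst x + t *\<^sub>R snd x) (snd x))"
proof -
  let ?S = "{s. s > 0 \<and> fst x + s *\<^sub>R snd x \<in> interior K}"
  let ?q = "fst x + t *\<^sub>R snd x" let ?l = "ball_index ?q" let ?p = "?q - cen ?l"
  have l: "?l \<in> {1..k0}" "norm ?p = rad ?l" "rad ?l > 0" using frontierE[OF q'] by blast+
  have pv: "?p \<bullet> snd x < 0"
    using inc l by (simp add: normal_def inner_commute mult_less_0_iff)
  have ent: "t + u \<in> ?S" if u: "0 < u" "u < - (?p \<bullet> snd x)" for u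
  proof -
    have "u * u < u * (- (?p \<bullet> snd x))" using u by (intro mult_strict_left_mono)
    then have "2 * u * (?p \<bullet> snd x) + u\<^sup>2 < 0"
      using mult_pos_neg[OF u(1) pv] unfolding power2_eq_square by linarith
    then have "(norm (?p + u *\<^sub>R snd x))\<^sup>2 < (rad ?l)\<^sup>2" using norm_add_scaleR_sq[OF v, of ?p u] l by simp
    then have "norm (?p + u *\<^sub>R snd x) < rad ?l" using l by (simp add: power2_less_imp_less)
    then have "fst x + (t + u) *\<^sub>R snd x \<in> ball (cen ?l) (rad ?l)"
      by (simp add: dist_norm norm_minus_commute algebra_simps)
    then show ?thesis using l t u unfolding interior_K by force
  qed
  have "t + - (?p \<bullet> snd x) / 2 \<in> ?S" using ent[of "- (?p \<bullet> snd x) / 2"] pv by simp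
  then have ne: "?S \<noteq> {}" by (metis empty_iff)
  then show h: "hits x" unfolding hits_def by blast
  have "?q \<notin> interior K" using q' by (simp add: frontier_def)
  then have ge: "t \<le> s" if "s \<in> ?S" for s using that out[of s] by (cases "s < t") auto
  have "Inf ?S = t"
  proof (rule antisym)
    show "t \<le> Inf ?S" using ge by (intro cInf_greatest[OF ne])
    show "Inf ?S \<le> t"
    proof (rule field_le_epsilon)
      fix e :: real assume e: "e > 0"
      define u where "u = min e (- (?p \<bullet> snd x) / 2)"
      have u: "0 < u" "u < - (?p \<bullet> snd x)" "u \<le> e" using e pv by (auto simp: u_def min_def)
      have "bdd_below ?S" by (rule bdd_belowI[of _ 0]) auto
      then have "Inf ?S \<le> t + u" by (intro cInf_lower[OF ent[OF u(1,2)]])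
      then show "Inf ?S \<le> t + e" using u by simp
    qed
  qed
  then show r: "ret x = t" using h by (simp add: ret_def)
  show "nxt x = (?q, reflect ?q (snd x))" using h by (simp add: nxt_def r Let_def)
qed

lemma nxt_M1: "\<lbrakk>x \<in> M1; hits x\<rbrakk> \<Longrightarrow> nxt x \<in> M1"
  using first_entry[of x] M1_D[of x]
  by (auto simp: nxt_def Let_def M1_def norm_reflect reflect_inner_normal)

section \<open>Existence of trajectories\<close>

text \<open>The states met while following a trajectory from collision to collision. The second disjunct, a particle
  that never hits a ball again, makes the sequence of recorded states infinite in all cases.\<close>

definition recorded_state :: "phase \<Rightarrow> bool" where
  "recorded_state x \<longleftrightarrow> x \<in> M1 \<or>
     norm (snd x) = 1 \<and> fst x \<in> Omega \<and> \<not> hits x \<and> (fst x \<in> frontier K \<longrightarrow> snd x \<bullet> normal (fst x) = 0)"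

lemma recorded_state_unit_Omega:
  "recorded_state x \<Longrightarrow> norm (snd x) = 1" "recorded_state x \<Longrightarrow> fst x \<in> Omega"
  unfolding recorded_state_def using M1_D frontier_K_Omega by blast+

lemma ret_ge: "recorded_state x \<Longrightarrow> min gap 1 \<le> ret x"
  unfolding recorded_state_def using first_entry(1)[of x] by (cases "hits x") (auto simp: ret_def)

lemma ret_pos: "recorded_state x \<Longrightarrow> ret x > 0"
  using ret_ge[of x] gap_pos by (auto simp: min_def split: if_splits)

lemma fst_nxt: "fst (nxt x) = fst x + ret x *\<^sub>R snd x"
  by (simp add: nxt_def Let_def)

lemma not_inside_before_ret:
  assumes "recorded_state x" "0 < s" "s < ret x \<or> \<not> hits x"
  shows "fst x + s *\<^sub>R snd x \<notin> interior K"
proof (cases "hits x")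
  case True
  then show ?thesis using assms first_entry(4)[of x s] by (auto simp: recorded_state_def)
qed (use assms in \<open>auto simp: hits_def\<close>)

lemma flight_segment:
  assumes a: "recorded_state x" and s: "0 < s" "s < ret x \<or> \<not> hits x"
  shows "fst x + s *\<^sub>R snd x \<in> Omega"
    "fst x + s *\<^sub>R snd x \<in> frontier K \<Longrightarrow> snd x \<bullet> normal (fst x + s *\<^sub>R snd x) = 0"
proof -
  show "fst x + s *\<^sub>R snd x \<in> Omega" using not_inside_before_ret[OF assms] by (simp add: Omega_eq)
  assume f: "fst x + s *\<^sub>R snd x \<in> frontier K"
  define e where "e = (if hits x then min s (ret x - s) else s)"
  show "snd x \<bullet> normal (fst x + s *\<^sub>R snd x) = 0"
  proof (rule tangential_contact[OF _ f, of _ e])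
    show "norm (snd x) = 1" using recorded_state_unit_Omega a by blast
    show "e > 0" using s by (auto simp: e_def)
    fix u assume u: "\<bar>u\<bar> < e"
    have "fst x + s *\<^sub>R snd x + u *\<^sub>R snd x = fst x + (s + u) *\<^sub>R snd x" by (simp add: algebra_simps)
    also have "\<dots> \<notin> interior K" using u s by (intro not_inside_before_ret[OF a]) (auto simp: e_def split: if_splits)
    finally show "fst x + s *\<^sub>R snd x + u *\<^sub>R snd x \<notin> interior K" .
  qed
qed

lemma nxt_recorded:
  assumes a: "recorded_state x"
  shows "recorded_state (nxt x)" "snd x = incoming (fst (nxt x)) (snd (nxt x))"
proof -
  have "recorded_state (nxt x) \<and> snd x = incoming (fst (nxt x)) (snd (nxt x))"
  proof (cases "hits x")
    case True
    then have "x \<in> M1" using a by (simp add: recorded_state_def)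
    then show ?thesis using nxt_M1[of x] first_entry(2)[of x] True
      by (auto simp: recorded_state_def incoming_def nxt_def Let_def reflect_reflect)
  next
    case False
    have n: "nxt x = (fst x + snd x, snd x)" using False by (simp add: nxt_def ret_def)
    have t: "fst x + snd x \<in> Omega" "fst x + snd x \<in> frontier K \<Longrightarrow> snd x \<bullet> normal (fst x + snd x) = 0"
      using flight_segment[OF a, of 1] False by auto
    have "\<not> hits (nxt x)"
    proof
      assume "hits (nxt x)"
      then obtain s where "s > 0" "fst x + snd x + s *\<^sub>R snd x \<in> interior K" by (auto simp: hits_def n)
      then have "1 + s > 0" "fst x + (1 + s) *\<^sub>R snd x \<in> interior K" by (auto simp: algebra_simps)
      then show False using False unfolding hits_def by blast
    qed
    then show ?thesis using t recorded_state_unit_Omega[OF a]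
      by (auto simp: recorded_state_def n incoming_def reflect_tangent)
  qed
  then show "recorded_state (nxt x)" "snd x = incoming (fst (nxt x)) (snd (nxt x))" by auto
qed

lemma nxt_iterate_recorded: "recorded_state x \<Longrightarrow> recorded_state ((nxt ^^ n) x)"
  by (induction n) (auto intro: nxt_recorded)

definition reversal :: "phase \<Rightarrow> phase" where
  "reversal x = (fst x, - reflect (fst x) (snd x))"

lemma reversal_M1: "x \<in> M1 \<Longrightarrow> reversal x \<in> M1"
  by (auto simp: reversal_def M1_def norm_reflect reflect_inner_normal)

lemma reversal_reversal: "x \<in> M1 \<Longrightarrow> reversal (reversal x) = x"
  by (auto simp: reversal_def M1_def reflect_minus reflect_reflect)

definition record_time :: "phase \<Rightarrow> nat \<Rightarrow> real" where
  "record_time x n = (\<Sum>i<n. ret ((nxt ^^ i) x))"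

lemma record_time_ge:
  assumes "recorded_state x"
  shows "real n * min gap 1 \<le> record_time x n"
proof (induction n)
  case (Suc n)
  then show ?case using ret_ge[OF nxt_iterate_recorded[OF assms], of n]
    by (simp add: record_time_def algebra_simps)
qed (simp add: record_time_def)

lemma record_time_unbounded:
  assumes "recorded_state x"
  shows "\<exists>n. T < record_time x n"
proof -
  have m: "min gap 1 > 0" using gap_pos by simp
  obtain n where "T < real n * min gap 1" using reals_Archimedean3[OF m] by blast
  then show ?thesis using record_time_ge[OF assms, of n] by (intro exI[of _ n]) linarith
qed

text \<open>The recorded states that follow \<open>x\<close> give the future of the trajectory, and those that follow the reversal of \<open>x\<close>,
  run backwards, give the past. The times between records are bounded below, so the whole time axis is covered.\<close>

lemma trajectory_exists:
  assumes x: "x \<in> M1"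
  obtains \<gamma> where "billiard_trajectory \<gamma>" "\<gamma> 0 = x"
    "\<And>n s. 0 \<le> s \<Longrightarrow> s < ret ((nxt ^^ n) x) \<Longrightarrow>
       \<gamma> (record_time x n + s) = (fst ((nxt ^^ n) x) + s *\<^sub>R snd ((nxt ^^ n) x), snd ((nxt ^^ n) x))"
proof -
  define y where "y = reversal x"
  have ax: "recorded_state x" and ay: "recorded_state y"
    using x reversal_M1 by (auto simp: recorded_state_def y_def)
  define f where "f n = (nxt ^^ n) x" for n
  define b where "b n = (nxt ^^ n) y" for n
  have fS: "f (Suc n) = nxt (f n)" and bS: "b (Suc n) = nxt (b n)" for n by (auto simp: f_def b_def)
  have af: "recorded_state (f n)" and ab: "recorded_state (b n)" for n
    using nxt_iterate_recorded ax ay by (auto simp: f_def b_def)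
  define t where "t j = (if j \<ge> 0 then record_time x (nat j) else - record_time y (nat (- j)))" for j :: int
  define q where "q j = (if j \<ge> 0 then fst (f (nat j)) else fst (b (nat (- j))))" for j :: int
  define v where "v j = (if j \<ge> 0 then snd (f (nat j)) else - snd (b (nat (- j) - 1)))" for j :: int
  have cases_j: "(\<exists>n. j = int n) \<or> (\<exists>n. j = - int (Suc n))" for j :: int
    by (metis int_cases)
  have tp: "t (int n) = record_time x n" and tn: "t (- int n) = - record_time y n" for n
    by (auto simp: t_def record_time_def)
  have qp: "q (int n) = fst (f n)" and qn: "q (- int n) = fst (b n)" for n
    by (auto simp: q_def f_def b_def y_def reversal_def)
  have vp: "v (int n) = snd (f n)" and vn: "v (- int (Suc n)) = - snd (b n)" for n
    by (auto simp: v_def nat_add_distrib)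
  have dt: "t (j + 1) - t j = (if j \<ge> 0 then ret (f (nat j)) else ret (b (nat (- j) - 1)))" for j
    using cases_j[of j]
  proof (elim disjE exE)
    fix n assume j: "j = int n"
    have "t (j + 1) = record_time x (Suc n)" using tp[of "Suc n"] j by (simp add: add.commute)
    then show ?thesis using tp[of n] j by (simp add: record_time_def f_def)
  next
    fix n assume j: "j = - int (Suc n)"
    have e: "j + 1 = - int n" using j by simp
    show ?thesis unfolding e tn using tn[of "Suc n"] j by (simp add: record_time_def b_def nat_add_distrib)
  qed
  obtain \<gamma> where g: "billiard_trajectory \<gamma>"
    "\<And>j s. 0 \<le> s \<Longrightarrow> s < t (j + 1) - t j \<Longrightarrow> \<gamma> (t j + s) = (q j + s *\<^sub>R v j, v j)"
  proof (rule glued_trajectory[of t q v])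
    show "t j < t (j + 1)" for j using dt[of j] ret_pos af ab by (auto split: if_splits simp: algebra_simps)
    show "\<exists>j. T < t j" for T
      using record_time_unbounded[OF ax, of T] tp by metis
    show "\<exists>j. t j \<le> T" for T
      using record_time_unbounded[OF ay, of "- T"] tn by (metis less_eq_real_def minus_less_iff)
    show "norm (v j) = 1" for j using recorded_state_unit_Omega af ab by (auto simp: v_def)
    show "q j \<in> Omega" for j using recorded_state_unit_Omega af ab by (auto simp: q_def)
    show "q (j + 1) = q j + (t (j + 1) - t j) *\<^sub>R v j" for j
      using cases_j[of j]
    proof (elim disjE exE)
      fix n assume j: "j = int n"
      show ?thesis unfolding dt using qp[of "Suc n"] qp[of n] vp[of n] j
        by (simp add: fS fst_nxt add.commute)
    next
      fix n assume j: "j = - int (Suc n)"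
      have e: "j + 1 = - int n" using j by simp
      show ?thesis unfolding dt unfolding e qn using qn[of "Suc n"] vn[of n] j
        by (simp add: bS fst_nxt nat_add_distrib)
    qed
    show "q j + s *\<^sub>R v j \<in> Omega \<and> (q j + s *\<^sub>R v j \<in> frontier K \<longrightarrow> v j \<bullet> normal (q j + s *\<^sub>R v j) = 0)"
      if s: "0 < s" "s < t (j + 1) - t j" for j s
      using cases_j[of j]
    proof (elim disjE exE)
      fix n assume j: "j = int n"
      show ?thesis using flight_segment[OF af, of s n] s vp[of n] qp[of n] j unfolding dt by simp
    next
      fix n assume j: "j = - int (Suc n)"
      have s': "s < ret (b n)" using s j unfolding dt by (simp add: nat_add_distrib)
      have "q j + s *\<^sub>R v j = fst (b n) + (ret (b n) - s) *\<^sub>R snd (b n)"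
        unfolding j qn vn by (simp add: bS fst_nxt scaleR_diff_left)
      then show ?thesis using flight_segment[OF ab, of "ret (b n) - s" n] s s' vn[of n] j by simp
    qed
    show "v (j - 1) = incoming (q j) (v j)" for j
    proof (cases "j = 0")
      case True
      have "v (- 1) = - snd y" using vn[of 0] by (simp add: b_def)
      then show ?thesis using True M1_D[OF x]
        by (simp add: q_def v_def f_def incoming_def y_def reversal_def)
    next
      case False
      from cases_j[of j] show ?thesis
      proof (elim disjE exE)
        fix n assume j: "j = int n"
        then obtain m where m: "n = Suc m" using False by (cases n) auto
        have e: "j - 1 = int m" using j m by simp
        show ?thesis unfolding e vp using nxt_recorded(2)[OF af[of m]] qp[of n] vp[of n]
          unfolding j m fS by simp
      next
        fix n assume j: "j = - int (Suc n)"
        have e: "j - 1 = - int (Suc (Suc n))" using j by simp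
        have "snd (b n) = incoming (fst (b (Suc n))) (snd (b (Suc n)))"
          using nxt_recorded(2)[OF ab[of n]] by (simp add: bS)
        then have "snd (b (Suc n)) = incoming (fst (b (Suc n))) (snd (b n))"
          by (simp add: incoming_incoming)
        then show ?thesis unfolding e unfolding j vn qn by (simp add: incoming_minus)
      qed
    qed
  qed blast
  have *: "\<gamma> (record_time x n + s) = (fst (f n) + s *\<^sub>R snd (f n), snd (f n))" if "0 \<le> s" "s < ret (f n)" for n s
    using g(2)[of s "int n"] that tp[of n] qp[of n] vp[of n] unfolding dt by simp
  have "\<gamma> 0 = x" using *[of 0 0] ret_pos[OF af[of 0]] by (simp add: record_time_def f_def)
  then show thesis using that g(1) * unfolding f_def by blast
qed

section \<open>The billiard map and its inverse\<close>

lemma billiard_flow_eq: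
  assumes x: "x \<in> M1" and g: "billiard_trajectory \<gamma>" "\<gamma> 0 = x"
  shows "billiard_flow t x = \<gamma> t"
proof -
  have "outgoing x = x" using M1_D[OF x] by (simp add: outgoing_def)
  then have "(THE \<gamma>. billiard_trajectory \<gamma> \<and> \<gamma> 0 = outgoing x) = \<gamma>"
    using g trajectory_unique by (intro the_equality) auto
  then show ?thesis by (simp add: billiard_flow_def)
qed

lemma billiard_flow_trajectory:
  assumes x: "x \<in> M1"
  shows "billiard_trajectory (\<lambda>t. billiard_flow t x)" "billiard_flow 0 x = x"
proof -
  obtain \<gamma> where g: "billiard_trajectory \<gamma>" "\<gamma> 0 = x" using trajectory_exists[OF x] by metis
  have "(\<lambda>t. billiard_flow t x) = \<gamma>" using billiard_flow_eq[OF x g] by auto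
  then show "billiard_trajectory (\<lambda>t. billiard_flow t x)" "billiard_flow 0 x = x" using g by auto
qed

lemma billiard_flow_recorded:
  assumes x: "x \<in> M1" and s: "0 \<le> s" "s < ret ((nxt ^^ n) x)"
  shows "billiard_flow (record_time x n + s) x = (fst ((nxt ^^ n) x) + s *\<^sub>R snd ((nxt ^^ n) x), snd ((nxt ^^ n) x))"
  using trajectory_exists[OF x] billiard_flow_eq[OF x] s by metis

lemma recorded_M1: "x \<in> M1 \<Longrightarrow> recorded_state x"
  by (simp add: recorded_state_def)

lemma billiard_flow_before_ret:
  assumes x: "x \<in> M1" and s: "0 \<le> s" "s < ret x"
  shows "billiard_flow s x = (fst x + s *\<^sub>R snd x, snd x)"
  using billiard_flow_recorded[OF x, of s 0] s by (simp add: record_time_def)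

lemma billiard_flow_ret: "x \<in> M1 \<Longrightarrow> billiard_flow (ret x) x = nxt x"
  using billiard_flow_recorded[of x 0 1] ret_pos[OF nxt_recorded(1)[OF recorded_M1]]
  by (simp add: record_time_def)

lemma billiard_flow_shift:
  assumes x: "x \<in> M1" and y: "billiard_flow s x \<in> M1"
  shows "billiard_flow t (billiard_flow s x) = billiard_flow (t + s) x"
  using billiard_flow_eq[OF y trajectory_shift[OF billiard_flow_trajectory(1)[OF x], of s]] by simp

text \<open>Before the first entry the particle touches the balls at most tangentially, and a tangential state is not in \<open>M1\<close>.\<close>

lemma billiard_map_eq_nxt:
  assumes x: "x \<in> M1" and h: "hits x"
  shows "billiard_map x = nxt x"
proof -
  have r: "ret x > 0" using ret_pos recorded_M1 x by blast
  have m: "billiard_flow (ret x) x \<in> M1" using billiard_flow_ret nxt_M1 x h by simp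
  have "(LEAST t. t > 0 \<and> billiard_flow t x \<in> M1) = ret x"
  proof (rule Least_equality)
    fix s assume s: "s > 0 \<and> billiard_flow s x \<in> M1"
    show "ret x \<le> s"
    proof (rule ccontr)
      assume "\<not> ret x \<le> s"
      then have s': "0 < s" "s < ret x" using s by auto
      have "(fst x + s *\<^sub>R snd x, snd x) \<in> M1" using billiard_flow_before_ret[OF x, of s] s s' by simp
      then show False using flight_segment(2)[OF recorded_M1[OF x], of s] s' M1_D by fastforce
    qed
  qed (use r m in auto)
  then show ?thesis unfolding billiard_map_def using x r m billiard_flow_ret[OF x] by auto
qed

lemma nxt_free:
  assumes "\<not> hits x"
  shows "(nxt ^^ n) x = (fst x + real n *\<^sub>R snd x, snd x) \<and> \<not> hits ((nxt ^^ n) x)"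
proof (induction n)
  case 0
  then show ?case using assms by simp
next
  case (Suc n)
  have nx: "nxt y = (fst y + snd y, snd y)" if "\<not> hits y" for y
    using that by (simp add: nxt_def ret_def)
  have "\<not> hits ((nxt ^^ n) x)" using Suc by blast
  from nx[OF this] have "(nxt ^^ Suc n) x = (fst ((nxt ^^ n) x) + snd ((nxt ^^ n) x), snd ((nxt ^^ n) x))"
    by simp
  then have e: "(nxt ^^ Suc n) x = (fst x + real (Suc n) *\<^sub>R snd x, snd x)"
    using Suc by (simp add: algebra_simps)
  have "\<not> hits ((nxt ^^ Suc n) x)"
  proof
    assume "hits ((nxt ^^ Suc n) x)"
    then obtain s where s: "s > 0" "fst x + real (Suc n) *\<^sub>R snd x + s *\<^sub>R snd x \<in> interior K"
      unfolding e hits_def fst_conv snd_conv by blast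
    then have "fst x + (real (Suc n) + s) *\<^sub>R snd x \<in> interior K"
      by (simp only: scaleR_add_left add.assoc)
    moreover have "real (Suc n) + s > 0" using s by (simp add: add_pos_pos)
    ultimately show False using assms unfolding hits_def by blast
  qed
  then show ?case using e by blast
qed

lemma M0_M1: "x \<in> M0 \<Longrightarrow> x \<in> M1"
  by (simp add: M0_def)

text \<open>A particle that never hits a ball again escapes to infinity.\<close>

lemma M0_hits:
  assumes x: "x \<in> M0"
  shows "hits x"
proof (rule ccontr)
  assume h: "\<not> hits x"
  have x1: "x \<in> M1" using x M0_M1 by blast
  obtain B where B: "\<And>t. norm (billiard_flow t x) \<le> B"
    using x unfolding M0_def bounded_iff by auto
  have t: "record_time x n = real n" for n
  proof -
    have "ret ((nxt ^^ i) x) = 1" for i using nxt_free[OF h, of i] unfolding ret_def by argo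
    then show ?thesis by (simp add: record_time_def)
  qed
  obtain n where n: "B + norm (fst x) < real n" using reals_Archimedean2 by blast
  have "ret ((nxt ^^ n) x) > 0" using ret_pos nxt_iterate_recorded recorded_M1 x1 by blast
  then have "billiard_flow (real n) x = (fst x + real n *\<^sub>R snd x, snd x)"
    using billiard_flow_recorded[OF x1, of 0 n] nxt_free[OF h, of n] t by simp
  then have "norm (fst x + real n *\<^sub>R snd x) \<le> B"
    using B[of "real n"] norm_fst_le[of "fst x + real n *\<^sub>R snd x" "snd x"] by (simp del: of_nat_add)
  moreover have "norm (real n *\<^sub>R snd x) = real n" using M1_D[OF x1] by simp
  ultimately show False using n norm_triangle_ineq4[of "fst x + real n *\<^sub>R snd x" "fst x"] M1_D(2)[OF x1] by simp
qed

lemma M0_billiard_map: "x \<in> M0 \<Longrightarrow> billiard_map x = nxt x"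
  using billiard_map_eq_nxt M0_M1 M0_hits by blast

lemma nxt_M0:
  assumes x: "x \<in> M0"
  shows "nxt x \<in> M0"
proof -
  have x1: "x \<in> M1" using x M0_M1 by blast
  have n1: "nxt x \<in> M1" using nxt_M1 M0_hits x x1 by blast
  have "billiard_flow t (nxt x) = billiard_flow (t + ret x) x" for t
    using billiard_flow_shift[OF x1, of "ret x"] billiard_flow_ret[OF x1] n1 by simp
  then have "range (\<lambda>t. billiard_flow t (nxt x)) \<subseteq> range (\<lambda>t. billiard_flow t x)" by auto
  then show ?thesis using x n1 unfolding M0_def by (auto intro: bounded_subset)
qed

lemma trajectory_bounded_iff:
  assumes "billiard_trajectory \<gamma>"
  shows "bounded (range \<gamma>) \<longleftrightarrow> bounded (range (\<lambda>t. fst (\<gamma> t)))"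
proof
  assume "bounded (range \<gamma>)"
  then have "bounded (fst ` range \<gamma>)" by (rule bounded_fst)
  then show "bounded (range (\<lambda>t. fst (\<gamma> t)))" by (simp add: image_image)
next
  assume b: "bounded (range (\<lambda>t. fst (\<gamma> t)))"
  have "\<gamma> t \<in> range (\<lambda>t. fst (\<gamma> t)) \<times> sphere 0 1" for t
    using trajectory_S_Omega[OF assms, of t] by (cases "\<gamma> t") (auto simp: S_Omega_def image_iff intro: exI[of _ t])
  then have "range \<gamma> \<subseteq> range (\<lambda>t. fst (\<gamma> t)) \<times> sphere 0 1" by blast
  then show "bounded (range \<gamma>)" using bounded_Times[OF b bounded_sphere] by (rule bounded_subset[rotated])
qed

lemma reversal_M0:
  assumes x: "x \<in> M0"
  shows "reversal x \<in> M0"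
proof -
  have x1: "x \<in> M1" using x M0_M1 by blast
  let ?g = "\<lambda>t. billiard_flow t x"
  let ?r = "\<lambda>t. (fst (?g (- t)), - arrival (?g (- t)))"
  have r: "billiard_trajectory ?r"
    using trajectory_reverse[OF billiard_flow_trajectory(1)[OF x1]] .
  have "?r 0 = reversal x" using billiard_flow_trajectory(2)[OF x1] M1_D[OF x1]
    by (simp add: reversal_def arrival_def incoming_def)
  then have e: "billiard_flow t (reversal x) = ?r t" for t
    using billiard_flow_eq[OF reversal_M1[OF x1] r] by blast
  have "bounded (range (\<lambda>t. fst (?g t)))"
    using x trajectory_bounded_iff[OF billiard_flow_trajectory(1)[OF x1]] by (simp add: M0_def)
  then have "bounded (range (\<lambda>t. fst (?r t)))" by (rule bounded_subset) auto
  then have "bounded (range ?r)" using trajectory_bounded_iff[OF r] by blast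
  then show ?thesis using reversal_M1[OF x1] e by (simp add: M0_def)
qed

text \<open>The segment between the two collisions is the same in both directions, and it is left transversally at both ends.\<close>

lemma nxt_reversal_nxt:
  assumes x: "x \<in> M1" and h: "hits x"
  shows "nxt (reversal (nxt x)) = reversal x"
proof -
  let ?q = "fst x + ret x *\<^sub>R snd x"
  have n: "nxt x = (?q, reflect ?q (snd x))" using h by (simp add: nxt_def Let_def)
  have qf: "?q \<in> frontier K" using first_entry(2)[OF x h] .
  have r: "reversal (nxt x) = (?q, - snd x)" by (simp add: n reversal_def reflect_reflect[OF qf])
  have "nxt (?q, - snd x) = (fst x, reflect (fst x) (- snd x))"
  proof -
    have "fst x + ret x *\<^sub>R snd x + s *\<^sub>R - snd x = fst x + (ret x - s) *\<^sub>R snd x" for s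
      by (simp add: algebra_simps)
    note e = this
    have "fst x + ret x *\<^sub>R snd x + s *\<^sub>R - snd x \<notin> interior K" if "0 < s" "s < ret x" for s
      unfolding e using first_entry(4)[OF x h, of "ret x - s"] that by simp
    moreover have "?q + ret x *\<^sub>R - snd x = fst x" by simp
    ultimately show ?thesis
      using first_entry_eqI(3)[of "(?q, - snd x)" "ret x"] M1_D[OF x] ret_pos[OF recorded_M1[OF x]]
      unfolding fst_conv snd_conv by (simp only: inner_minus_left neg_less_0_iff_less norm_minus_cancel simp_thms)
  qed
  then show ?thesis unfolding r by (simp add: reversal_def reflect_minus)
qed

text \<open>The inverse of the billiard map is its conjugate by the reversal, which preserves \<open>M0\<close>.\<close>

lemma billiard_map_bij: "bij_betw billiard_map M0 M0"
proof -
  have "inj_on billiard_map M0"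
  proof (rule inj_onI)
    fix x y assume x: "x \<in> M0" and y: "y \<in> M0" and e: "billiard_map x = billiard_map y"
    have "reversal x = reversal y"
      using e nxt_reversal_nxt[OF M0_M1 M0_hits, OF x x] nxt_reversal_nxt[OF M0_M1 M0_hits, OF y y]
      by (simp add: M0_billiard_map x y)
    then show "x = y" using reversal_reversal M0_M1 x y by metis
  qed
  moreover have "billiard_map ` M0 \<subseteq> M0" using M0_billiard_map nxt_M0 by auto
  moreover have "x \<in> billiard_map ` M0" if x: "x \<in> M0" for x
  proof -
    let ?r = "reversal x"
    have r: "?r \<in> M0" using reversal_M0[OF x] .
    let ?y = "reversal (nxt ?r)"
    have y: "?y \<in> M0" using reversal_M0[OF nxt_M0[OF r]] .
    have "nxt ?y = x" using nxt_reversal_nxt[OF M0_M1 M0_hits, OF r r] reversal_reversal[OF M0_M1[OF x]] by simp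
    then show ?thesis using M0_billiard_map[OF y] y by (metis image_eqI)
  qed
  ultimately show ?thesis unfolding bij_betw_def by blast
qed

lemma billiard_map_pow_M0:
  assumes x: "x \<in> M0"
  shows "billiard_map_pow j x \<in> M0"
    and "billiard_map_pow (j + 1) x = billiard_map (billiard_map_pow j x)"
    and "billiard_map_pow 0 x = x"
proof -
  let ?g = "inv_into M0 billiard_map"
  have fM: "billiard_map y \<in> M0" if "y \<in> M0" for y using bij_betw_apply[OF billiard_map_bij that] .
  have gM: "?g y \<in> M0" if "y \<in> M0" for y
    using bij_betw_apply[OF bij_betw_inv_into[OF billiard_map_bij] that] .
  have fg: "billiard_map (?g y) = y" if "y \<in> M0" for y
    using bij_betw_inv_into_right[OF billiard_map_bij that] .
  have fn: "(billiard_map ^^ n) x \<in> M0" for n by (induction n) (auto simp: x fM)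
  have gn: "(?g ^^ n) x \<in> M0" for n by (induction n) (auto simp: x gM)
  show "billiard_map_pow j x \<in> M0" by (simp add: billiard_map_pow_def fn gn)
  show "billiard_map_pow 0 x = x" by (simp add: billiard_map_pow_def)
  show "billiard_map_pow (j + 1) x = billiard_map (billiard_map_pow j x)"
  proof (cases "j \<ge> 0")
    case True
    then show ?thesis by (simp add: billiard_map_pow_def nat_add_distrib)
  next
    case False
    then obtain n where j: "j = - int (Suc n)" by (metis int_cases of_nat_0_le_iff)
    have e: "j + 1 = - int n" using j by simp
    have 1: "billiard_map_pow j x = ?g ((?g ^^ n) x)" unfolding j billiard_map_pow_def by (simp add: nat_add_distrib)
    have 2: "billiard_map_pow (j + 1) x = (?g ^^ n) x" unfolding e billiard_map_pow_def by simp
    show ?thesis unfolding 1 2 fg[OF gn] ..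
  qed
qed

end

section \<open>Chains of reflection points\<close>

lemma norm_diff_unit_sq:
  fixes u v :: "'a::real_inner"
  assumes "norm u = 1" "norm v = 1"
  shows "(norm (u - v))\<^sup>2 = 2 - 2 * (u \<bullet> v)"
proof -
  have "u \<bullet> u = 1" "v \<bullet> v = 1" using assms by (simp_all add: dot_square_norm)
  then show ?thesis unfolding power2_norm_eq_inner
    by (simp only: inner_diff_left inner_diff_right inner_commute[of v u])
qed

lemma inner_unit_combination:
  fixes m n :: "'a::real_inner"
  assumes "norm m = 1" "norm n = 1"
  shows "(m - n) \<bullet> ((2 * a) *\<^sub>R m - (2 * b) *\<^sub>R n) = 2 * (a + b) * (1 - m \<bullet> n)"
  using assms by (simp add: inner_diff_left inner_diff_right dot_square_norm inner_commute[of n m] algebra_simps)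

context separated_balls
begin

definition dir :: "(int \<Rightarrow> real^3) \<Rightarrow> int \<Rightarrow> real^3" where
  "dir q j = (q (j + 1) - q j) /\<^sub>R norm (q (j + 1) - q j)"

text \<open>The reflection points of a trajectory that collides for ever in the past and in the future. The law of
  reflection relates only successive points, which makes chains easier to construct and to compare than
  trajectories.\<close>

definition orbit_chain :: "(int \<Rightarrow> nat) \<Rightarrow> (int \<Rightarrow> real^3) \<Rightarrow> bool" where
  "orbit_chain z q \<longleftrightarrow> z \<in> Sigma_A k0 \<and> (\<forall>j. q j \<in> sphere (cen (z j)) (rad (z j)) \<and>
     0 < dir q j \<bullet> normal (q j) \<and> dir q (j - 1) = reflect (q j) (dir q j))"

lemma Sigma_A_D: "z \<in> Sigma_A k0 \<Longrightarrow> z j \<in> {1..k0}" "z \<in> Sigma_A k0 \<Longrightarrow> z j \<noteq> z (j + 1)"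
  by (auto simp: Sigma_A_def adj_def split: if_splits)

lemma orbit_chainD:
  assumes "orbit_chain z q"
  shows "z j \<in> {1..k0}" "z j \<noteq> z (j + 1)" "q j \<in> sphere (cen (z j)) (rad (z j))"
    "q j \<in> frontier K" "ball_index (q j) = z j" "normal (q j) = (q j - cen (z j)) /\<^sub>R rad (z j)"
    "0 < dir q j \<bullet> normal (q j)" "dir q (j - 1) = reflect (q j) (dir q j)"
    "gap \<le> norm (q (j + 1) - q j)" "norm (dir q j) = 1"
    "q (j + 1) = q j + norm (q (j + 1) - q j) *\<^sub>R dir q j" "rad (z j) > 0"
proof -
  have s: "q i \<in> sphere (cen (z i)) (rad (z i))" for i using assms by (auto simp: orbit_chain_def)
  have z: "z i \<in> {1..k0}" "z i \<noteq> z (i + 1)" for i using assms Sigma_A_D by (auto simp: orbit_chain_def)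
  show "z j \<in> {1..k0}" "z j \<noteq> z (j + 1)" "q j \<in> sphere (cen (z j)) (rad (z j))" by fact+
  then show "q j \<in> frontier K" unfolding frontier_K by blast
  show "rad (z j) > 0" using rad_pos z by blast
  show "ball_index (q j) = z j" using sphere_ball_index z s by blast
  show "normal (q j) = (q j - cen (z j)) /\<^sub>R rad (z j)" using sphere_normal z s by blast
  show "0 < dir q j \<bullet> normal (q j)" "dir q (j - 1) = reflect (q j) (dir q j)"
    using assms by (auto simp: orbit_chain_def)
  have "q j \<in> Kball (z j)" "q (j + 1) \<in> Kball (z (j + 1))" using s[of j] s[of "j + 1"] by (auto simp: Kball_def)
  then have g: "gap \<le> dist (q j) (q (j + 1))" using dist_balls_ge_gap z by blast
  then show "gap \<le> norm (q (j + 1) - q j)" by (simp add: dist_norm norm_minus_commute)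
  have n0: "norm (q (j + 1) - q j) \<noteq> 0" using g gap_pos by (auto simp: dist_norm norm_minus_commute)
  then show "norm (dir q j) = 1" by (simp add: dir_def)
  show "q (j + 1) = q j + norm (q (j + 1) - q j) *\<^sub>R dir q j" using n0 by (simp add: dir_def)
qed

lemma orbit_chain_shift:
  assumes "orbit_chain z q"
  shows "orbit_chain (\<lambda>j. z (j + i)) (\<lambda>j. q (j + i))" "dir (\<lambda>j. q (j + i)) j = dir q (j + i)"
proof -
  show d: "dir (\<lambda>j. q (j + i)) j = dir q (j + i)" for j by (simp add: dir_def add.assoc add.commute[of i 1])
  have a: "z j \<in> {1..k0}" "adj (z j) (z (j + 1)) = 1" for j
    using assms unfolding orbit_chain_def Sigma_A_def by auto
  have "adj (z (j + i)) (z (j + 1 + i)) = 1" for j using a(2)[of "j + i"] by (simp add: ac_simps)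
  then have "(\<lambda>j. z (j + i)) \<in> Sigma_A k0" using a(1) by (simp add: Sigma_A_def)
  moreover have "dir q (j - 1 + i) = reflect (q (j + i)) (dir q (j + i))" for j
  proof -
    have e: "j - 1 + i = j + i - 1" by simp
    show ?thesis using assms unfolding orbit_chain_def e by blast
  qed
  ultimately show "orbit_chain (\<lambda>j. z (j + i)) (\<lambda>j. q (j + i))"
    using assms unfolding orbit_chain_def d by simp
qed

lemma M0_orbit_chain:
  assumes x: "x \<in> M0"
  defines "X \<equiv> (\<lambda>j. billiard_map_pow j x)"
  shows "orbit_chain (coding x) (\<lambda>j. fst (X j))" "dir (\<lambda>j. fst (X j)) j = snd (X j)"
proof -
  have X0: "X j \<in> M0" for j
    unfolding X_def by (rule billiard_map_pow_M0(1)[OF x])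
  have X: "X (j + 1) = nxt (X j)" for j
    using billiard_map_pow_M0(2)[OF x, of j] M0_billiard_map[OF X0[of j]] unfolding X_def by (rule trans)
  have X1: "X j \<in> M1" for j by (rule M0_M1[OF X0])
  have h: "hits (X j)" for j by (rule M0_hits[OF X0])
  have r: "ret (X j) > 0" for j by (rule ret_pos[OF recorded_M1[OF X1]])
  have D: "dir (\<lambda>j. fst (X j)) j = snd (X j)" for j
    using r[of j] M1_D(2)[OF X1[of j]] by (simp add: dir_def X fst_nxt)
  then show "dir (\<lambda>j. fst (X j)) j = snd (X j)" .
  have b: "ball_index (fst (X j)) \<in> {1..k0}" "fst (X j) \<in> sphere (cen (ball_index (fst (X j)))) (rad (ball_index (fst (X j))))" for j
    using frontierE[OF M1_D(1)[OF X1[of j]]] by blast+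
  have ne: "ball_index (fst (X j)) \<noteq> ball_index (fst (X (j + 1)))" for j
    using first_entry(5)[OF X1[of j] h[of j]] by (simp add: X fst_nxt)
  have c: "coding x = (\<lambda>j. ball_index (fst (X j)))" by (simp add: coding_def X_def)
  have "snd (X (j - 1)) = reflect (fst (X j)) (snd (X j))" for j
  proof -
    have "X j = nxt (X (j - 1))" using X[of "j - 1"] by simp
    then show ?thesis
      using nxt_recorded(2)[OF recorded_M1[OF X1[of "j - 1"]]] M1_D(1)[OF X1[of j]]
      by (simp add: incoming_def)
  qed
  then show "orbit_chain (coding x) (\<lambda>j. fst (X j))"
    unfolding orbit_chain_def D c Sigma_A_def adj_def using b ne M1_D(3)[OF X1] by simp
qed

text \<open>Let \<open>w\<close> be the difference of the positions of two chains and \<open>u\<close> that of their velocities. During the flight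
  \<open>w \<bullet> u\<close> increases, because its derivative is \<open>\<bar>u\<bar>\<^sup>2\<close> for motion along straight lines. At a reflection in the same ball
  it increases by convexity: the velocities change by positive multiples of the normals, and the normals of a
  sphere diverge.\<close>

lemma divergence_step:
  assumes q: "orbit_chain z q" and q': "orbit_chain z' q'" and zz: "z (j + 1) = z' (j + 1)"
  shows "(q (j + 1) - q' (j + 1)) \<bullet> (dir q (j + 1) - dir q' (j + 1)) - (q j - q' j) \<bullet> (dir q j - dir q' j)
    \<ge> gap * (norm (dir q j - dir q' j))\<^sup>2
      + (dir q (j + 1) \<bullet> normal (q (j + 1))) / rad (z (j + 1)) * (norm (q (j + 1) - q' (j + 1)))\<^sup>2"
proof -
  let ?v = "dir q j" let ?v' = "dir q' j" let ?V = "dir q (j + 1)" let ?V' = "dir q' (j + 1)"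
  let ?l = "norm (q (j + 1) - q j)" let ?l' = "norm (q' (j + 1) - q' j)"
  let ?n = "normal (q (j + 1))" let ?n' = "normal (q' (j + 1))" let ?r = "rad (z (j + 1))"
  let ?c = "?V \<bullet> ?n" let ?c' = "?V' \<bullet> ?n'"
  let ?w = "q j - q' j" let ?W = "q (j + 1) - q' (j + 1)"
  have l: "gap \<le> ?l" "gap \<le> ?l'" using orbit_chainD(9)[OF q] orbit_chainD(9)[OF q'] .
  have u: "norm ?v = 1" "norm ?v' = 1" using orbit_chainD(10)[OF q] orbit_chainD(10)[OF q'] .
  have W: "?W = ?w + ?l *\<^sub>R ?v - ?l' *\<^sub>R ?v'"
    using orbit_chainD(11)[OF q, of j] orbit_chainD(11)[OF q', of j] by (simp add: algebra_simps)
  have r: "?r > 0" using orbit_chainD(12)[OF q] .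
  have c: "?c > 0" "?c' > 0" using orbit_chainD(7)[OF q] orbit_chainD(7)[OF q'] .
  have fl: "?W \<bullet> (?v - ?v') - ?w \<bullet> (?v - ?v') = (?l + ?l') * (norm (?v - ?v'))\<^sup>2 / 2"
  proof -
    have "?W \<bullet> (?v - ?v') - ?w \<bullet> (?v - ?v') = (?l + ?l') * (1 - ?v \<bullet> ?v')"
      unfolding W using u by (simp add: inner_diff_left inner_diff_right inner_add_left dot_square_norm inner_commute[of ?v' ?v] algebra_simps)
    then show ?thesis using norm_diff_unit_sq[OF u] by simp
  qed
  have V: "?v = ?V - (2 * ?c) *\<^sub>R ?n" "?v' = ?V' - (2 * ?c') *\<^sub>R ?n'"
    using orbit_chainD(8)[OF q, of "j + 1"] orbit_chainD(8)[OF q', of "j + 1"] by (simp_all add: reflect_def)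
  have nn: "norm ?n = 1" "norm ?n' = 1" using norm_normal[OF orbit_chainD(4)[OF q]] norm_normal[OF orbit_chainD(4)[OF q']] .
  have Wn: "?W = ?r *\<^sub>R (?n - ?n')"
  proof -
    have "?r *\<^sub>R ?n = q (j + 1) - cen (z (j + 1))" "?r *\<^sub>R ?n' = q' (j + 1) - cen (z (j + 1))"
      using orbit_chainD(6)[OF q, of "j + 1"] orbit_chainD(6)[OF q', of "j + 1"] zz r by simp_all
    then show ?thesis by (simp add: scaleR_diff_right)
  qed
  have nW: "(norm ?W)\<^sup>2 = ?r\<^sup>2 * (norm (?n - ?n'))\<^sup>2" unfolding Wn by (simp add: power_mult_distrib)
  have "?W \<bullet> (?V - ?V') - ?W \<bullet> (?v - ?v') = ?W \<bullet> ((2 * ?c) *\<^sub>R ?n - (2 * ?c') *\<^sub>R ?n')"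
    unfolding V by (simp add: inner_diff_right algebra_simps)
  also have "\<dots> = 2 * ?r * (?c + ?c') * (1 - ?n \<bullet> ?n')"
    unfolding Wn inner_scaleR_left inner_unit_combination[OF nn] by (simp only: ac_simps)
  also have "\<dots> = (?c + ?c') / ?r * (norm ?W)\<^sup>2"
    unfolding nW norm_diff_unit_sq[OF nn] using r by (simp add: power2_eq_square field_simps)
  finally have re: "?W \<bullet> (?V - ?V') - ?W \<bullet> (?v - ?v') = (?c + ?c') / ?r * (norm ?W)\<^sup>2" .
  have "gap * (norm (?v - ?v'))\<^sup>2 \<le> (?l + ?l') / 2 * (norm (?v - ?v'))\<^sup>2"
    using l by (intro mult_right_mono) auto
  moreover have "?c / ?r * (norm ?W)\<^sup>2 \<le> (?c + ?c') / ?r * (norm ?W)\<^sup>2"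
    using c r by (intro mult_right_mono divide_right_mono) auto
  ultimately show ?thesis using fl re by linarith
qed

lemma bounded_K: "bounded K"
  unfolding K_def Kball_def by (intro bounded_UN ballI bounded_cball) simp

end

section \<open>Broken lines of minimal length\<close>

text \<open>From \<open>2 \<bar>x\<bar> \<bar>x + t d\<bar> \<le> \<bar>x\<bar>\<^sup>2 + \<bar>x + t d\<bar>\<^sup>2\<close>.\<close>

lemma norm_add_le_second_order:
  fixes x d :: "'a::real_inner"
  assumes "x \<noteq> 0"
  shows "norm (x + t *\<^sub>R d) \<le> norm x + t * (x \<bullet> d) / norm x + t\<^sup>2 * (norm d)\<^sup>2 / (2 * norm x)"
proof -
  have n: "norm x > 0" using assms by simp
  have 1: "(norm (t *\<^sub>R d))\<^sup>2 = t\<^sup>2 * (norm d)\<^sup>2" by (simp add: power_mult_distrib)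
  have 2: "x \<bullet> (t *\<^sub>R d) = t * (x \<bullet> d)" by simp
  have y: "(norm (x + t *\<^sub>R d))\<^sup>2 = (norm x)\<^sup>2 + (2 * (t * (x \<bullet> d)) + t\<^sup>2 * (norm d)\<^sup>2)"
  proof -
    have "N = a + (2 * P + m)" if "P = (N - a - m) / 2" for N a m P :: real using that by simp
    then show ?thesis using dot_norm[of x "t *\<^sub>R d"] unfolding 1 2 .
  qed
  have "norm (x + t *\<^sub>R d) * (2 * norm x) \<le> (norm x)\<^sup>2 + (norm (x + t *\<^sub>R d))\<^sup>2"
    using sum_squares_bound[of "norm x" "norm (x + t *\<^sub>R d)"] by (simp only: ac_simps)
  then have "norm (x + t *\<^sub>R d) \<le> ((norm x)\<^sup>2 + ((norm x)\<^sup>2 + (2 * (t * (x \<bullet> d)) + t\<^sup>2 * (norm d)\<^sup>2))) / (2 * norm x)"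
    unfolding y using n by (subst pos_le_divide_eq) simp_all
  also have "(a\<^sup>2 + (a\<^sup>2 + (2 * (t * X) + t\<^sup>2 * D\<^sup>2))) / (2 * a) = a + t * X / a + t\<^sup>2 * D\<^sup>2 / (2 * a)"
    if "a > 0" for a X D :: real
    using that by (simp add: field_simps power2_eq_square)
  note this[OF n]
  finally show ?thesis .
qed

text \<open>The first variation of the length of a broken line whose vertex moves in the direction \<open>d\<close>.\<close>

lemma first_order_broken_line:
  fixes a b c d :: "'a::real_inner"
  assumes ab: "a \<noteq> b" and bc: "b \<noteq> c"
    and min: "\<And>t. 0 < t \<Longrightarrow> t \<le> 1 \<Longrightarrow> norm (b - a) + norm (c - b) \<le> norm (b + t *\<^sub>R d - a) + norm (c - (b + t *\<^sub>R d))"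
  shows "0 \<le> ((b - a) /\<^sub>R norm (b - a) - (c - b) /\<^sub>R norm (c - b)) \<bullet> d"
proof -
  define g where "g = ((b - a) /\<^sub>R norm (b - a) - (c - b) /\<^sub>R norm (c - b)) \<bullet> d"
  define M where "M = (norm d)\<^sup>2 / (2 * norm (b - a)) + (norm d)\<^sup>2 / (2 * norm (c - b))"
  have "0 \<le> g + t * M" if t: "0 < t" "t \<le> 1" for t
  proof -
    have e1: "norm (b + t *\<^sub>R d - a) = norm ((b - a) + t *\<^sub>R d)" by (simp add: algebra_simps)
    have e2: "norm (c - (b + t *\<^sub>R d)) = norm ((c - b) + t *\<^sub>R (- d))" by (simp add: algebra_simps)
    have "0 \<le> t * ((b - a) \<bullet> d) / norm (b - a) + t\<^sup>2 * (norm d)\<^sup>2 / (2 * norm (b - a))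
       + (t * ((c - b) \<bullet> (- d)) / norm (c - b) + t\<^sup>2 * (norm d)\<^sup>2 / (2 * norm (c - b)))"
      using min[OF t] norm_add_le_second_order[of "b - a" t d] norm_add_le_second_order[of "c - b" t "- d"] ab bc
      unfolding e1 e2 by simp
    also have "\<dots> = t * (g + t * M)"
    proof -
      have gd: "g = ((b - a) \<bullet> d) / norm (b - a) - ((c - b) \<bullet> d) / norm (c - b)"
        by (simp only: g_def inner_diff_left[of "(b - a) /\<^sub>R norm (b - a)"] inner_scaleR_left divide_inverse mult.commute)
      show ?thesis unfolding M_def gd
        by (simp add: algebra_simps power2_eq_square add_divide_distrib diff_divide_distrib)
    qed
    finally show ?thesis using t by (simp add: zero_le_mult_iff)
  qed
  note g = this
  have "0 \<le> g"
  proof (rule ccontr)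
    assume n: "\<not> 0 \<le> g"
    \<comment> \<open>Small enough for the linear term to win over the quadratic one.\<close>
    define t where "t = min 1 (- g / (2 * (\<bar>M\<bar> + 1)))"
    have t: "0 < t" "t \<le> 1" using n by (auto simp: t_def divide_neg_pos)
    have "t * M \<le> t * (\<bar>M\<bar> + 1)" using t by (intro mult_left_mono) auto
    also have "\<dots> \<le> - g / (2 * (\<bar>M\<bar> + 1)) * (\<bar>M\<bar> + 1)" by (intro mult_right_mono) (auto simp: t_def)
    also have "\<dots> = - g / 2" by (simp add: field_simps)
    finally show False using g[OF t] n by linarith
  qed
  then show ?thesis by (simp add: g_def)
qed

text \<open>At a minimum over the ball the gradient of the length, which is the difference of the two unit directions,
  points to the centre. When it does not vanish, the point is on the boundary and this is the law of reflection.\<close>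

lemma shortest_broken_line_reflects:
  fixes a b c m :: "'a::real_inner"
  assumes r: "r > 0" and b: "norm (b - m) \<le> r" and ab: "a \<noteq> b" and bc: "b \<noteq> c"
    and min: "\<And>p. norm (p - m) \<le> r \<Longrightarrow> norm (b - a) + norm (c - b) \<le> norm (p - a) + norm (c - p)"
  defines "e1 \<equiv> (b - a) /\<^sub>R norm (b - a)" and "e2 \<equiv> (c - b) /\<^sub>R norm (c - b)" and "n \<equiv> (b - m) /\<^sub>R r"
  assumes ne: "e1 \<noteq> e2"
  shows "norm (b - m) = r" "e2 \<bullet> n > 0" "e1 = e2 - (2 * (e2 \<bullet> n)) *\<^sub>R n"
proof -
  let ?G = "e1 - e2"
  have G: "norm ?G > 0" using ne by simp
  have u: "norm e1 = 1" "norm e2 = 1" using ab bc by (auto simp: e1_def e2_def)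
  \<comment> \<open>The point of the ball at which the linear functional \<open>?G\<close> is smallest; it can only be \<open>b\<close>.\<close>
  define p where "p = m - (r / norm ?G) *\<^sub>R ?G"
  have p: "norm (p - m) \<le> r" using r G by (simp add: p_def)
  have "0 \<le> ?G \<bullet> (p - b)"
    unfolding e1_def e2_def
  proof (rule first_order_broken_line[OF ab bc])
    fix t :: real assume t: "0 < t" "t \<le> 1"
    have "b + t *\<^sub>R (p - b) - m = (1 - t) *\<^sub>R (b - m) + t *\<^sub>R (p - m)" by (simp add: algebra_simps)
    then have "norm (b + t *\<^sub>R (p - b) - m) \<le> (1 - t) * norm (b - m) + t * norm (p - m)"
      using t norm_triangle_ineq[of "(1 - t) *\<^sub>R (b - m)" "t *\<^sub>R (p - m)"] by simp
    also have "\<dots> \<le> (1 - t) * r + t * r" using t b p by (intro add_mono mult_left_mono) auto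
    finally have "norm (b + t *\<^sub>R (p - b) - m) \<le> r" by (simp add: algebra_simps)
    then show "norm (b - a) + norm (c - b) \<le> norm (b + t *\<^sub>R (p - b) - a) + norm (c - (b + t *\<^sub>R (p - b)))"
      by (rule min)
  qed
  also have "?G \<bullet> (p - b) = ?G \<bullet> (m - b) - (r / norm ?G) * (?G \<bullet> ?G)"
    by (simp add: p_def inner_diff_right)
  also have "\<dots> = ?G \<bullet> (m - b) - r * norm ?G"
    using G by (simp add: dot_square_norm power2_eq_square)
  finally have ge: "r * norm ?G \<le> ?G \<bullet> (m - b)" by simp
  have le: "?G \<bullet> (m - b) \<le> norm ?G * norm (m - b)" by (rule norm_cauchy_schwarz)
  have b': "norm (m - b) \<le> r" using b by (simp add: norm_minus_commute)
  have "r * norm ?G \<le> norm (m - b) * norm ?G" using ge le by (simp add: mult.commute)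
  then have nr: "norm (m - b) = r" using G b' by simp
  then show "norm (b - m) = r" by (simp add: norm_minus_commute)
  have "?G \<bullet> (m - b) = norm ?G * norm (m - b)" using ge le nr by (simp add: mult.commute)
  then have "norm ?G *\<^sub>R (m - b) = norm (m - b) *\<^sub>R ?G" by (simp only: norm_cauchy_schwarz_eq)
  then have "inverse r *\<^sub>R (norm ?G *\<^sub>R (b - m)) = - (inverse r *\<^sub>R (r *\<^sub>R ?G))"
    unfolding nr by (metis minus_diff_eq scaleR_minus_right)
  then have Gn: "norm ?G *\<^sub>R n = - ?G" using r by (simp add: n_def mult.commute)
  have nn: "n \<bullet> n = 1" using nr r by (simp add: n_def dot_square_norm norm_minus_commute power2_eq_square)
  have E1: "e1 = e2 - norm ?G *\<^sub>R n" using Gn by simp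
  have "(norm e1)\<^sup>2 = (norm e2)\<^sup>2 - 2 * norm ?G * (e2 \<bullet> n) + (norm ?G)\<^sup>2"
    using norm_add_scaleR_sq[of n e2 "- norm ?G"] E1 nn by (simp add: norm_eq_1)
  then have "norm ?G * norm ?G = norm ?G * (2 * (e2 \<bullet> n))" using u by (simp add: power2_eq_square)
  then have h: "norm ?G = 2 * (e2 \<bullet> n)" using G by simp
  then show "e2 \<bullet> n > 0" using G by simp
  show "e1 = e2 - (2 * (e2 \<bullet> n)) *\<^sub>R n" using E1 unfolding h .
qed

lemma int_partial_sums:
  fixes l :: "int \<Rightarrow> real"
  assumes l: "\<And>j. m \<le> l j" and m: "m > 0"
  obtains t where "t 0 = 0" "\<And>j. t (j + 1) - t j = l j" "\<And>T. \<exists>j. T < t j" "\<And>T. \<exists>j. t j \<le> T"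
proof -
  define t where "t j = (if j \<ge> 0 then (\<Sum>i<nat j. l (int i)) else - (\<Sum>i<nat (- j). l (- int i - 1)))" for j :: int
  have tp: "t (int n) = (\<Sum>i<n. l (int i))" and tn: "t (- int n) = - (\<Sum>i<n. l (- int i - 1))" for n
    by (auto simp: t_def)
  have "t 0 = 0" by (simp add: t_def)
  moreover have "t (j + 1) - t j = l j" for j
  proof (cases "j \<ge> 0")
    case True
    then obtain n where j: "j = int n" by (metis nonneg_int_cases)
    have e: "j + 1 = int (Suc n)" using j by simp
    show ?thesis unfolding e tp unfolding j tp by simp
  next
    case False
    then obtain n where j: "j = - int (Suc n)" by (metis int_cases of_nat_0_le_iff)
    have e: "j + 1 = - int n" using j by simp
    have j': "j = - int n - 1" using j by simp
    show ?thesis unfolding e tn using tn[of "Suc n", folded j] by (simp add: j')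
  qed
  moreover have "\<exists>j. T < t j" for T
  proof -
    obtain n where n: "T < real n * m" using reals_Archimedean3[OF m] by blast
    have "real n * m \<le> t (int n)" unfolding tp using sum_mono[of "{..<n}" "\<lambda>_. m" "\<lambda>i. l (int i)"] l by simp
    then show ?thesis using n by (intro exI[of _ "int n"]) linarith
  qed
  moreover have "\<exists>j. t j \<le> T" for T
  proof -
    obtain n where n: "- T < real n * m" using reals_Archimedean3[OF m] by blast
    have "real n * m \<le> - t (- int n)" unfolding tn using sum_mono[of "{..<n}" "\<lambda>_. m" "\<lambda>i. l (- int i - 1)"] l by simp
    then show ?thesis using n by (intro exI[of _ "- int n"]) linarith
  qed
  ultimately show thesis using that by blast
qed

section \<open>Chains are trapped trajectories\<close>

locale open_billiard = separated_balls +
  assumes no_eclipse: no_eclipse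
begin

lemma hull_avoids:
  assumes "i \<in> {1..k0}" "j \<in> {1..k0}" "l \<in> {1..k0}" "l \<noteq> i" "l \<noteq> j"
    and "p \<in> Kball i" "q \<in> Kball j" "0 \<le> u" "u \<le> 1"
  shows "(1 - u) *\<^sub>R p + u *\<^sub>R q \<notin> Kball l"
proof (cases "i = j")
  case True
  have "(1 - u) *\<^sub>R p + u *\<^sub>R q \<in> Kball i"
    using assms True convexD[OF convex_cball, of p "cen i" "rad i" q "1 - u" u] by (simp add: Kball_def)
  then show ?thesis using ball_index_eq assms by metis
next
  case False
  have "(1 - u) *\<^sub>R p + u *\<^sub>R q \<in> convex hull (Kball i \<union> Kball j)"
    using assms by (intro convexD[OF convex_convex_hull]) (auto intro: hull_inc)
  then show ?thesis using no_eclipse assms False unfolding no_eclipse_def by blast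
qed

text \<open>The two balls at the ends are convex and met transversally, the others are excluded by the no-eclipse condition.\<close>

lemma segment_avoids_K:
  assumes q: "orbit_chain z q" and s: "0 < s" "s < norm (q (j + 1) - q j)"
  shows "q j + s *\<^sub>R dir q j \<notin> K"
proof
  let ?l = "norm (q (j + 1) - q j)" let ?p = "q j + s *\<^sub>R dir q j"
  assume "?p \<in> K"
  then obtain m where m: "m \<in> {1..k0}" "?p \<in> Kball m" by (auto simp: K_def)
  have l: "?l > 0" using s by linarith
  have qK: "q i \<in> Kball (z i)" for i using orbit_chainD(3)[OF q, of i] by (auto simp: Kball_def)
  consider "m = z j" | "m = z (j + 1)" | "m \<noteq> z j" "m \<noteq> z (j + 1)" by blast
  then show False
  proof cases
    case 1
    then show False
      using outgoing_ray_leaves[OF orbit_chainD(4)[OF q, of j] orbit_chainD(10)[OF q, of j] _ s(1)]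
        orbit_chainD(7)[OF q, of j] orbit_chainD(5)[OF q, of j] m by simp
  next
    case 2
    let ?y = "q (j + 1)"
    have "dir q j \<bullet> normal ?y < 0"
      using orbit_chainD(8)[OF q, of "j + 1"] orbit_chainD(7)[OF q, of "j + 1"]
        reflect_inner_normal[OF orbit_chainD(4)[OF q, of "j + 1"], of "dir q (j + 1)"] by simp
    then have "?y + (?l - s) *\<^sub>R (- dir q j) \<notin> Kball (ball_index ?y)"
      using outgoing_ray_leaves[OF orbit_chainD(4)[OF q, of "j + 1"], of "- dir q j" "?l - s"]
        orbit_chainD(10)[OF q, of j] s by simp
    moreover have "?y + (?l - s) *\<^sub>R (- dir q j) = ?p"
      using orbit_chainD(11)[OF q, of j] by (simp add: algebra_simps)
    ultimately show False using 2 m orbit_chainD(5)[OF q, of "j + 1"] by simp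
  next
    case 3
    have "(1 - s / ?l) *\<^sub>R q j + (s / ?l) *\<^sub>R q (j + 1) = ?p"
      using l by (simp add: dir_def algebra_simps divide_inverse)
    moreover have "(1 - s / ?l) *\<^sub>R q j + (s / ?l) *\<^sub>R q (j + 1) \<notin> Kball m"
      using 3 m s l qK orbit_chainD(1)[OF q] by (intro hull_avoids[of "z j" "z (j + 1)"]) auto
    ultimately show False using m by simp
  qed
qed

lemma chain_M1: "orbit_chain z q \<Longrightarrow> (q j, dir q j) \<in> M1"
  using orbit_chainD by (auto simp: M1_def)

lemma chain_nxt:
  assumes q: "orbit_chain z q"
  shows "hits (q j, dir q j)" "ret (q j, dir q j) = norm (q (j + 1) - q j)"
    "nxt (q j, dir q j) = (q (j + 1), dir q (j + 1))"
proof -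
  let ?x = "(q j, dir q j)" let ?l = "norm (q (j + 1) - q j)"
  have e: "fst ?x + ?l *\<^sub>R snd ?x = q (j + 1)" using orbit_chainD(11)[OF q, of j] by simp
  have qf: "q (j + 1) \<in> frontier K" using orbit_chainD(4)[OF q] .
  have d: "dir q j = reflect (q (j + 1)) (dir q (j + 1))" using orbit_chainD(8)[OF q, of "j + 1"] by simp
  have l: "?l > 0" using orbit_chainD(9)[OF q, of j] gap_pos by linarith
  have n: "norm (snd ?x) = 1" using orbit_chainD(10)[OF q] by simp
  have inc: "snd ?x \<bullet> normal (fst ?x + ?l *\<^sub>R snd ?x) < 0" unfolding e
    using reflect_inner_normal[OF qf] orbit_chainD(7)[OF q, of "j + 1"] d by simp
  have out: "fst ?x + s *\<^sub>R snd ?x \<notin> interior K" if "0 < s" "s < ?l" for s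
    using segment_avoids_K[OF q that] interior_subset by auto
  note f = first_entry_eqI[of ?x ?l, OF n l, unfolded e, OF qf inc[unfolded e] out]
  show "hits ?x" "ret ?x = ?l" using f by blast+
  have "nxt ?x = (q (j + 1), reflect (q (j + 1)) (dir q j))" using f(3) by simp
  then show "nxt ?x = (q (j + 1), dir q (j + 1))" unfolding d reflect_reflect[OF qf] .
qed

lemma chain_M0_start:
  assumes q: "orbit_chain z q"
  shows "(q 0, dir q 0) \<in> M0"
proof -
  obtain t where t: "t 0 = 0" "\<And>j. t (j + 1) - t j = norm (q (j + 1) - q j)"
     "\<And>T. \<exists>j. T < t j" "\<And>T. \<exists>j. t j \<le> T"
    using int_partial_sums[of gap "\<lambda>j. norm (q (j + 1) - q j)"] orbit_chainD(9)[OF q] gap_pos by metis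
  have mono: "t j < t (j + 1)" for j using t(2)[of j] orbit_chainD(9)[OF q, of j] gap_pos by linarith
  obtain \<gamma> where g: "billiard_trajectory \<gamma>"
    "\<And>j s. 0 \<le> s \<Longrightarrow> s < t (j + 1) - t j \<Longrightarrow> \<gamma> (t j + s) = (q j + s *\<^sub>R dir q j, dir q j)"
  proof (rule glued_trajectory[of t q "dir q"])
    show "q j \<in> Omega" for j using orbit_chainD(4)[OF q] frontier_K_Omega by blast
    show "norm (dir q j) = 1" for j using orbit_chainD(10)[OF q] .
    show "q (j + 1) = q j + (t (j + 1) - t j) *\<^sub>R dir q j" for j using orbit_chainD(11)[OF q, of j] t by simp
    show "dir q (j - 1) = incoming (q j) (dir q j)" for j
      using orbit_chainD(4,8)[OF q, of j] by (simp add: incoming_def)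
    show "q j + s *\<^sub>R dir q j \<in> Omega \<and> (q j + s *\<^sub>R dir q j \<in> frontier K \<longrightarrow> dir q j \<bullet> normal (q j + s *\<^sub>R dir q j) = 0)"
      if "0 < s" "s < t (j + 1) - t j" for j s
      using segment_avoids_K[OF q that(1), of j] that(2) t interior_subset[of K] closed_K
      unfolding Omega_eq frontier_def by auto
  qed (use mono t in auto)
  have g0: "\<gamma> 0 = (q 0, dir q 0)" using g(2)[of 0 0] t(1) mono[of 0] by simp
  obtain B where B: "\<And>p. p \<in> K \<Longrightarrow> norm p \<le> B" using bounded_K unfolding bounded_iff by blast
  have qB: "norm (q j) \<le> B" for j
    using B orbit_chainD(4)[OF q, of j] closed_K by (simp add: frontier_def)
  have "norm (fst (\<gamma> T)) \<le> 3 * B" for T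
  proof -
    obtain j where j: "t j \<le> T" "T < t (j + 1)" using int_index_exists[OF mono t(3,4)] by blast
    have "\<gamma> T = (q j + (T - t j) *\<^sub>R dir q j, dir q j)" using g(2)[of "T - t j" j] j by simp
    moreover have "norm (q j + (T - t j) *\<^sub>R dir q j) \<le> norm (q j) + norm (q (j + 1) - q j)"
      using norm_triangle_ineq[of "q j" "(T - t j) *\<^sub>R dir q j"] orbit_chainD(10)[OF q, of j] t(2)[of j] j by simp
    moreover have "norm (q (j + 1) - q j) \<le> norm (q (j + 1)) + norm (q j)" by (rule norm_triangle_ineq4)
    ultimately show ?thesis using qB[of j] qB[of "j + 1"] by simp
  qed
  then have "bounded (range (\<lambda>t. fst (\<gamma> t)))" unfolding bounded_iff by blast
  then have "bounded (range \<gamma>)" using trajectory_bounded_iff[OF g(1)] by blast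
  then show ?thesis
    using chain_M1[OF q] billiard_flow_eq[OF chain_M1[OF q] g(1) g0] by (simp add: M0_def)
qed

lemma chain_M0: "orbit_chain z q \<Longrightarrow> (q j, dir q j) \<in> M0"
  using chain_M0_start[OF orbit_chain_shift(1), of z q j] orbit_chain_shift(2)[of z q j 0] by simp

text \<open>For negative exponents this uses that the billiard map is injective on \<open>M0\<close>.\<close>

lemma chain_billiard_map_pow:
  assumes q: "orbit_chain z q"
  shows "billiard_map_pow j (q 0, dir q 0) = (q j, dir q j)"
proof -
  let ?x = "(q 0, dir q 0)"
  note P = billiard_map_pow_M0[OF chain_M0[OF q, of 0]]
  have X: "billiard_map (q j, dir q j) = (q (j + 1), dir q (j + 1))" for j
    using M0_billiard_map[OF chain_M0[OF q]] chain_nxt[OF q] by simp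
  show ?thesis
  proof (induction j rule: int_induct[of _ 0])
    case base
    then show ?case using P(3) .
  next
    case (step1 i)
    then show ?case using P(2)[of i] X by simp
  next
    case (step2 i)
    have "billiard_map (billiard_map_pow (i - 1) ?x) = billiard_map (q (i - 1), dir q (i - 1))"
      using P(2)[of "i - 1"] step2 X[of "i - 1"] by simp
    then show ?case
      using inj_onD[OF bij_betw_imp_inj_on[OF billiard_map_bij]] P(1) chain_M0[OF q] by blast
  qed
qed

lemma chain_coding:
  assumes q: "orbit_chain z q"
  shows "coding (q 0, dir q 0) = z"
  unfolding coding_def chain_billiard_map_pow[OF q] using orbit_chainD(5)[OF q] by simp

section \<open>Uniqueness of chains\<close>

definition divergence :: "(int \<Rightarrow> real^3) \<Rightarrow> (int \<Rightarrow> real^3) \<Rightarrow> int \<Rightarrow> real" where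
  "divergence q q' j = (q j - q' j) \<bullet> (dir q j - dir q' j)"

lemma divergence_step_flight:
  assumes q: "orbit_chain z q" and q': "orbit_chain z' q'" and zz: "z (j + 1) = z' (j + 1)"
  shows "divergence q q' j + gap * (norm (dir q j - dir q' j))\<^sup>2 \<le> divergence q q' (j + 1)"
proof -
  have "0 \<le> (dir q (j + 1) \<bullet> normal (q (j + 1))) / rad (z (j + 1)) * (norm (q (j + 1) - q' (j + 1)))\<^sup>2"
    using orbit_chainD(7)[OF q, of "j + 1"] orbit_chainD(12)[OF q, of "j + 1"] by simp
  then show ?thesis using divergence_step[OF q q' zz] unfolding divergence_def by linarith
qed

lemma divergence_step_reflection:
  assumes q: "orbit_chain z q" and q': "orbit_chain z' q'" and zz: "z (j + 1) = z' (j + 1)"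
  shows "divergence q q' j + (dir q (j + 1) \<bullet> normal (q (j + 1))) / rad (z (j + 1)) * (norm (q (j + 1) - q' (j + 1)))\<^sup>2
    \<le> divergence q q' (j + 1)"
proof -
  have "0 \<le> gap * (norm (dir q j - dir q' j))\<^sup>2" using gap_pos by simp
  then show ?thesis using divergence_step[OF q q' zz] unfolding divergence_def by linarith
qed

lemma chain_positions_close:
  obtains D where "D > 0" "\<And>z q z' q' j. orbit_chain z q \<Longrightarrow> orbit_chain z' q' \<Longrightarrow> norm (q j - q' j) \<le> D"
proof -
  obtain B where B: "\<And>p. p \<in> K \<Longrightarrow> norm p \<le> B" using bounded_K unfolding bounded_iff by blast
  have "norm (q j - q' j) \<le> 2 * \<bar>B\<bar> + 1" if "orbit_chain z q" "orbit_chain z' q'" for z q z' q' j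
  proof -
    have "norm (q j) \<le> B" "norm (q' j) \<le> B"
      using B orbit_chainD(4)[OF that(1), of j] orbit_chainD(4)[OF that(2), of j] closed_K
      by (simp_all add: frontier_def)
    then show ?thesis using norm_triangle_ineq4[of "q j" "q' j"] by linarith
  qed
  then show thesis using that[of "2 * \<bar>B\<bar> + 1"] by simp
qed

text \<open>If two itineraries agree on a long window, the divergence is small in the middle: once it
  exceeds \<open>\<epsilon>\<close> in absolute value, it moves away from 0 by a fixed amount at each step, forward or
  backward in time, whereas it is bounded.\<close>

lemma divergence_small:
  assumes e: "\<epsilon> > 0"
  obtains N :: nat where "\<And>z q z' q' m. orbit_chain z q \<Longrightarrow> orbit_chain z' q' \<Longrightarrow>
    (\<forall>j. \<bar>j - m\<bar> \<le> int N \<longrightarrow> z j = z' j) \<Longrightarrow> \<bar>divergence q q' m\<bar> \<le> \<epsilon>"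
proof -
  obtain D where D: "D > 0" "\<And>z q z' q' j. orbit_chain z q \<Longrightarrow> orbit_chain z' q' \<Longrightarrow> norm (q j - q' j) \<le> D"
    using chain_positions_close by blast
  define \<delta> where "\<delta> = gap * (\<epsilon> / D)\<^sup>2"
  have d: "\<delta> > 0" using gap_pos e D by (simp add: \<delta>_def)
  obtain N where N: "2 * D < real N * \<delta>" using reals_Archimedean3[OF d] by blast
  show thesis
  proof (rule that[of N])
    fix z q z' q' m
    assume q: "orbit_chain z q" and q': "orbit_chain z' q'" and zz: "\<forall>j. \<bar>j - m\<bar> \<le> int N \<longrightarrow> z j = z' j"
    let ?A = "divergence q q'"
    have A: "\<bar>?A j\<bar> \<le> D * norm (dir q j - dir q' j)" for j
    proof -
      have "\<bar>?A j\<bar> \<le> norm (q j - q' j) * norm (dir q j - dir q' j)"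
        unfolding divergence_def by (rule Cauchy_Schwarz_ineq2)
      also have "\<dots> \<le> D * norm (dir q j - dir q' j)" using D(2)[OF q q'] by (intro mult_right_mono) auto
      finally show ?thesis .
    qed
    have A2: "\<bar>?A j\<bar> \<le> 2 * D" for j
    proof -
      have "norm (dir q j - dir q' j) \<le> 2"
        using norm_triangle_ineq4[of "dir q j" "dir q' j"] orbit_chainD(10)[OF q, of j] orbit_chainD(10)[OF q', of j] by simp
      then have "D * norm (dir q j - dir q' j) \<le> D * 2" using D(1) by (intro mult_left_mono) auto
      then show ?thesis using A[of j] by simp
    qed
    have big: "\<delta> \<le> gap * (norm (dir q j - dir q' j))\<^sup>2" if "\<bar>?A j\<bar> > \<epsilon>" for j
    proof -
      have "\<epsilon> / D \<le> norm (dir q j - dir q' j)" using A[of j] that D(1) by (simp add: field_simps)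
      then have "(\<epsilon> / D)\<^sup>2 \<le> (norm (dir q j - dir q' j))\<^sup>2" using e D(1) by (intro power_mono) auto
      then show ?thesis unfolding \<delta>_def using gap_pos by simp
    qed
    have st: "?A j + gap * (norm (dir q j - dir q' j))\<^sup>2 \<le> ?A (j + 1)" if "\<bar>j + 1 - m\<bar> \<le> int N" for j
      using divergence_step_flight[OF q q'] zz that by blast
    have gn: "0 \<le> gap * (norm (dir q j - dir q' j))\<^sup>2" for j using gap_pos by simp
    have up: "?A m \<le> \<epsilon>"
    proof (rule ccontr)
      assume n: "\<not> ?A m \<le> \<epsilon>"
      have "i \<le> N \<Longrightarrow> ?A (m + int i) \<ge> ?A m + real i * \<delta>" for i
      proof (induction i)
        case (Suc i)
        have ih: "?A (m + int i) \<ge> ?A m + real i * \<delta>" using Suc by simp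
        have "real i * \<delta> \<ge> 0" using d by simp
        then have "\<bar>?A (m + int i)\<bar> > \<epsilon>" using ih n by linarith
        then have "?A (m + int i) + \<delta> \<le> ?A (m + int i + 1)"
          using big[of "m + int i"] st[of "m + int i"] Suc.prems by force
        moreover have "m + int (Suc i) = m + int i + 1" by simp
        moreover have "real (Suc i) * \<delta> = real i * \<delta> + \<delta>" by (simp add: algebra_simps)
        ultimately show ?case using ih by (simp only:)
      qed simp
      from this[of N] show False using A2[of "m + int N"] N n e by linarith
    qed
    have "- \<epsilon> \<le> ?A m"
    proof (rule ccontr)
      assume n: "\<not> - \<epsilon> \<le> ?A m"
      have "i \<le> N \<Longrightarrow> ?A (m - int i) \<le> ?A m - real i * \<delta>" for i
      proof (induction i)
        case (Suc i)
        have ih: "?A (m - int i) \<le> ?A m - real i * \<delta>" using Suc by simp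
        have "real i * \<delta> \<ge> 0" using d by simp
        have e1: "m - int (Suc i) + 1 = m - int i" by simp
        have s: "?A (m - int (Suc i)) + gap * (norm (dir q (m - int (Suc i)) - dir q' (m - int (Suc i))))\<^sup>2 \<le> ?A (m - int i)"
          using st[of "m - int (Suc i)"] Suc.prems unfolding e1 by simp
        then have "\<bar>?A (m - int (Suc i))\<bar> > \<epsilon>"
          using ih n gn[of "m - int (Suc i)"] \<open>real i * \<delta> \<ge> 0\<close> e by linarith
        then have "?A (m - int (Suc i)) + \<delta> \<le> ?A (m - int i)"
          using big[of "m - int (Suc i)"] s by linarith
        moreover have "real (Suc i) * \<delta> = real i * \<delta> + \<delta>" by (simp add: algebra_simps)
        ultimately show ?case using ih by linarith
      qed simp
      from this[of N] show False using A2[of "m - int N"] N n e by linarith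
    qed
    then show "\<bar>?A m\<bar> \<le> \<epsilon>" using up by linarith
  qed
qed

text \<open>The divergence is small at the places \<open>-1\<close>, \<open>0\<close> and \<open>1\<close>, and its two increments between them control the distances
  of the velocities and of the positions at \<open>0\<close>.\<close>

lemma chains_close:
  assumes q: "orbit_chain z q" and e: "e > 0"
  obtains N :: nat where "\<And>z' q'. orbit_chain z' q' \<Longrightarrow> (\<forall>j. \<bar>j\<bar> \<le> int N \<longrightarrow> z j = z' j) \<Longrightarrow>
    norm (q 0 - q' 0) < e \<and> norm (dir q 0 - dir q' 0) < e"
proof -
  define c where "c = (dir q 0 \<bullet> normal (q 0)) / rad (z 0)"
  have c: "c > 0" using orbit_chainD(7,12)[OF q, of 0] by (simp add: c_def)
  define \<epsilon> where "\<epsilon> = min (gap * e\<^sup>2) (c * e\<^sup>2) / 3"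
  have eps: "\<epsilon> > 0" "2 * \<epsilon> < gap * e\<^sup>2" "2 * \<epsilon> < c * e\<^sup>2"
    using gap_pos c e by (auto simp: \<epsilon>_def min_def)
  obtain N where N: "\<And>z q z' q' m. orbit_chain z q \<Longrightarrow> orbit_chain z' q' \<Longrightarrow>
    (\<forall>j. \<bar>j - m\<bar> \<le> int N \<longrightarrow> z j = z' j) \<Longrightarrow> \<bar>divergence q q' m\<bar> \<le> \<epsilon>"
    using divergence_small[OF eps(1)] by blast
  show thesis
  proof (rule that[of "N + 1"])
    fix z' q' assume q': "orbit_chain z' q'" and zz: "\<forall>j. \<bar>j\<bar> \<le> int (N + 1) \<longrightarrow> z j = z' j"
    let ?A = "divergence q q'"
    have A: "\<bar>?A m\<bar> \<le> \<epsilon>" if "\<bar>m\<bar> \<le> 1" for m using N[OF q q', of m] zz that by simp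
    have A3: "\<bar>?A 0\<bar> \<le> \<epsilon>" "\<bar>?A 1\<bar> \<le> \<epsilon>" "\<bar>?A (- 1)\<bar> \<le> \<epsilon>" using A by simp_all
    have "?A 0 + gap * (norm (dir q 0 - dir q' 0))\<^sup>2 \<le> ?A 1"
      using divergence_step_flight[OF q q', of 0] zz by simp
    then have "gap * (norm (dir q 0 - dir q' 0))\<^sup>2 < gap * e\<^sup>2" using A3 eps by linarith
    then have 1: "norm (dir q 0 - dir q' 0) < e" using gap_pos e by (simp add: power2_less_imp_less)
    have "?A (- 1) + c * (norm (q 0 - q' 0))\<^sup>2 \<le> ?A 0"
      using divergence_step_reflection[OF q q', of "- 1"] zz by (simp add: c_def)
    then have "c * (norm (q 0 - q' 0))\<^sup>2 < c * e\<^sup>2" using A3 eps by linarith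
    then have 2: "norm (q 0 - q' 0) < e" using c e by (simp add: power2_less_imp_less)
    show "norm (q 0 - q' 0) < e \<and> norm (dir q 0 - dir q' 0) < e" using 1 2 by simp
  qed
qed

lemma chain_unique:
  assumes q: "orbit_chain z q" and q': "orbit_chain z q'"
  shows "q = q'"
proof
  fix i
  have "norm (q i - q' i) < e" if e: "e > 0" for e
  proof -
    obtain N :: nat where N: "\<And>z' p'. orbit_chain z' p' \<Longrightarrow> (\<forall>j. \<bar>j\<bar> \<le> int N \<longrightarrow> z (j + i) = z' j) \<Longrightarrow>
      norm (q (0 + i) - p' 0) < e \<and> norm (dir (\<lambda>j. q (j + i)) 0 - dir p' 0) < e"
      using chains_close[OF orbit_chain_shift(1)[OF q, of i] e] by blast
    show ?thesis using N[OF orbit_chain_shift(1)[OF q', of i]] by simp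
  qed
  then have "norm (q i - q' i) = 0" by (metis less_irrefl norm_ge_zero order_le_less)
  then show "q i = q' i" by simp
qed

section \<open>Existence of chains\<close>

text \<open>Unlike minimality of the infinite total length, this property makes sense; it is closed in the product
  topology, and minimisers of the length of a finite piece have it at the inner vertices.\<close>

definition locally_shortest :: "(int \<Rightarrow> nat) \<Rightarrow> (int \<Rightarrow> real^3) \<Rightarrow> int \<Rightarrow> bool" where
  "locally_shortest z q j \<longleftrightarrow> (\<forall>p\<in>Kball (z j).
     norm (q j - q (j - 1)) + norm (q (j + 1) - q j) \<le> norm (p - q (j - 1)) + norm (q (j + 1) - p))"

lemma locally_shortest_chain:
  assumes z: "z \<in> Sigma_A k0" and q: "\<And>j. q j \<in> Kball (z j)" and m: "\<And>j. locally_shortest z q j"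
  shows "orbit_chain z q"
proof -
  have loc: "norm (q j - cen (z j)) = rad (z j) \<and> 0 < dir q j \<bullet> normal (q j) \<and> dir q (j - 1) = reflect (q j) (dir q j)" for j
  proof -
    let ?a = "q (j - 1)" let ?b = "q j" let ?c = "q (j + 1)"
    have zj: "z j \<in> {1..k0}" "z (j - 1) \<in> {1..k0}" "z (j + 1) \<in> {1..k0}" using Sigma_A_D(1)[OF z] by blast+
    have zn: "z j \<noteq> z (j + 1)" "z j \<noteq> z (j - 1)"
      using Sigma_A_D(2)[OF z, of j] Sigma_A_D(2)[OF z, of "j - 1"] by auto
    have r: "rad (z j) > 0" using rad_pos zj by blast
    have "gap \<le> dist ?a ?b" "gap \<le> dist ?b ?c"
      using dist_balls_ge_gap[OF zj(2) zj(1) _ q q] dist_balls_ge_gap[OF zj(1) zj(3) _ q q] zn by auto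
    then have ab: "?a \<noteq> ?b" and bc: "?b \<noteq> ?c" using gap_pos by auto
    have e: "dir q (j - 1) = (?b - ?a) /\<^sub>R norm (?b - ?a)" "dir q j = (?c - ?b) /\<^sub>R norm (?c - ?b)"
      by (simp_all add: dir_def)
    \<comment> \<open>Otherwise \<open>?b\<close> would be on the segment between its neighbours, against the no-eclipse condition.\<close>
    have ne: "(?b - ?a) /\<^sub>R norm (?b - ?a) \<noteq> (?c - ?b) /\<^sub>R norm (?c - ?b)"
    proof
      assume eq: "(?b - ?a) /\<^sub>R norm (?b - ?a) = (?c - ?b) /\<^sub>R norm (?c - ?b)"
      define s t where "s = norm (?b - ?a)" and "t = norm (?c - ?b)"
      have st: "s > 0" "t > 0" using ab bc by (auto simp: s_def t_def)
      have "t *\<^sub>R (?b - ?a) = s *\<^sub>R (?c - ?b)"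
        using arg_cong[OF eq, of "\<lambda>w. (s * t) *\<^sub>R w"] st unfolding s_def[symmetric] t_def[symmetric]
        by (simp add: mult.commute[of s t] mult.assoc)
      then have "(s + t) *\<^sub>R ?b = t *\<^sub>R ?a + s *\<^sub>R ?c" by (simp add: algebra_simps)
      then have "inverse (s + t) *\<^sub>R ((s + t) *\<^sub>R ?b) = inverse (s + t) *\<^sub>R (t *\<^sub>R ?a + s *\<^sub>R ?c)" by simp
      then have "?b = (t / (s + t)) *\<^sub>R ?a + (s / (s + t)) *\<^sub>R ?c"
        using st by (simp add: scaleR_add_right divide_inverse mult.commute)
      moreover have "t / (s + t) = 1 - s / (s + t)" using st by (simp add: field_simps)
      ultimately have "?b = (1 - s / (s + t)) *\<^sub>R ?a + (s / (s + t)) *\<^sub>R ?c" by simp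
      moreover have "(1 - s / (s + t)) *\<^sub>R ?a + (s / (s + t)) *\<^sub>R ?c \<notin> Kball (z j)"
        using zj zn q st by (intro hull_avoids[of "z (j - 1)" "z (j + 1)"]) auto
      ultimately show False using q[of j] by simp
    qed
    have min: "norm (?b - ?a) + norm (?c - ?b) \<le> norm (p - ?a) + norm (?c - p)" if "norm (p - cen (z j)) \<le> rad (z j)" for p
      using m[of j] that unfolding locally_shortest_def Kball_def by (simp add: dist_norm norm_minus_commute)
    have b: "norm (?b - cen (z j)) \<le> rad (z j)" using q[of j] by (simp add: Kball_def dist_norm norm_minus_commute)
    note S = shortest_broken_line_reflects[OF r b ab bc min ne]
    have qs: "?b \<in> sphere (cen (z j)) (rad (z j))" using S(1) by (simp add: dist_norm norm_minus_commute)
    show ?thesis using S sphere_normal[OF zj(1) qs] unfolding e reflect_def by simp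
  qed
  then show ?thesis using z by (simp add: orbit_chain_def dist_norm norm_minus_commute)
qed

lemma compact_itinerary_space:
  shows "compact {q :: int \<Rightarrow> real^3. \<forall>j. q j \<in> Kball (z j)}"
proof -
  have "{q. \<forall>j. q j \<in> Kball (z j)} = PiE UNIV (\<lambda>j. Kball (z j))" by (auto simp: PiE_iff)
  moreover have "compactin (product_topology (\<lambda>j. euclidean) UNIV) (PiE UNIV (\<lambda>j. Kball (z j)))"
    by (simp add: compactin_PiE Kball_def)
  ultimately show ?thesis by (simp add: euclidean_product_topology)
qed

text \<open>By compactness of the product of the balls the closed conditions, which can be met at finitely many places
  simultaneously, can be met at all places.\<close>

lemma chain_exists:
  assumes z: "z \<in> Sigma_A k0"
  obtains q where "orbit_chain z q"
proof -
  let ?D = "{q :: int \<Rightarrow> real^3. \<forall>j. q j \<in> Kball (z j)}"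
  have zj: "z j \<in> {1..k0}" for j using Sigma_A_D(1)[OF z] .
  have "(\<lambda>j. cen (z j)) \<in> ?D" using rad_pos[OF zj] by (auto simp: Kball_def intro: less_imp_le)
  then have ne: "?D \<noteq> {}" by (metis empty_iff)
  have "?D \<inter> (\<Inter>j\<in>UNIV. {q. locally_shortest z q j}) \<noteq> {}"
  proof (rule compact_imp_fip_image[OF compact_itinerary_space])
    fix j :: int
    have c: "continuous_on UNIV (\<lambda>q :: int \<Rightarrow> real^3. q i)" for i by simp
    have "{q. locally_shortest z q j} = (\<Inter>p\<in>Kball (z j). {q. norm (q j - q (j - 1)) + norm (q (j + 1) - q j) \<le> norm (p - q (j - 1)) + norm (q (j + 1) - p)})"
      by (auto simp: locally_shortest_def)
    also have "closed \<dots>" by (intro closed_INT ballI closed_Collect_le continuous_intros c)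
    finally show "closed {q. locally_shortest z q j}" .
  next
    fix J :: "int set" assume J: "finite J" "J \<subseteq> UNIV"
    obtain N :: int where N: "\<And>j. j \<in> J \<Longrightarrow> \<bar>j\<bar> < N"
    proof -
      have "\<bar>j\<bar> < Max (insert 0 (abs ` J)) + 1" if "j \<in> J" for j
        using Max_ge[of "insert 0 (abs ` J)" "\<bar>j\<bar>"] J that by simp
      then show thesis using that by blast
    qed
    define L where "L q = (\<Sum>i\<in>{-N..N}. norm (q (i + 1) - q i))" for q :: "int \<Rightarrow> real^3"
    have c: "continuous_on UNIV (\<lambda>q :: int \<Rightarrow> real^3. q i)" for i by simp
    have "continuous_on ?D L" unfolding L_def
      by (rule continuous_on_subset[of UNIV]) (intro continuous_intros c, simp)
    then obtain q where q: "q \<in> ?D" "\<And>p. p \<in> ?D \<Longrightarrow> L q \<le> L p"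
      using continuous_attains_inf[OF compact_itinerary_space ne] by blast
    have "locally_shortest z q j" if j: "j \<in> J" for j
      unfolding locally_shortest_def
    proof
      fix p assume p: "p \<in> Kball (z j)"
      let ?q = "q(j := p)"
      have "L q \<le> L ?q" using q p by (intro q(2)) auto
      moreover have sub: "{j - 1, j} \<subseteq> {-N..N}" using N[OF j] by auto
      have "L r = (\<Sum>i\<in>{-N..N} - {j - 1, j}. norm (r (i + 1) - r i)) + (norm (r j - r (j - 1)) + norm (r (j + 1) - r j))" for r
        unfolding L_def using sum.subset_diff[OF sub, of "\<lambda>i. norm (r (i + 1) - r i)"] by simp
      moreover have "(\<Sum>i\<in>{-N..N} - {j - 1, j}. norm (?q (i + 1) - ?q i)) = (\<Sum>i\<in>{-N..N} - {j - 1, j}. norm (q (i + 1) - q i))"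
        by (intro sum.cong) auto
      ultimately show "norm (q j - q (j - 1)) + norm (q (j + 1) - q j) \<le> norm (p - q (j - 1)) + norm (q (j + 1) - p)"
        by simp
    qed
    then show "?D \<inter> (\<Inter>j\<in>J. {q. locally_shortest z q j}) \<noteq> {}" using q(1) by blast
  qed
  then obtain q where "q \<in> ?D" "\<And>j. locally_shortest z q j" by blast
  then show thesis using that locally_shortest_chain[OF z] by blast
qed

section \<open>Symbolic coding\<close>

lemma coding_bij: "bij_betw coding M0 (Sigma_A k0)"
  unfolding bij_betw_def
proof
  show "inj_on coding M0"
  proof (rule inj_onI)
    fix x y assume x: "x \<in> M0" and y: "y \<in> M0" and c: "coding x = coding y"
    have e: "(\<lambda>j. fst (billiard_map_pow j x)) = (\<lambda>j. fst (billiard_map_pow j y))"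
      using chain_unique[OF M0_orbit_chain(1)[OF x]] M0_orbit_chain(1)[OF y] c by simp
    have "snd (billiard_map_pow 0 x) = snd (billiard_map_pow 0 y)"
      using M0_orbit_chain(2)[OF x, of 0] M0_orbit_chain(2)[OF y, of 0] e by simp
    moreover have "fst (billiard_map_pow 0 x) = fst (billiard_map_pow 0 y)" using fun_cong[OF e, of 0] by simp
    ultimately show "x = y" using billiard_map_pow_M0(3)[OF x] billiard_map_pow_M0(3)[OF y] by (simp add: prod_eq_iff)
  qed
  show "coding ` M0 = Sigma_A k0"
  proof
    show "coding ` M0 \<subseteq> Sigma_A k0" using M0_orbit_chain(1) by (auto simp: orbit_chain_def)
    show "Sigma_A k0 \<subseteq> coding ` M0"
    proof
      fix z assume "z \<in> Sigma_A k0"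
      then obtain q where q: "orbit_chain z q" using chain_exists by blast
      show "z \<in> coding ` M0" using chain_coding[OF q] chain_M0[OF q, of 0] by force
    qed
  qed
qed

lemma inv_coding_chain:
  assumes q: "orbit_chain z q"
  shows "inv_into M0 coding z = (q 0, dir q 0)"
  using inv_into_f_f[OF bij_betw_imp_inj_on[OF coding_bij] chain_M0[OF q, of 0]] chain_coding[OF q] by simp

text \<open>Itineraries close to \<open>z\<close> agree with \<open>z\<close> on a long window, and chains with such itineraries are close at the origin.\<close>

lemma continuous_on_inv_coding: "continuous_on (Sigma_A k0) (inv_into M0 coding)"
proof (unfold continuous_on_def, intro ballI)
  fix z assume z: "z \<in> Sigma_A k0"
  obtain q where q: "orbit_chain z q" using chain_exists[OF z] .
  show "(inv_into M0 coding \<longlongrightarrow> inv_into M0 coding z) (at z within Sigma_A k0)"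
  proof (rule tendstoI)
    fix e :: real assume e: "e > 0"
    then have "e / 2 > 0" by simp
    then obtain N :: nat where N: "\<And>z' q'. orbit_chain z' q' \<Longrightarrow> (\<forall>j. \<bar>j\<bar> \<le> int N \<longrightarrow> z j = z' j) \<Longrightarrow>
      norm (q 0 - q' 0) < e / 2 \<and> norm (dir q 0 - dir q' 0) < e / 2"
      using chains_close[OF q] by blast
    have op: "open {z'. \<forall>j\<in>{- int N..int N}. z' j \<in> {z j}}"
      by (rule product_topology_basis') (simp_all add: Topological_Spaces.open_discrete)
    have "\<forall>\<^sub>F z' in at z within Sigma_A k0. z' \<in> {z'. \<forall>j\<in>{- int N..int N}. z' j \<in> {z j}} \<and> z' \<in> Sigma_A k0"
      using op by (auto simp: eventually_at_topological intro!: exI[of _ "{z'. \<forall>j\<in>{- int N..int N}. z' j \<in> {z j}}"])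
    then show "\<forall>\<^sub>F z' in at z within Sigma_A k0. dist (inv_into M0 coding z') (inv_into M0 coding z) < e"
    proof (rule eventually_mono)
      fix z' assume z': "z' \<in> {z'. \<forall>j\<in>{- int N..int N}. z' j \<in> {z j}} \<and> z' \<in> Sigma_A k0"
      then obtain q' where q': "orbit_chain z' q'" using chain_exists by blast
      have "\<forall>j. \<bar>j\<bar> \<le> int N \<longrightarrow> z j = z' j" using z' by (auto simp: abs_le_iff)
      then have "norm (q 0 - q' 0) < e / 2 \<and> norm (dir q 0 - dir q' 0) < e / 2" using N[OF q'] by blast
      moreover have "dist (q' 0, dir q' 0) (q 0, dir q 0) \<le> norm (q 0 - q' 0) + norm (dir q 0 - dir q' 0)"
        unfolding dist_Pair_Pair by (simp add: dist_norm norm_minus_commute) (rule sqrt_sum_squares_le_sum, auto)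
      ultimately show "dist (inv_into M0 coding z') (inv_into M0 coding z) < e"
        unfolding inv_coding_chain[OF q] inv_coding_chain[OF q'] by linarith
    qed
  qed
qed

end

section \<open>Planarity and uniform bounds\<close>

lemma mirror_inner:
  fixes e :: "'a::real_inner"
  assumes "norm e = 1"
  shows "(u - (2 * (u \<bullet> e)) *\<^sub>R e) \<bullet> (w - (2 * (w \<bullet> e)) *\<^sub>R e) = u \<bullet> w"
proof -
  have "e \<bullet> e = 1" using assms by (simp add: norm_eq_1)
  then show ?thesis
    by (simp add: inner_diff_left inner_diff_right inner_commute[of e u] inner_commute[of e w])
qed

context open_billiard
begin

text \<open>The mirror image of a chain in the plane of the centres is a chain with the same itinerary, hence the same chain.\<close>

lemma chain_planar:
  assumes e: "norm e = 1" and cen: "\<And>i. i \<in> {1..k0} \<Longrightarrow> cen i \<bullet> e = h"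
    and q: "orbit_chain z q"
  shows "q j \<bullet> e = h" "dir q j \<bullet> e = 0" "normal (q j) \<bullet> e = 0"
proof -
  define L where "L v = v - (2 * (v \<bullet> e)) *\<^sub>R e" for v :: "real^3"
  define m where "m p = p - (2 * (p \<bullet> e - h)) *\<^sub>R e" for p :: "real^3"
  have mm: "m p - m p' = L (p - p')" for p p' by (simp add: m_def L_def inner_diff_left algebra_simps)
  have Lin: "L u \<bullet> L w = u \<bullet> w" for u w unfolding L_def by (rule mirror_inner[OF e])
  have Ln: "norm (L u) = norm u" for u using Lin[of u u] by (simp add: norm_eq)
  have Ls: "L (c *\<^sub>R u) = c *\<^sub>R L u" for c u by (simp add: L_def algebra_simps)
  have Ld: "L (u - w) = L u - L w" for u w by (simp add: L_def inner_diff_left algebra_simps)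
  define q' where "q' j = m (q j)" for j
  have zj: "z j \<in> {1..k0}" for j using orbit_chainD(1)[OF q] .
  have mc: "m (cen (z j)) = cen (z j)" for j using cen[OF zj] by (simp add: m_def)
  have qc: "q' j - cen (z j) = L (q j - cen (z j))" for j using mm[of "q j" "cen (z j)"] mc by (simp add: q'_def)
  have sph: "q' j \<in> sphere (cen (z j)) (rad (z j))" for j
    using orbit_chainD(3)[OF q, of j] Ln[of "q j - cen (z j)"] qc[of j] by (simp add: dist_norm norm_minus_commute)
  have nr: "normal (q' j) = L (normal (q j))" for j
    unfolding sphere_normal[OF zj sph] orbit_chainD(6)[OF q, of j] qc Ls ..
  have dr: "dir q' j = L (dir q j)" for j unfolding dir_def q'_def mm Ls Ln ..
  have re: "reflect (q' j) (L u) = L (reflect (q j) u)" for j u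
    unfolding reflect_def nr Lin Ld Ls ..
  have "orbit_chain z q'"
    using q sph unfolding orbit_chain_def dr nr Lin re by simp
  then have eq: "q' = q" using chain_unique[OF q] by simp
  show h: "q j \<bullet> e = h" for j
  proof -
    have "m (q j) = q j" using eq by (simp add: q'_def fun_eq_iff)
    then have "(2 * (q j \<bullet> e - h)) *\<^sub>R e = 0" by (simp add: m_def)
    then show ?thesis using e by auto
  qed
  show "dir q j \<bullet> e = 0" by (simp add: dir_def inner_diff_left h)
  show "normal (q j) \<bullet> e = 0" unfolding orbit_chainD(6)[OF q] using cen[OF zj[of j]] by (simp add: inner_diff_left h)
qed

lemma flight_length_bounded:
  obtains L where "L > 0" "\<And>z q j. orbit_chain z q \<Longrightarrow> norm (q (j + 1) - q j) \<le> L"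
proof -
  obtain D where D: "D > 0" "\<And>z q z' q' j. orbit_chain z q \<Longrightarrow> orbit_chain z' q' \<Longrightarrow> norm (q j - q' j) \<le> D"
    using chain_positions_close by blast
  have "norm (q (j + 1) - q j) \<le> D" if q: "orbit_chain z q" for z q j
    using D(2)[OF orbit_chain_shift(1)[OF q, of 1] q, of j] by simp
  then show thesis using that D(1) by blast
qed

text \<open>By compactness the broken line through three successive reflection points is bent by a uniform
  amount: the middle one stays away from the segment between the other two.\<close>

lemma cos_bounded_below:
  obtains c1 where "c1 > 0" "\<And>z q j. orbit_chain z q \<Longrightarrow> c1 \<le> dir q j \<bullet> normal (q j)"
proof -
  \<comment> \<open>\<open>H m\<close> consists of the segments between balls other than \<open>m\<close>; it is compact and disjoint from the ball \<open>m\<close>.\<close>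
  define H where "H m = (\<Union>(i, l)\<in>{(i, l). i \<in> {1..k0} \<and> l \<in> {1..k0} \<and> i \<noteq> m \<and> l \<noteq> m}.
     (\<lambda>(u, p, p'). (1 - u) *\<^sub>R p + u *\<^sub>R p') ` ({0..1::real} \<times> Kball i \<times> Kball l))" for m
  define C where "C = (\<Union>m\<in>{1..k0}. H m \<times> Kball m)"
  have "compact (H m)" for m unfolding H_def
  proof (rule compact_UN)
    show "finite {(i, l). i \<in> {1..k0} \<and> l \<in> {1..k0} \<and> i \<noteq> m \<and> l \<noteq> m}"
      by (rule finite_subset[of _ "{1..k0} \<times> {1..k0}"]) auto
    show "compact (case x of (i, l) \<Rightarrow> (\<lambda>(u, p, p'). (1 - u) *\<^sub>R p + u *\<^sub>R p') ` ({0..1::real} \<times> Kball i \<times> Kball l))" for x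
    proof (cases x)
      case (Pair i l)
      have "continuous_on S (\<lambda>y::real \<times> (real^3) \<times> (real^3). (1 - fst y) *\<^sub>R fst (snd y) + fst y *\<^sub>R snd (snd y))" for S
        by (intro continuous_intros)
      then show ?thesis unfolding Pair
        by (auto simp: case_prod_unfold Kball_def intro!: compact_continuous_image compact_Times)
    qed
  qed
  then have "compact C" unfolding C_def by (intro compact_UN) (auto simp: Kball_def intro!: compact_Times)
  have disj: "a \<noteq> b" if "(a, b) \<in> C" for a b
  proof
    assume "a = b"
    with that obtain m i l u p p' where m: "m \<in> {1..k0}" "a \<in> Kball m" "i \<in> {1..k0}" "l \<in> {1..k0}" "i \<noteq> m" "l \<noteq> m"
      "a = (1 - u) *\<^sub>R p + u *\<^sub>R p'" "0 \<le> u" "u \<le> 1" "p \<in> Kball i" "p' \<in> Kball l"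
      unfolding C_def H_def by auto
    then show False using hull_avoids[of i l m p p' u] by auto
  qed
  obtain d where d: "d > 0" "\<And>a b. (a, b) \<in> C \<Longrightarrow> d \<le> dist a b"
  proof (cases "C = {}")
    case True
    then show thesis using that[of 1] by simp
  next
    case False
    have "continuous_on C (\<lambda>y. dist (fst y) (snd y))" by (intro continuous_intros)
    then obtain y where y: "y \<in> C" "\<And>y'. y' \<in> C \<Longrightarrow> dist (fst y) (snd y) \<le> dist (fst y') (snd y')"
      using continuous_attains_inf[OF \<open>compact C\<close> False] by blast
    have "dist (fst y) (snd y) > 0" using disj[of "fst y" "snd y"] y(1) by simp
    then show thesis using that[of "dist (fst y) (snd y)"] y(2) by force
  qed
  obtain L where L: "L > 0" "\<And>z q j. orbit_chain z q \<Longrightarrow> norm (q (j + 1) - q j) \<le> L"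
    using flight_length_bounded by blast
  have "d / (2 * L) \<le> dir q j \<bullet> normal (q j)" if q: "orbit_chain z q" for z q j
  proof -
    let ?a = "q (j - 1)" let ?b = "q j" let ?c = "q (j + 1)"
    define s t where "s = norm (?b - ?a)" and "t = norm (?c - ?b)"
    let ?k = "dir q j \<bullet> normal (q j)"
    have s: "gap \<le> s" and t: "gap \<le> t" "t \<le> L"
      using orbit_chainD(9)[OF q, of "j - 1"] orbit_chainD(9)[OF q, of j] L(2)[OF q, of j] by (auto simp: s_def t_def)
    have st: "s > 0" "t > 0" using s t gap_pos by linarith+
    define u where "u = s / (s + t)"
    have u: "0 \<le> u" "u \<le> 1" using st by (auto simp: u_def)
    have ab: "?b = ?a + s *\<^sub>R dir q (j - 1)" using orbit_chainD(11)[OF q, of "j - 1"] by (simp add: s_def)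
    have bc: "?c = ?b + t *\<^sub>R dir q j" using orbit_chainD(11)[OF q, of j] by (simp add: t_def)
    have a: "?a = ?b - s *\<^sub>R dir q (j - 1)" using ab by (simp add: algebra_simps)
    \<comment> \<open>The point of the chord at which the chord crosses the normal line through \<open>?b\<close>.\<close>
    define p where "p = (1 - u) *\<^sub>R ?a + u *\<^sub>R ?c"
    have ut: "(1 - u) * s = u * t" using st by (simp add: u_def field_simps)
    have "p = ?b + (u * t) *\<^sub>R dir q j - ((1 - u) * s) *\<^sub>R dir q (j - 1)"
      unfolding p_def bc a by (simp add: algebra_simps)
    also have "\<dots> = ?b + (u * t) *\<^sub>R (dir q j - dir q (j - 1))" unfolding ut by (simp add: scaleR_diff_right)
    also have "dir q j - dir q (j - 1) = (2 * ?k) *\<^sub>R normal (q j)"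
      using orbit_chainD(8)[OF q, of j] by (simp add: reflect_def)
    finally have pb: "p = ?b + (u * t) *\<^sub>R ((2 * ?k) *\<^sub>R normal (q j))" .
    have k: "?k > 0" using orbit_chainD(7)[OF q] .
    have dist: "dist p ?b = u * t * (2 * ?k)"
      unfolding pb using norm_normal[OF orbit_chainD(4)[OF q, of j]] k st u by (simp add: dist_norm)
    have zn: "z (j - 1) \<noteq> z j" "z (j + 1) \<noteq> z j" using orbit_chainD(2)[OF q, of "j - 1"] orbit_chainD(2)[OF q, of j] by auto
    have qK: "q i \<in> Kball (z i)" for i using orbit_chainD(3)[OF q, of i] by (auto simp: Kball_def)
    have "p \<in> (\<lambda>(u, p, p'). (1 - u) *\<^sub>R p + u *\<^sub>R p') ` ({0..1} \<times> Kball (z (j - 1)) \<times> Kball (z (j + 1)))"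
      unfolding p_def using u qK by (intro image_eqI[of _ _ "(u, ?a, ?c)"]) auto
    then have "p \<in> H (z j)" unfolding H_def using zn orbit_chainD(1)[OF q] by blast
    then have "(p, ?b) \<in> C" unfolding C_def using qK orbit_chainD(1)[OF q] by blast
    then have "d \<le> u * t * (2 * ?k)" using d(2) dist by metis
    also have "\<dots> \<le> 1 * L * (2 * ?k)" using u t st k by (intro mult_right_mono mult_mono) auto
    finally show ?thesis using L(1) by (simp add: field_simps)
  qed
  then show thesis using that[of "d / (2 * L)"] d(1) L(1) by simp
qed

lemma chain_successive_reflection:
  assumes q: "orbit_chain z q"
  shows "successive_reflection_points (q j) (q (j + 1)) (q (j + 2))"
proof -
  let ?x = "(q j, dir q j)" let ?s = "norm (q (j + 1) - q j)" let ?t = "norm (q (j + 2) - q (j + 1))"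
  have j2: "j + 1 + 1 = j + 2" by simp
  have n1: "nxt ?x = (q (j + 1), dir q (j + 1))" "ret ?x = ?s" using chain_nxt[OF q, of j] by auto
  have n2: "nxt (q (j + 1), dir q (j + 1)) = (q (j + 2), dir q (j + 2))" "ret (q (j + 1), dir q (j + 1)) = ?t"
    using chain_nxt[OF q, of "j + 1"] unfolding j2 by auto
  have x: "?x \<in> M1" using chain_M1[OF q] .
  have pos: "?s > 0" "?t > 0" "ret (q (j + 2), dir q (j + 2)) > 0"
    using ret_pos[OF recorded_M1[OF chain_M1[OF q]]] n1(2) n2(2) by metis+
  define \<gamma> where "\<gamma> t = billiard_flow t ?x" for t
  have g: "billiard_trajectory \<gamma>" unfolding \<gamma>_def using billiard_flow_trajectory(1)[OF x] .
  have f0: "\<gamma> u = (q j + u *\<^sub>R dir q j, dir q j)" if "0 \<le> u" "u < ?s" for u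
    using billiard_flow_before_ret[OF x, of u] that n1 by (simp add: \<gamma>_def)
  have f1: "\<gamma> (?s + u) = (q (j + 1) + u *\<^sub>R dir q (j + 1), dir q (j + 1))" if "0 \<le> u" "u < ?t" for u
    using billiard_flow_recorded[OF x, of u 1] that n1 n2 by (simp add: \<gamma>_def record_time_def)
  have f2: "\<gamma> (?s + ?t) = (q (j + 2), dir q (j + 2))"
    using billiard_flow_recorded[OF x, of 0 2] n1 n2 pos by (simp add: \<gamma>_def record_time_def numeral_2_eq_2)
  have fr: "q i \<in> frontier K" for i using orbit_chainD(4)[OF q] .
  have nf: "q i + u *\<^sub>R dir q i \<notin> frontier K" if "0 < u" "u < norm (q (i + 1) - q i)" for i u
    using segment_avoids_K[OF q that] closed_K by (simp add: frontier_def)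
  have "{t \<in> {0..?s + ?t}. fst (\<gamma> t) \<in> frontier K} = {0, ?s, ?s + ?t}"
  proof
    show "{0, ?s, ?s + ?t} \<subseteq> {t \<in> {0..?s + ?t}. fst (\<gamma> t) \<in> frontier K}"
      using f0[of 0] f1[of 0] f2 pos fr by auto
    show "{t \<in> {0..?s + ?t}. fst (\<gamma> t) \<in> frontier K} \<subseteq> {0, ?s, ?s + ?t}"
    proof
      fix u assume u: "u \<in> {t \<in> {0..?s + ?t}. fst (\<gamma> t) \<in> frontier K}"
      consider "u = 0" | "0 < u" "u < ?s" | "u = ?s" | "?s < u" "u < ?s + ?t" | "u = ?s + ?t" using u by force
      then show "u \<in> {0, ?s, ?s + ?t}"
      proof cases
        case 2
        then show ?thesis using u f0[of u] nf[of u j] by simp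
      next
        case 4
        then show ?thesis using u f1[of "u - ?s"] nf[of "u - ?s" "j + 1"] unfolding j2 by simp
      qed auto
    qed
  qed
  moreover have "fst (\<gamma> 0) = q j" "fst (\<gamma> ?s) = q (j + 1)" "fst (\<gamma> (?s + ?t)) = q (j + 2)"
    using f0[of 0] f1[of 0] f2 pos by auto
  ultimately show ?thesis unfolding successive_reflection_points_def using g pos
    by (intro exI[of _ \<gamma>] exI[of _ 0] exI[of _ ?s] exI[of _ "?s + ?t"]) auto
qed

lemma chain_cos_reflection:
  assumes q: "orbit_chain z q"
  shows "cos_reflection (q (j + 1)) (q (j + 2)) = dir q (j + 1) \<bullet> normal (q (j + 1))"
  unfolding cos_reflection_def dir_def by (simp add: add.commute inner_commute)

section \<open>A smooth formula for the billiard map\<close>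

text \<open>The smaller root of the quadratic equation for the time at which a particle moving with unit velocity meets
  the sphere of the ball \<open>l\<close>.\<close>

definition entry_time :: "nat \<Rightarrow> phase \<Rightarrow> real" where
  "entry_time l y = - ((fst y - cen l) \<bullet> snd y)
     - sqrt (((fst y - cen l) \<bullet> snd y)\<^sup>2 - (fst y - cen l) \<bullet> (fst y - cen l) + (rad l)\<^sup>2)"

definition discriminant :: "nat \<Rightarrow> phase \<Rightarrow> real" where
  "discriminant l y = ((fst y - cen l) \<bullet> snd y)\<^sup>2 - (fst y - cen l) \<bullet> (fst y - cen l) + (rad l)\<^sup>2"

definition entry_map :: "nat \<Rightarrow> phase \<Rightarrow> phase" where
  "entry_map l y = (let q = fst y + entry_time l y *\<^sub>R snd y; n = (q - cen l) /\<^sub>R rad l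
     in (q, snd y - (2 * (snd y \<bullet> n)) *\<^sub>R n))"

lemma entry_time_eq: "entry_time l y = - ((fst y - cen l) \<bullet> snd y) - sqrt (discriminant l y)"
  by (simp add: entry_time_def discriminant_def)

lemma distance_along_ray:
  assumes v: "norm v = 1"
  shows "(norm (q + s *\<^sub>R v - cen l))\<^sup>2 = (s + (q - cen l) \<bullet> v)\<^sup>2 - discriminant l (q, v) + (rad l)\<^sup>2"
proof -
  have e: "q + s *\<^sub>R v - cen l = (q - cen l) + s *\<^sub>R v" by simp
  have "(norm (q + s *\<^sub>R v - cen l))\<^sup>2 = (norm (q - cen l))\<^sup>2 + 2 * s * ((q - cen l) \<bullet> v) + s\<^sup>2"
    unfolding e by (rule norm_add_scaleR_sq[OF v])
  then show ?thesis unfolding discriminant_def fst_conv snd_conv dot_square_norm power2_sum by linarith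
qed

lemma entry_point_on_sphere:
  assumes v: "norm (snd y) = 1" and d: "discriminant l y > 0" and l: "l \<in> {1..k0}"
  defines "q \<equiv> fst y + entry_time l y *\<^sub>R snd y"
  shows "norm (q - cen l) = rad l" "(q - cen l) \<bullet> snd y = - sqrt (discriminant l y)"
    "\<And>s. s < entry_time l y \<Longrightarrow> fst y + s *\<^sub>R snd y \<notin> Kball l"
proof -
  let ?b = "(fst y - cen l) \<bullet> snd y" let ?t = "entry_time l y"
  have r: "rad l > 0" using rad_pos l by blast
  have sd: "sqrt (discriminant l y) > 0" using d by simp
  have tb: "?t + ?b = - sqrt (discriminant l y)" by (simp add: entry_time_eq)
  have "(norm (q - cen l))\<^sup>2 = (rad l)\<^sup>2"
    unfolding q_def distance_along_ray[OF v] using d tb by simp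
  then show "norm (q - cen l) = rad l" using r by simp
  have "(q - cen l) \<bullet> snd y = ?b + ?t * (snd y \<bullet> snd y)" by (simp add: q_def inner_diff_left inner_add_left)
  then show "(q - cen l) \<bullet> snd y = - sqrt (discriminant l y)" using v tb by (simp add: dot_square_norm)
  fix s assume s: "s < ?t"
  have "sqrt (discriminant l y) < - (s + ?b)" using s tb by linarith
  then have "(sqrt (discriminant l y))\<^sup>2 < (- (s + ?b))\<^sup>2" using sd by (intro power_strict_mono) auto
  then have "(sqrt (discriminant l y))\<^sup>2 < (s + ?b)\<^sup>2" by (simp only: power2_minus)
  then have "(norm (fst y + s *\<^sub>R snd y - cen l))\<^sup>2 > (rad l)\<^sup>2"
    unfolding distance_along_ray[OF v] using d by simp
  then have "norm (fst y + s *\<^sub>R snd y - cen l) > rad l" using r by (simp add: power2_less_imp_less)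
  then show "fst y + s *\<^sub>R snd y \<notin> Kball l" by (simp add: Kball_def dist_norm norm_minus_commute)
qed

lemma isCont_entry_time: "isCont (entry_time l) x" "isCont (discriminant l) x"
  unfolding entry_time_def[abs_def] discriminant_def[abs_def] by (intro continuous_intros)+

lemma trapped_entry:
  assumes x: "x \<in> M0"
  defines "l \<equiv> ball_index (fst (nxt x))"
  shows "l \<in> {1..k0}" "discriminant l x > 0" "entry_time l x = ret x"
    "sqrt (discriminant l x) = - (rad l * (snd x \<bullet> normal (fst (nxt x))))"
proof -
  have x1: "x \<in> M1" and h: "hits x" using M0_M1 M0_hits x by blast+
  note F = first_entry[OF x1 h, folded fst_nxt]
  have l: "l \<in> {1..k0}" "norm (fst (nxt x) - cen l) = rad l" "rad l > 0"
    using frontierE[OF F(2)] unfolding l_def by blast+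
  show "l \<in> {1..k0}" by fact
  have v: "norm (snd x) = 1" using M1_D[OF x1] by simp
  let ?b = "(fst x - cen l) \<bullet> snd x"
  have "(ret x + ?b)\<^sup>2 - discriminant l x = 0"
    using distance_along_ray[OF v, of "fst x" "ret x" l] l(2) by (simp add: fst_nxt)
  then have d: "discriminant l x = (ret x + ?b)\<^sup>2" by simp
  have vv: "snd x \<bullet> snd x = 1" using v by (simp add: dot_square_norm)
  have b: "ret x + ?b = rad l * (snd x \<bullet> normal (fst (nxt x)))"
  proof -
    have "rad l *\<^sub>R normal (fst (nxt x)) = fst (nxt x) - cen l" using l by (simp add: normal_def l_def)
    then have "rad l * (snd x \<bullet> normal (fst (nxt x))) = (fst (nxt x) - cen l) \<bullet> snd x"
      by (metis inner_commute inner_scaleR_right)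
    then show ?thesis by (simp add: fst_nxt inner_diff_left inner_add_left vv)
  qed
  have neg: "ret x + ?b < 0" unfolding b using F(3) l(3) by (simp add: mult_pos_neg)
  show "discriminant l x > 0" unfolding d using neg by (simp add: zero_less_power2)
  have "sqrt (discriminant l x) = - (ret x + ?b)" unfolding d using neg by simp
  then show "entry_time l x = ret x" "sqrt (discriminant l x) = - (rad l * (snd x \<bullet> normal (fst (nxt x))))"
    unfolding entry_time_eq using b by simp_all
qed

text \<open>Near a point of the trapped set the billiard map is given by a smooth formula: by the no-eclipse condition the
  segment of flight has a positive distance from the balls at which it does not begin or end, and so neighbouring
  segments avoid these balls, too.\<close>

lemma billiard_map_locally_entry_map:
  assumes x: "x \<in> M0"
  defines "l \<equiv> ball_index (fst (nxt x))"
  shows "\<forall>\<^sub>F y in at x within M1. billiard_map y = entry_map l y"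
proof -
  let ?i = "ball_index (fst x)" let ?t = "entry_time l"
  have x1: "x \<in> M1" and h: "hits x" using M0_M1 M0_hits x by blast+
  note T = trapped_entry[OF x, folded l_def]
  have xf: "fst x \<in> frontier K" using M1_D[OF x1] by simp
  have i: "?i \<in> {1..k0}" "fst x \<in> Kball ?i" using frontierE[OF xf] by blast+
  have tx: "?t x > 0" using T(3) ret_pos[OF recorded_M1[OF x1]] by simp
  define W where "W = (\<Union>m\<in>{1..k0} - {?i, l}. Kball m)"
  have W: "closed W" unfolding W_def Kball_def by auto
  define seg where "seg y = (\<lambda>u. fst y + (u * ?t y) *\<^sub>R snd y) ` {0..1}" for y
  have nx: "fst (nxt x) \<in> Kball l" using frontierE[OF first_entry(2)[OF x1 h]] unfolding l_def fst_nxt by blast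
  have "seg x \<inter> W = {}"
  proof -
    have "fst x + (u * ?t x) *\<^sub>R snd x \<notin> Kball m" if "u \<in> {0..1}" "m \<in> {1..k0} - {?i, l}" for u m
    proof -
      have "fst x + (u * ?t x) *\<^sub>R snd x = (1 - u) *\<^sub>R fst x + u *\<^sub>R fst (nxt x)"
        unfolding T(3) fst_nxt by (simp add: algebra_simps)
      also have "\<dots> \<notin> Kball m" using that T(1) i nx by (intro hull_avoids[of ?i l]) auto
      finally show ?thesis .
    qed
    then show ?thesis unfolding seg_def W_def by blast
  qed
  note disj = this
  have "compact (seg x)" unfolding seg_def
    by (intro compact_continuous_image continuous_intros) simp
  from separate_compact_closed[OF this W disj]
  obtain d where d: "d > 0" "\<And>p w. p \<in> seg x \<Longrightarrow> w \<in> W \<Longrightarrow> d \<le> dist p w"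
    by blast
  note ct = isCont_entry_time[where l = l and x = x]
  have "isCont (\<lambda>y. ?t y *\<^sub>R snd y) x" "isCont (fst :: phase \<Rightarrow> real^3) x" by (intro continuous_intros ct)+
  note c = ct[THEN continuous_at_imp_continuous_at_within[where s=M1]]
    this[THEN continuous_at_imp_continuous_at_within[where s=M1]]
  have e0: "\<forall>\<^sub>F y in at x within M1. y \<in> M1" by (simp add: eventually_at_filter)
  have e1: "\<forall>\<^sub>F y in at x within M1. ?t y > 0"
    using order_tendstoD(1)[OF c(1)[unfolded continuous_within] tx] .
  have e2: "\<forall>\<^sub>F y in at x within M1. discriminant l y > 0"
    using order_tendstoD(1)[OF c(2)[unfolded continuous_within] T(2)] .
  have e3: "\<forall>\<^sub>F y in at x within M1. dist (?t y *\<^sub>R snd y) (?t x *\<^sub>R snd x) < d / 2"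
    using tendstoD[OF c(3)[unfolded continuous_within], of "d / 2"] d by simp
  have e4: "\<forall>\<^sub>F y in at x within M1. dist (fst y) (fst x) < d / 2"
    using tendstoD[OF c(4)[unfolded continuous_within], of "d / 2"] d by simp
  have e5: "\<forall>\<^sub>F y in at x within M1. dist (fst y) (fst x) < gap"
    using tendstoD[OF c(4)[unfolded continuous_within] gap_pos] .
  show ?thesis using e0 e1 e2 e3 e4 e5
  proof eventually_elim
    case (elim y)
    have yv: "norm (snd y) = 1" and yf: "fst y \<in> frontier K" and yn: "snd y \<bullet> normal (fst y) > 0"
      using M1_D[OF elim(1)] by auto
    have yb: "ball_index (fst y) \<in> {1..k0}" "fst y \<in> Kball (ball_index (fst y))"
      using frontierE[OF yf] by blast+
    have yi: "ball_index (fst y) = ?i"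
    proof (rule ccontr)
      assume "ball_index (fst y) \<noteq> ?i"
      then have "gap \<le> dist (fst y) (fst x)"
        using dist_balls_ge_gap[OF yb(1) i(1) _ yb(2) i(2)] by simp
      then show False using elim by simp
    qed
    note E = entry_point_on_sphere[OF yv elim(3) T(1)]
    let ?q = "fst y + ?t y *\<^sub>R snd y"
    have qs: "?q \<in> sphere (cen l) (rad l)" using E(1) by (simp add: dist_norm norm_minus_commute)
    have qf: "?q \<in> frontier K" using qs T(1) unfolding frontier_K by blast
    have n: "normal ?q = (?q - cen l) /\<^sub>R rad l" using sphere_normal[OF T(1) qs] .
    have r: "rad l > 0" using rad_pos T(1) by blast
    have inc: "snd y \<bullet> normal ?q < 0"
    proof -
      have "snd y \<bullet> normal ?q = - sqrt (discriminant l y) / rad l"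
        unfolding n using E(2) by (simp add: inner_commute divide_inverse)
      then show ?thesis using elim(3) r by (simp add: divide_neg_pos)
    qed
    have out: "fst y + s *\<^sub>R snd y \<notin> interior K" if s: "0 < s" "s < ?t y" for s
    proof -
      have "fst y + s *\<^sub>R snd y \<notin> Kball m" if m: "m \<in> {1..k0}" for m
      proof -
        consider "m = l" | "m = ?i" | "m \<in> {1..k0} - {?i, l}" using m by blast
        then show ?thesis
        proof cases
          case 1
          then show ?thesis using E(3)[OF s(2)] by simp
        next
          case 2
          then show ?thesis using outgoing_ray_leaves[OF yf yv less_imp_le[OF yn] s(1)] yi by simp
        next
          case 3
          define u where "u = s / ?t y"
          have u: "0 \<le> u" "u \<le> 1" "s = u * ?t y" using s by (auto simp: u_def)
          let ?p = "fst x + (u * ?t x) *\<^sub>R snd x"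
          have p: "?p \<in> seg x" unfolding seg_def using u by auto
          have pe: "?p - (fst y + s *\<^sub>R snd y) = (fst x - fst y) + u *\<^sub>R (?t x *\<^sub>R snd x - ?t y *\<^sub>R snd y)"
            unfolding u(3) by (simp add: algebra_simps)
          have "dist ?p (fst y + s *\<^sub>R snd y) \<le> norm (fst x - fst y) + u * norm (?t x *\<^sub>R snd x - ?t y *\<^sub>R snd y)"
            using norm_triangle_ineq[of "fst x - fst y" "u *\<^sub>R (?t x *\<^sub>R snd x - ?t y *\<^sub>R snd y)"] u(1)
            unfolding dist_norm pe by simp
          also have "\<dots> \<le> norm (fst x - fst y) + 1 * norm (?t x *\<^sub>R snd x - ?t y *\<^sub>R snd y)"
            using u by (intro add_left_mono mult_right_mono) auto
          also have "\<dots> < d" using elim(4,5) by (simp add: dist_norm norm_minus_commute)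
          finally have "fst y + s *\<^sub>R snd y \<notin> W" using d(2)[OF p] by force
          then show ?thesis using 3 unfolding W_def by blast
        qed
      qed
      then show ?thesis using interior_subset[of K] unfolding K_def by blast
    qed
    note N = first_entry_eqI[OF yv elim(2) qf inc out]
    show ?case using billiard_map_eq_nxt[OF elim(1) N(1)] N(3)
      by (simp add: entry_map_def Let_def reflect_def n)
  qed
qed

end

section \<open>The derivative of the billiard map\<close>

text \<open>If \<open>\<bar>p\<bar> = r\<close>, \<open>A = \<bar>a\<bar>\<^sup>2\<close> and \<open>a\<close> is orthogonal to \<open>p\<close>, this curve stays on the sphere of radius \<open>r\<close>.\<close>

lemma normalized_line_derivative:
  fixes p a :: "'a::real_inner"
  assumes r: "r > 0"
  shows "((\<lambda>s. (r / sqrt (r\<^sup>2 + s\<^sup>2 * A)) *\<^sub>R (p + s *\<^sub>R a)) has_vector_derivative a) (at 0)"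
proof -
  have s: "((\<lambda>s. r / sqrt (r\<^sup>2 + s\<^sup>2 * A)) has_real_derivative 0) (at 0)"
    using r by (auto intro!: derivative_eq_intros)
  have l: "((\<lambda>s. p + s *\<^sub>R a) has_vector_derivative a) (at 0)"
    by (auto intro!: derivative_eq_intros simp: has_vector_derivative_def)
  have "((\<lambda>s. (r / sqrt (r\<^sup>2 + s\<^sup>2 * A)) *\<^sub>R (p + s *\<^sub>R a)) has_vector_derivative
      ((r / sqrt (r\<^sup>2 + 0\<^sup>2 * A)) *\<^sub>R a + 0 *\<^sub>R (p + 0 *\<^sub>R a))) (at 0)"
    by (rule has_vector_derivative_scaleR[OF s l])
  then show ?thesis using r by simp
qed

text \<open>By Lagrange's identity \<open>w = e \<times> (w \<times> e)\<close> and \<open>e = n \<times> (e \<times> n)\<close>.\<close>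

lemma plane_decomposition:
  fixes e n w :: "real^3"
  assumes e: "norm e = 1" and n: "norm n = 1" and en: "n \<bullet> e = 0" and w: "w \<bullet> e = 0"
  shows "w = (w \<bullet> n) *\<^sub>R n + (w \<bullet> cross3 e n) *\<^sub>R cross3 e n"
proof -
  have ee: "e \<bullet> e = 1" and nn: "n \<bullet> n = 1" using e n by (auto simp: norm_eq_1)
  let ?t = "cross3 e n"
  have nt: "cross3 n ?t = e" using Lagrange[of n e n] en nn by simp
  have et: "cross3 e ?t = - n" using Lagrange[of e e n] en ee by (simp add: inner_commute)
  have "cross3 w e = (w \<bullet> ?t) *\<^sub>R n - (w \<bullet> n) *\<^sub>R ?t" using Lagrange[of w n ?t] unfolding nt by simp
  moreover have "cross3 e (cross3 w e) = w" using Lagrange[of e w e] ee w by (simp add: inner_commute)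
  ultimately have "w = cross3 e ((w \<bullet> ?t) *\<^sub>R n - (w \<bullet> n) *\<^sub>R ?t)" by simp
  also have "\<dots> = (w \<bullet> ?t) *\<^sub>R ?t - (w \<bullet> n) *\<^sub>R cross3 e ?t"
    by (simp add: left_diff_distrib Cross3.right_diff_distrib cross_mult_right)
  finally show ?thesis unfolding et by (simp add: add.commute)
qed

context open_billiard
begin

text \<open>Every tangent vector is the velocity of a curve in \<open>M1\<close>, so derivatives within \<open>M1\<close> are determined
  on the tangent space.\<close>

lemma has_derivative_within_M1_unique:
  assumes x: "x \<in> M1" and w: "w \<in> tangent_space x"
    and f: "(f has_derivative D) (at x within M1)" and g: "(f has_derivative D') (at x within M1)"
  shows "D w = D' w"
proof -
  obtain a b where ab: "w = (a, b)" by (cases w)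
  let ?i = "ball_index (fst x)" let ?O = "cen ?i" let ?r = "rad ?i" let ?v = "snd x"
  define p where "p = fst x - ?O"
  have xf: "fst x \<in> frontier K" using M1_D[OF x] by simp
  have i: "?i \<in> {1..k0}" "norm p = ?r" "?r > 0" using frontierE[OF xf] unfolding p_def by blast+
  have v: "norm ?v = 1" using M1_D[OF x] by simp
  have nx: "normal (fst x) = p /\<^sub>R ?r" by (simp add: normal_def p_def)
  have pa: "p \<bullet> a = 0" "?v \<bullet> b = 0"
    using w i unfolding ab tangent_space_def nx by (auto simp: inner_commute)
  define c1 where "c1 s = (?r / sqrt (?r\<^sup>2 + s\<^sup>2 * (norm a)\<^sup>2)) *\<^sub>R (p + s *\<^sub>R a)" for s
  define c2 where "c2 s = (1 / sqrt (1\<^sup>2 + s\<^sup>2 * (norm b)\<^sup>2)) *\<^sub>R (?v + s *\<^sub>R b)" for s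
  define c where "c s = (?O + c1 s, c2 s)" for s
  have n1: "norm (c1 s) = ?r" for s
  proof -
    have "(norm (p + s *\<^sub>R a))\<^sup>2 = ?r\<^sup>2 + s\<^sup>2 * (norm a)\<^sup>2"
      using norm_add_Pythagorean[of p "s *\<^sub>R a"] pa i by (simp add: orthogonal_def power_mult_distrib)
    then have "sqrt (?r\<^sup>2 + s\<^sup>2 * (norm a)\<^sup>2) = norm (p + s *\<^sub>R a)" by (metis norm_ge_zero real_sqrt_unique)
    moreover have "?r\<^sup>2 + s\<^sup>2 * (norm a)\<^sup>2 > 0" using i by (simp add: add_pos_nonneg)
    ultimately have "norm (p + s *\<^sub>R a) > 0" by (metis real_sqrt_gt_zero)
    then show ?thesis using i \<open>sqrt _ = _\<close> unfolding c1_def by simp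
  qed
  have n2: "norm (c2 s) = 1" for s
  proof -
    have "(norm (?v + s *\<^sub>R b))\<^sup>2 = 1 + s\<^sup>2 * (norm b)\<^sup>2"
      using norm_add_Pythagorean[of ?v "s *\<^sub>R b"] pa v by (simp add: orthogonal_def power_mult_distrib)
    then have "sqrt (1 + s\<^sup>2 * (norm b)\<^sup>2) = norm (?v + s *\<^sub>R b)" by (metis norm_ge_zero real_sqrt_unique)
    moreover have "1 + s\<^sup>2 * (norm b)\<^sup>2 > 0" by (simp add: add_pos_nonneg)
    ultimately have "norm (?v + s *\<^sub>R b) > 0" by (metis real_sqrt_gt_zero)
    then show ?thesis using \<open>sqrt _ = _\<close> unfolding c2_def by simp
  qed
  have c0: "c 0 = x" using i by (simp add: c_def c1_def c2_def p_def)
  define S where "S = {s. 0 < (?v + s *\<^sub>R b) \<bullet> (p + s *\<^sub>R a)}"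
  have S: "open S" unfolding S_def by (intro open_Collect_less continuous_intros)
  have S0: "0 \<in> S" using M1_D(3)[OF x] i unfolding S_def nx by (simp add: zero_less_mult_iff)
  have cS: "c s \<in> M1" if s: "s \<in> S" for s
  proof -
    have sph: "?O + c1 s \<in> sphere ?O ?r" using n1 by (simp add: dist_norm)
    have fr: "?O + c1 s \<in> frontier K" using sph i(1) unfolding frontier_K by blast
    have nn: "normal (?O + c1 s) = c1 s /\<^sub>R ?r" using sphere_normal[OF i(1) sph] by simp
    have pos: "?r\<^sup>2 + s\<^sup>2 * (norm a)\<^sup>2 > 0" "1\<^sup>2 + s\<^sup>2 * (norm b)\<^sup>2 > 0" using i by (simp_all add: add_pos_nonneg)
    have "c2 s \<bullet> c1 s = (1 / sqrt (1\<^sup>2 + s\<^sup>2 * (norm b)\<^sup>2)) * (?r / sqrt (?r\<^sup>2 + s\<^sup>2 * (norm a)\<^sup>2)) * ((?v + s *\<^sub>R b) \<bullet> (p + s *\<^sub>R a))"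
      unfolding c1_def c2_def by simp
    also have "\<dots> > 0" using s i pos unfolding S_def by (intro mult_pos_pos divide_pos_pos) auto
    finally have "c2 s \<bullet> c1 s > 0" .
    then have "c2 s \<bullet> normal (?O + c1 s) > 0" unfolding nn using i by simp
    then show ?thesis using fr n2 unfolding c_def M1_def by simp
  qed
  have "(c1 has_vector_derivative a) (at 0)" unfolding c1_def
    by (rule normalized_line_derivative[OF i(3)])
  then have d1: "((\<lambda>s. ?O + c1 s) has_derivative (\<lambda>h. h *\<^sub>R a)) (at 0)"
    unfolding has_vector_derivative_def by (auto intro!: derivative_eq_intros)
  have "(c2 has_vector_derivative b) (at 0)" unfolding c2_def
    by (rule normalized_line_derivative) simp
  then have d2: "(c2 has_derivative (\<lambda>h. h *\<^sub>R b)) (at 0)" unfolding has_vector_derivative_def .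
  have dc: "(c has_derivative (\<lambda>h. h *\<^sub>R w)) (at 0 within S)"
    using has_derivative_Pair[OF d1 d2] unfolding c_def ab by (auto intro: has_derivative_at_withinI)
  have comp: "((\<lambda>s. f (c s)) has_derivative (\<lambda>h. E (h *\<^sub>R w))) (at 0)" if E: "(f has_derivative E) (at x within M1)" for E
  proof -
    have "c ` S \<subseteq> M1" using cS by blast
    then have "(f has_derivative E) (at (c 0) within c ` S)" using has_derivative_subset[OF E] c0 by simp
    from has_derivative_in_compose[OF dc this] show ?thesis using at_within_open[OF S0 S] by simp
  qed
  have "(\<lambda>h. D (h *\<^sub>R w)) = (\<lambda>h. D' (h *\<^sub>R w))"
    by (rule has_derivative_unique[OF comp[OF f] comp[OF g]])
  from fun_cong[OF this, of 1] show ?thesis by simp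
qed

text \<open>The derivative of the entry time enters only through the number \<open>t'\<close>. It need not be computed: \<open>t'\<close> is determined
  by the condition that the displacement \<open>dq\<close> of the point of impact is tangent to the sphere, which comes from
  differentiating the equation of the sphere.\<close>

lemma dB_formula:
  assumes x: "x \<in> M0" and w: "(a, b) \<in> tangent_space x"
  defines "v \<equiv> snd x" and "n \<equiv> normal (fst (nxt x))" and "r \<equiv> rad (ball_index (fst (nxt x)))"
  obtains dq t' where "dq = a + ret x *\<^sub>R b + t' *\<^sub>R v" "dq \<bullet> n = 0"
    "dB x (a, b) = (dq, b - (2 * (v \<bullet> dq / r + b \<bullet> n)) *\<^sub>R n - (2 * (v \<bullet> n) / r) *\<^sub>R dq)"
    "linear (dB x)"
proof -
  define l where "l = ball_index (fst (nxt x))"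
  have x1: "x \<in> M1" and h: "hits x" using M0_M1 M0_hits x by blast+
  note T = trapped_entry[OF x, folded l_def]
  have r: "r > 0" using rad_pos[OF T(1)] by (simp add: r_def l_def)
  define q where "q y = fst y + entry_time l y *\<^sub>R snd y" for y
  define N where "N y = (q y - cen l) /\<^sub>R r" for y
  have qx: "q x = fst (nxt x)" unfolding q_def T(3) fst_nxt ..
  have Nx: "N x = n" unfolding N_def qx n_def normal_def l_def[symmetric] r_def by simp
  have em: "entry_map l y = (q y, snd y - (2 * (snd y \<bullet> N y)) *\<^sub>R N y)" for y
    by (simp add: entry_map_def q_def N_def r_def l_def Let_def)
  have "((\<lambda>y. discriminant l y) has_derivative (\<lambda>w. 2 * ((fst x - cen l) \<bullet> snd x) * ((fst x - cen l) \<bullet> snd w + fst w \<bullet> snd x)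
      - ((fst x - cen l) \<bullet> fst w + fst w \<bullet> (fst x - cen l)))) (at x)"
    unfolding discriminant_def by (auto intro!: derivative_eq_intros)
  from has_derivative_real_sqrt[OF T(2) this]
  obtain S where S: "((\<lambda>y. sqrt (discriminant l y)) has_derivative S) (at x)" by blast
  obtain E where E: "(entry_time l has_derivative E) (at x)"
  proof -
    have "((\<lambda>y. - ((fst y - cen l) \<bullet> snd y) - sqrt (discriminant l y)) has_derivative
      (\<lambda>w. - ((fst x - cen l) \<bullet> snd w + fst w \<bullet> snd x) - S w)) (at x)"
      by (rule has_derivative_diff[OF has_derivative_minus S]) (auto intro!: derivative_eq_intros)
    then show thesis using that unfolding entry_time_eq[abs_def] by blast
  qed
  define Q where "Q w = fst w + (ret x *\<^sub>R snd w + E w *\<^sub>R v)" for w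
  have Q: "(q has_derivative Q) (at x)"
    unfolding q_def[abs_def] Q_def[abs_def] by (auto intro!: derivative_eq_intros E simp: T(3) v_def)
  have dN: "(N has_derivative (\<lambda>w. Q w /\<^sub>R r)) (at x)"
    unfolding N_def[abs_def] by (auto intro!: derivative_eq_intros Q)
  define D where "D w = (Q w, snd w - ((2 * (v \<bullet> n)) *\<^sub>R (Q w /\<^sub>R r) + (2 * (v \<bullet> (Q w /\<^sub>R r) + snd w \<bullet> n)) *\<^sub>R n))" for w
  have D: "(entry_map l has_derivative D) (at x)"
    unfolding em[abs_def] D_def[abs_def]
    by (auto intro!: derivative_eq_intros Q dN simp: Nx v_def)
  have bx: "billiard_map x = entry_map l x"
  proof -
    have "fst (nxt x) \<in> frontier K" using first_entry(2)[OF x1 h] by (simp add: fst_nxt)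
    then show ?thesis unfolding M0_billiard_map[OF x] em qx Nx n_def using h
      by (simp add: nxt_def Let_def reflect_def)
  qed
  have BD: "(billiard_map has_derivative D) (at x within M1)"
  proof (rule has_derivative_transform_eventually[OF has_derivative_at_withinI[OF D]])
    show "\<forall>\<^sub>F y in at x within M1. entry_map l y = billiard_map y"
      using billiard_map_locally_entry_map[OF x] unfolding l_def[symmetric] by eventually_elim simp
  qed (use bx x1 in auto)
  then have fd: "(billiard_map has_derivative dB x) (at x within M1)"
    unfolding dB_def frechet_derivative_works[symmetric] differentiable_def by blast
  have dBD: "dB x (a, b) = D (a, b)" by (rule has_derivative_within_M1_unique[OF x1 w fd BD])
  have "((\<lambda>y. (q y - cen l) \<bullet> (q y - cen l)) has_derivative (\<lambda>w. (q x - cen l) \<bullet> Q w + Q w \<bullet> (q x - cen l))) (at x)"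
    by (auto intro!: derivative_eq_intros Q)
  then have G: "((\<lambda>y. (q y - cen l) \<bullet> (q y - cen l)) has_derivative (\<lambda>w. 2 * (Q w \<bullet> (q x - cen l)))) (at x within M1)"
    by (auto intro: has_derivative_at_withinI simp: inner_commute)
  \<comment> \<open>The equation of the sphere holds only for unit velocities, hence only within \<open>M1\<close>.\<close>
  have qr: "(q y - cen l) \<bullet> (q y - cen l) = r\<^sup>2" if "y \<in> M1" "discriminant l y > 0" for y
    using entry_point_on_sphere(1)[OF M1_D(2)[OF that(1)] that(2) T(1)]
    by (simp add: q_def r_def l_def dot_square_norm)
  have "((\<lambda>y. r\<^sup>2) has_derivative (\<lambda>w. 2 * (Q w \<bullet> (q x - cen l)))) (at x within M1)"
  proof (rule has_derivative_transform_eventually[OF G])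
    have "continuous (at x within M1) (discriminant l)"
      by (rule continuous_at_imp_continuous_at_within[OF isCont_entry_time(2)])
    from order_tendstoD(1)[OF this[unfolded continuous_within] T(2)]
    have "\<forall>\<^sub>F y in at x within M1. 0 < discriminant l y" .
    moreover have "\<forall>\<^sub>F y in at x within M1. y \<in> M1" by (simp add: eventually_at_filter)
    ultimately show "\<forall>\<^sub>F y in at x within M1. (q y - cen l) \<bullet> (q y - cen l) = r\<^sup>2"
      by eventually_elim (rule qr)
  qed (use qr[OF x1 T(2)] x1 in auto)
  from has_derivative_within_M1_unique[OF x1 w this has_derivative_const]
  have "Q (a, b) \<bullet> (q x - cen l) = 0" by simp
  then have Qn: "Q (a, b) \<bullet> n = 0" using r unfolding Nx[symmetric] N_def by simp
  show thesis
  proof (rule that[of "Q (a, b)" "E (a, b)"])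
    show "Q (a, b) = a + ret x *\<^sub>R b + E (a, b) *\<^sub>R v" by (simp add: Q_def)
    show "dB x (a, b) = (Q (a, b), b - (2 * (v \<bullet> Q (a, b) / r + b \<bullet> n)) *\<^sub>R n - (2 * (v \<bullet> n) / r) *\<^sub>R Q (a, b))"
      unfolding dBD D_def by (simp add: algebra_simps divide_inverse)
    show "linear (dB x)" using fd by (rule has_derivative_linear)
  qed (fact Qn)
qed

end

section \<open>Perpendicular and in-plane tangent vectors\<close>

lemma cross3_plane:
  fixes e u w :: "real^3"
  assumes "norm e = 1" "u \<bullet> e = 0" "w \<bullet> e = 0"
  shows "cross3 e u \<bullet> cross3 e w = u \<bullet> w" "cross3 e u \<bullet> e = 0" "cross3 e u \<bullet> u = 0" "norm (cross3 e u) = norm u"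
proof -
  have ee: "e \<bullet> e = 1" using assms by (simp add: norm_eq_1)
  have d: "cross3 e y \<bullet> cross3 e y' = y \<bullet> y'" if "y \<bullet> e = 0" "y' \<bullet> e = 0" for y y'
    using that ee by (simp add: dot_cross inner_commute)
  show "cross3 e u \<bullet> cross3 e w = u \<bullet> w" using d assms by blast
  show "cross3 e u \<bullet> e = 0" "cross3 e u \<bullet> u = 0" by (simp_all add: dot_cross_self inner_commute[of _ e])
  show "norm (cross3 e u) = norm u" using d[OF assms(2) assms(2)] by (simp add: norm_eq)
qed

lemma reflected_rotation_combination:
  fixes T N :: "'a::real_vector"
  shows "\<eta> *\<^sub>R (- (c *\<^sub>R T) - s *\<^sub>R N) - (2 * (k * s / r + - (\<eta> * s))) *\<^sub>R N - (2 * - c / r) *\<^sub>R (k *\<^sub>R T)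
    = (2 * c * k / r - \<eta> * c) *\<^sub>R T + (\<eta> * s - 2 * k * s / r) *\<^sub>R N"
proof -
  have "(2 * (k * s / r + - (\<eta> * s))) *\<^sub>R N = (2 * k * s / r) *\<^sub>R N - (\<eta> * s) *\<^sub>R N - (\<eta> * s) *\<^sub>R N"
    unfolding scaleR_left_diff_distrib[symmetric] by (rule arg_cong[where f = "\<lambda>x. x *\<^sub>R N"]) (simp add: algebra_simps)
  then show ?thesis by (simp add: algebra_simps)
qed

locale planar_billiard = open_billiard +
  fixes e :: "real^3" and h :: real
  assumes unit: "norm e = 1" and centres: "\<And>i. i \<in> {1..k0} \<Longrightarrow> cen i \<bullet> e = h"
begin

lemma trapped_planar:
  assumes x: "x \<in> M0"
  shows "snd x \<bullet> e = 0" "normal (fst x) \<bullet> e = 0"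
proof -
  note c = M0_orbit_chain[OF x]
  have s: "snd x = dir (\<lambda>j. fst (billiard_map_pow j x)) 0" using c(2)[of 0] billiard_map_pow_M0(3)[OF x] by simp
  show "snd x \<bullet> e = 0" unfolding s by (rule chain_planar(2)[OF unit centres c(1)])
  have "normal (fst (billiard_map_pow 0 x)) \<bullet> e = 0" by (rule chain_planar(3)[OF unit centres c(1)])
  then show "normal (fst x) \<bullet> e = 0" using billiard_map_pow_M0(3)[OF x] by simp
qed

definition perp_vector :: "real \<times> real \<Rightarrow> phase" where
  "perp_vector p = (fst p *\<^sub>R e, snd p *\<^sub>R e)"

text \<open>The coordinates are the displacement transversal to the velocity and the rotation of the velocity.\<close>

definition inplane_vector :: "phase \<Rightarrow> real \<times> real \<Rightarrow> phase" where
  "inplane_vector x p = ((fst p / (snd x \<bullet> normal (fst x))) *\<^sub>R cross3 e (normal (fst x)), snd p *\<^sub>R cross3 e (snd x))"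

lemma perp_tangent: "x \<in> M0 \<Longrightarrow> perp_vector p \<in> tangent_space x"
  using trapped_planar by (simp add: perp_vector_def tangent_space_def inner_commute[of e])

lemma inplane_tangent: "x \<in> M0 \<Longrightarrow> inplane_vector x p \<in> tangent_space x"
  using cross3_plane(3)[OF unit trapped_planar(2) trapped_planar(2)] cross3_plane(3)[OF unit trapped_planar(1) trapped_planar(1)]
  by (simp add: inplane_vector_def tangent_space_def)

lemma trapped_next:
  assumes x: "x \<in> M0"
  defines "n \<equiv> normal (fst (nxt x))"
  shows "nxt x \<in> M0" "norm n = 1" "n \<bullet> e = 0" "snd x \<bullet> e = 0" "snd (nxt x) = snd x - (2 * (snd x \<bullet> n)) *\<^sub>R n"
    "snd (nxt x) \<bullet> n = - (snd x \<bullet> n)" "snd x \<bullet> n < 0" "rad (ball_index (fst (nxt x))) > 0" "norm (snd x) = 1"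
proof -
  have x1: "x \<in> M1" and h: "hits x" using M0_M1 M0_hits x by blast+
  show nx: "nxt x \<in> M0" using nxt_M0[OF x] .
  have nf: "fst (nxt x) \<in> frontier K" using M1_D(1)[OF M0_M1[OF nx]] .
  show "norm n = 1" unfolding n_def by (rule norm_normal[OF nf])
  show "n \<bullet> e = 0" unfolding n_def by (rule trapped_planar(2)[OF nx])
  show "snd x \<bullet> e = 0" by (rule trapped_planar(1)[OF x])
  have s: "snd (nxt x) = reflect (fst (nxt x)) (snd x)" using h by (simp add: nxt_def Let_def)
  then show "snd (nxt x) = snd x - (2 * (snd x \<bullet> n)) *\<^sub>R n" by (simp add: reflect_def n_def)
  show "snd (nxt x) \<bullet> n = - (snd x \<bullet> n)" unfolding s n_def by (rule reflect_inner_normal[OF nf])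
  show "snd x \<bullet> n < 0" using first_entry(3)[OF x1 h] by (simp add: n_def fst_nxt)
  show "rad (ball_index (fst (nxt x))) > 0" using frontierE[OF nf] by blast
  show "norm (snd x) = 1" using M1_D[OF x1] by simp
qed

lemma dB_perp:
  fixes \<alpha> \<beta> :: real
  assumes x: "x \<in> M0"
  defines "r \<equiv> rad (ball_index (fst (nxt x)))" and "c \<equiv> snd (nxt x) \<bullet> normal (fst (nxt x))"
  defines "\<alpha>' \<equiv> \<alpha> + ret x * \<beta>"
  shows "dB x (perp_vector (\<alpha>, \<beta>)) = perp_vector (\<alpha>', \<beta> + 2 * c / r * \<alpha>')"
proof -
  let ?n = "normal (fst (nxt x))" let ?v = "snd x"
  note N = trapped_next[OF x]
  obtain dq t' where d: "dq = \<alpha> *\<^sub>R e + ret x *\<^sub>R (\<beta> *\<^sub>R e) + t' *\<^sub>R ?v" "dq \<bullet> ?n = 0"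
    "dB x (\<alpha> *\<^sub>R e, \<beta> *\<^sub>R e) = (dq, \<beta> *\<^sub>R e - (2 * (?v \<bullet> dq / r + (\<beta> *\<^sub>R e) \<bullet> ?n)) *\<^sub>R ?n - (2 * (?v \<bullet> ?n) / r) *\<^sub>R dq)"
    using dB_formula[OF x perp_tangent[OF x, of "(\<alpha>, \<beta>)", unfolded perp_vector_def fst_conv snd_conv]]
    unfolding r_def by blast
  have en: "e \<bullet> ?n = 0" using N(3) by (simp add: inner_commute)
  have "t' * (?v \<bullet> ?n) = 0" using d(2) en unfolding d(1) by (simp add: inner_add_left)
  then have "t' = 0" using N(7) by simp
  then have dq: "dq = \<alpha>' *\<^sub>R e" unfolding d(1) \<alpha>'_def by (simp add: algebra_simps)
  have "?v \<bullet> dq = 0" unfolding dq using N(4) by simp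
  then have "dB x (\<alpha> *\<^sub>R e, \<beta> *\<^sub>R e) = (dq, \<beta> *\<^sub>R e - (2 * (?v \<bullet> ?n) / r) *\<^sub>R dq)"
    using d(3) en by simp
  also have "?v \<bullet> ?n = - c" using N(6) by (simp add: c_def)
  finally show ?thesis unfolding perp_vector_def dq by (simp add: algebra_simps)
qed

text \<open>In the orthonormal basis formed by the normal \<open>n\<close> at the impact and \<open>t = e \<times> n\<close> the velocities before and after
  the impact are \<open>s t - c n\<close> and \<open>s t + c n\<close>. The displacement \<open>\<xi>'\<close> transversal to the velocity is the projection of the
  displacement \<open>- (\<xi>' / c) t\<close> along the sphere, and dividing by \<open>c\<close> rather than multiplying is what makes the in-plane
  curvature \<open>2 / (c r)\<close>, whereas the perpendicular one is \<open>2 c / r\<close>. The sign comes from the change of orientation.\<close>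

lemma dB_inplane:
  fixes \<xi> \<eta> :: real
  assumes x: "x \<in> M0"
  defines "r \<equiv> rad (ball_index (fst (nxt x)))" and "c \<equiv> snd (nxt x) \<bullet> normal (fst (nxt x))"
  defines "\<xi>' \<equiv> \<xi> + ret x * \<eta>"
  shows "dB x (inplane_vector x (\<xi>, \<eta>)) = - inplane_vector (nxt x) (\<xi>', \<eta> + 2 / (c * r) * \<xi>')"
proof -
  let ?m = "normal (fst x)" let ?n = "normal (fst (nxt x))" let ?v = "snd x" let ?v1 = "snd (nxt x)"
  let ?t = "cross3 e ?n"
  define a where "a = (\<xi> / (?v \<bullet> ?m)) *\<^sub>R cross3 e ?m"
  define b where "b = \<eta> *\<^sub>R cross3 e ?v"
  have iv: "inplane_vector x (\<xi>, \<eta>) = (a, b)" by (simp add: inplane_vector_def a_def b_def)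
  note N = trapped_next[OF x]
  have r: "r > 0" unfolding r_def by (rule N(8))
  have vn: "?v \<bullet> ?n = - c" using N(6) by (simp add: c_def)
  have c: "c > 0" using N(7) vn by linarith
  have n0: "?m \<bullet> e = 0" "?v \<bullet> ?m > 0" using trapped_planar[OF x] M1_D(3)[OF M0_M1[OF x]] by auto
  define s where "s = ?v \<bullet> ?t"
  have t: "?t \<bullet> e = 0" "?t \<bullet> ?n = 0" "norm ?t = 1"
    using cross3_plane[OF unit N(3) N(3)] N(2) by simp_all
  have tt: "?t \<bullet> ?t = 1" and nn: "?n \<bullet> ?n = 1" using t N(2) by (simp_all add: norm_eq_1)
  have et: "cross3 e ?t = - ?n"
    using Lagrange[of e e ?n] N(3) unit by (simp add: norm_eq_1 inner_commute)
  have v: "?v = s *\<^sub>R ?t - c *\<^sub>R ?n"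
    using plane_decomposition[OF unit N(2) N(3) N(4)] unfolding s_def[symmetric] vn by simp
  have ev: "cross3 e ?v = - (c *\<^sub>R ?t) - s *\<^sub>R ?n"
    unfolding v by (simp add: Cross3.right_diff_distrib cross_mult_right et)
  have v1: "?v1 = s *\<^sub>R ?t + c *\<^sub>R ?n"
  proof -
    have "2 * - c = - c - c" by simp
    then have "(2 * - c) *\<^sub>R ?n = - (c *\<^sub>R ?n) - c *\<^sub>R ?n" by (simp only: scaleR_left_diff_distrib scaleR_minus_left)
    then show ?thesis unfolding N(5) vn by (subst v) simp
  qed
  have ev1: "cross3 e ?v1 = c *\<^sub>R ?t - s *\<^sub>R ?n"
    unfolding v1 by (simp add: cross_add_right cross_mult_right et)
  obtain dq t' where d: "dq = a + ret x *\<^sub>R b + t' *\<^sub>R ?v" "dq \<bullet> ?n = 0"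
    "dB x (a, b) = (dq, b - (2 * (?v \<bullet> dq / r + b \<bullet> ?n)) *\<^sub>R ?n - (2 * (?v \<bullet> ?n) / r) *\<^sub>R dq)"
    using dB_formula[OF x inplane_tangent[OF x, of "(\<xi>, \<eta>)", unfolded iv]] unfolding r_def by blast
  define k where "k = dq \<bullet> ?t"
  have "dq \<bullet> e = 0" unfolding d(1) a_def b_def
    using cross3_plane(2)[OF unit n0(1) n0(1)] cross3_plane(2)[OF unit N(4) N(4)] N(4) by (simp add: inner_add_left)
  from plane_decomposition[OF unit N(2) N(3) this] have dq: "dq = k *\<^sub>R ?t" using d(2) by (simp add: k_def)
  have av: "a \<bullet> cross3 e ?v = \<xi>" unfolding a_def
    using cross3_plane(1)[OF unit n0(1) N(4)] n0(2) by (simp add: inner_commute)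
  have bv: "b \<bullet> cross3 e ?v = \<eta>" unfolding b_def
    using cross3_plane(1)[OF unit N(4) N(4)] N(9) by (simp add: norm_eq_1)
  have "?v \<bullet> cross3 e ?v = 0" using cross3_plane(3)[OF unit N(4) N(4)] by (simp add: inner_commute)
  then have "dq \<bullet> cross3 e ?v = \<xi>'" unfolding d(1) \<xi>'_def using av bv by (simp add: inner_add_left)
  moreover have "dq \<bullet> cross3 e ?v = - (k * c)" unfolding dq ev using tt t(2) by (simp add: inner_diff_right)
  ultimately have k: "k = - (\<xi>' / c)" using c by (simp add: field_simps)
  have vdq: "?v \<bullet> dq = k * s" unfolding dq s_def by simp
  have bn: "b \<bullet> ?n = - (\<eta> * s)" unfolding b_def ev using t(2) nn by (simp add: inner_diff_left)
  have "b - (2 * (?v \<bullet> dq / r + b \<bullet> ?n)) *\<^sub>R ?n - (2 * (?v \<bullet> ?n) / r) *\<^sub>R dq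
      = (2 * c * k / r - \<eta> * c) *\<^sub>R ?t + (\<eta> * s - 2 * k * s / r) *\<^sub>R ?n"
    unfolding vdq bn vn unfolding b_def ev dq by (rule reflected_rotation_combination)
  also have "\<dots> = - ((\<eta> - 2 * k / r) *\<^sub>R cross3 e ?v1)"
    unfolding ev1 by (simp add: algebra_simps)
  also have "\<eta> - 2 * k / r = \<eta> + 2 / (c * r) * \<xi>'" unfolding k by simp
  finally have "dB x (a, b) = (k *\<^sub>R ?t, - ((\<eta> + 2 / (c * r) * \<xi>') *\<^sub>R cross3 e ?v1))"
    using d(3) dq by simp
  then show ?thesis unfolding iv unfolding inplane_vector_def c_def[symmetric] k by simp
qed

end

section \<open>Comparison of wave fronts\<close>

text \<open>The evolution of a pair of a displacement and a rotation: a free flight of length \<open>\<tau> n\<close>, and then a reflection that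
  adds the curvature \<open>k n\<close>.\<close>

primrec wavefront :: "(nat \<Rightarrow> real) \<Rightarrow> (nat \<Rightarrow> real) \<Rightarrow> nat \<Rightarrow> real \<times> real" where
  "wavefront \<tau> k 0 = (1, 1)"
| "wavefront \<tau> k (Suc n) = (let p = wavefront \<tau> k n; a = fst p + \<tau> n * snd p in (a, snd p + k n * a))"

lemma wavefront_ge_1:
  assumes "\<And>n. 0 \<le> \<tau> n" "\<And>n. 0 \<le> k n"
  shows "1 \<le> fst (wavefront \<tau> k n) \<and> 1 \<le> snd (wavefront \<tau> k n)"
proof (induction n)
  case (Suc n)
  have "0 \<le> \<tau> n * snd (wavefront \<tau> k n)" using assms Suc by simp
  then have "1 \<le> fst (wavefront \<tau> k n) + \<tau> n * snd (wavefront \<tau> k n)" using Suc by linarith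
  moreover from this have "0 \<le> k n * (fst (wavefront \<tau> k n) + \<tau> n * snd (wavefront \<tau> k n))" using assms by simp
  ultimately show ?case using Suc by (simp add: Let_def)
qed simp

lemma wavefront_step_mono:
  fixes \<alpha> \<beta> \<xi> \<eta> \<rho> \<tau> k K :: real
  assumes "0 \<le> \<tau>" "0 \<le> k" "k \<le> K" "0 \<le> \<alpha>" "0 \<le> \<beta>" "0 \<le> \<rho>" "\<rho> * \<alpha> \<le> \<xi>" "\<rho> * \<beta> \<le> \<eta>"
  shows "\<rho> * (\<alpha> + \<tau> * \<beta>) \<le> \<xi> + \<tau> * \<eta>" "\<rho> * (\<beta> + K * (\<alpha> + \<tau> * \<beta>)) \<le> \<eta> + K * (\<xi> + \<tau> * \<eta>)"
    "\<rho> * (\<beta> + k * (\<alpha> + \<tau> * \<beta>)) \<le> \<eta> + K * (\<xi> + \<tau> * \<eta>)"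
proof -
  have "\<tau> * (\<rho> * \<beta>) \<le> \<tau> * \<eta>" using assms by (intro mult_left_mono)
  then show a: "\<rho> * (\<alpha> + \<tau> * \<beta>) \<le> \<xi> + \<tau> * \<eta>" using assms by (simp add: algebra_simps)
  have "K * (\<rho> * (\<alpha> + \<tau> * \<beta>)) \<le> K * (\<xi> + \<tau> * \<eta>)" using assms a by (intro mult_left_mono) auto
  then show b: "\<rho> * (\<beta> + K * (\<alpha> + \<tau> * \<beta>)) \<le> \<eta> + K * (\<xi> + \<tau> * \<eta>)" using assms by (simp add: algebra_simps)
  have "\<rho> * (k * (\<alpha> + \<tau> * \<beta>)) \<le> \<rho> * (K * (\<alpha> + \<tau> * \<beta>))" using assms by (intro mult_left_mono mult_right_mono) auto
  then show "\<rho> * (\<beta> + k * (\<alpha> + \<tau> * \<beta>)) \<le> \<eta> + K * (\<xi> + \<tau> * \<eta>)" using b by (simp add: algebra_simps)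
qed

text \<open>A surplus of curvature at a reflection first increases the rotation component; one flight
  later the gain has spread to both components.\<close>

lemma wavefront_gain:
  fixes \<alpha> \<beta> \<xi> \<eta> \<rho> \<tau> \<tau>' k k' K K' t0 k0 k1 \<Delta> :: real
  assumes t: "0 < t0" "t0 \<le> \<tau>" "t0 \<le> \<tau>'" and k: "0 < k0" "k0 \<le> k" "k \<le> k1" "k0 \<le> k'" "k' \<le> K'"
    and D: "0 < \<Delta>" "k + \<Delta> \<le> K" and pos: "0 \<le> \<alpha>" "0 \<le> \<beta>" "0 \<le> \<rho>" "\<rho> * \<alpha> \<le> \<xi>" "\<rho> * \<beta> \<le> \<eta>"
  defines "e1 \<equiv> \<Delta> / (1 / t0 + k1)"
  defines "e2 \<equiv> e1 * (t0 * k0) / (1 + t0 * k0)"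
  defines "\<alpha>1 \<equiv> \<alpha> + \<tau> * \<beta>" and "\<xi>1 \<equiv> \<xi> + \<tau> * \<eta>"
  defines "\<beta>1 \<equiv> \<beta> + k * \<alpha>1" and "\<eta>1 \<equiv> \<eta> + K * \<xi>1"
  shows "(\<rho> * (1 + e2)) * (\<alpha>1 + \<tau>' * \<beta>1) \<le> \<xi>1 + \<tau>' * \<eta>1"
    "(\<rho> * (1 + e2)) * (\<beta>1 + k' * (\<alpha>1 + \<tau>' * \<beta>1)) \<le> \<eta>1 + K' * (\<xi>1 + \<tau>' * \<eta>1)"
proof -
  have M: "1 / t0 + k1 > 0" using t k by (simp add: add_pos_pos)
  have e1: "e1 > 0" using D M by (simp add: e1_def)
  have tk: "t0 * k0 > 0" using t k by simp
  have e2: "0 \<le> e2" "e2 \<le> e1" using e1 tk by (auto simp: e2_def field_simps)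
  have a1: "0 \<le> \<alpha>1" using pos t by (simp add: \<alpha>1_def)
  have b1: "0 \<le> \<beta>1" using pos k a1 by (simp add: \<beta>1_def)
  have x1: "\<rho> * \<alpha>1 \<le> \<xi>1" using wavefront_step_mono(1)[of \<tau> k K \<alpha> \<beta> \<rho> \<xi> \<eta>] pos t k D by (simp add: \<alpha>1_def \<xi>1_def)
  have "\<beta> \<le> \<alpha>1 / t0"
  proof -
    have "t0 * \<beta> \<le> \<tau> * \<beta>" using t pos by (intro mult_right_mono) auto
    then show ?thesis using t pos by (simp add: \<alpha>1_def field_simps)
  qed
  moreover have "k * \<alpha>1 \<le> k1 * \<alpha>1" using k a1 by (intro mult_right_mono) auto
  ultimately have "\<beta>1 \<le> (1 / t0 + k1) * \<alpha>1" by (simp add: \<beta>1_def algebra_simps)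
  then have "\<beta>1 / (1 / t0 + k1) \<le> \<alpha>1" using M by (simp add: field_simps)
  then have "\<Delta> * (\<beta>1 / (1 / t0 + k1)) \<le> \<Delta> * \<alpha>1" using D by (intro mult_left_mono) auto
  then have g1: "e1 * \<beta>1 \<le> \<Delta> * \<alpha>1" by (simp add: e1_def)
  have h1: "\<rho> * (1 + e1) * \<beta>1 \<le> \<eta>1"
  proof -
    have "\<beta> + K * \<alpha>1 \<ge> \<beta>1 + \<Delta> * \<alpha>1"
      using mult_right_mono[OF D(2) a1] by (simp add: \<beta>1_def algebra_simps)
    then have "\<beta>1 + e1 * \<beta>1 \<le> \<beta> + K * \<alpha>1" using g1 by linarith
    then have "\<rho> * (\<beta>1 + e1 * \<beta>1) \<le> \<rho> * (\<beta> + K * \<alpha>1)" using pos by (intro mult_left_mono) auto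
    also have "\<dots> \<le> \<eta>1"
      using wavefront_step_mono(2)[of \<tau> k K \<alpha> \<beta> \<rho> \<xi> \<eta>] pos t k D by (simp add: \<alpha>1_def \<xi>1_def \<eta>1_def)
    finally show ?thesis by (simp add: algebra_simps)
  qed
  have g2: "e2 * (\<alpha>1 + \<tau>' * \<beta>1) \<le> e1 * \<tau>' * \<beta>1"
  proof -
    have "k0 * \<alpha>1 \<le> k * \<alpha>1" using k a1 by (intro mult_right_mono) auto
    then have "k0 * \<alpha>1 \<le> \<beta>1" using pos by (simp add: \<beta>1_def)
    then have "k0 * (\<alpha>1 + \<tau>' * \<beta>1) \<le> (1 + k0 * \<tau>') * \<beta>1" by (simp add: algebra_simps)
    then have "t0 * (k0 * (\<alpha>1 + \<tau>' * \<beta>1)) \<le> t0 * ((1 + k0 * \<tau>') * \<beta>1)" using t by (intro mult_left_mono) auto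
    also have "\<dots> \<le> (\<tau>' * (1 + t0 * k0)) * \<beta>1"
    proof -
      have "t0 * (1 + k0 * \<tau>') \<le> \<tau>' * (1 + t0 * k0)" using t by (simp add: algebra_simps)
      then show ?thesis using b1 by (metis mult.assoc mult_right_mono)
    qed
    finally have "e1 * (t0 * (k0 * (\<alpha>1 + \<tau>' * \<beta>1))) \<le> e1 * ((\<tau>' * (1 + t0 * k0)) * \<beta>1)"
      using e1 by (intro mult_left_mono) auto
    then have "e1 * (t0 * k0) * (\<alpha>1 + \<tau>' * \<beta>1) \<le> (e1 * \<tau>' * \<beta>1) * (1 + t0 * k0)"
      by (simp only: mult.assoc mult.left_commute mult.commute)
    then have "e1 * (t0 * k0) * (\<alpha>1 + \<tau>' * \<beta>1) / (1 + t0 * k0) \<le> e1 * \<tau>' * \<beta>1"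
      using tk by (subst pos_divide_le_eq) auto
    then show ?thesis by (simp add: e2_def)
  qed
  show s1: "(\<rho> * (1 + e2)) * (\<alpha>1 + \<tau>' * \<beta>1) \<le> \<xi>1 + \<tau>' * \<eta>1"
  proof -
    have "\<rho> * (e2 * (\<alpha>1 + \<tau>' * \<beta>1)) \<le> \<rho> * (e1 * \<tau>' * \<beta>1)" using g2 pos by (intro mult_left_mono) auto
    moreover have "\<tau>' * (\<rho> * (1 + e1) * \<beta>1) \<le> \<tau>' * \<eta>1" using h1 t by (intro mult_left_mono) auto
    ultimately show ?thesis using x1 by (simp add: algebra_simps)
  qed
  have "0 \<le> \<alpha>1 + \<tau>' * \<beta>1" using a1 b1 t by simp
  then have "k' * (\<rho> * (1 + e2) * (\<alpha>1 + \<tau>' * \<beta>1)) \<le> K' * (\<rho> * (1 + e2) * (\<alpha>1 + \<tau>' * \<beta>1))"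
    using k pos e2 by (intro mult_right_mono) auto
  also have "\<dots> \<le> K' * (\<xi>1 + \<tau>' * \<eta>1)" using s1 k by (intro mult_left_mono) auto
  finally have "k' * (\<rho> * (1 + e2) * (\<alpha>1 + \<tau>' * \<beta>1)) \<le> K' * (\<xi>1 + \<tau>' * \<eta>1)" .
  moreover have "\<rho> * (1 + e2) * \<beta>1 \<le> \<rho> * (1 + e1) * \<beta>1"
    using e2 pos b1 by (intro mult_right_mono mult_left_mono) auto
  ultimately show "(\<rho> * (1 + e2)) * (\<beta>1 + k' * (\<alpha>1 + \<tau>' * \<beta>1)) \<le> \<eta>1 + K' * (\<xi>1 + \<tau>' * \<eta>1)"
    using h1 by (simp add: algebra_simps)
qed

text \<open>Steps are taken in pairs, so that a surplus of curvature at an even step enlarges both components before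
  the next one is considered.\<close>

lemma wavefront_comparison:
  fixes \<tau> k K :: "nat \<Rightarrow> real" and t0 k0 k1 \<Delta> :: real
  assumes t: "0 < t0" "\<And>n. t0 \<le> \<tau> n" and k: "0 < k0" "\<And>n. k0 \<le> k n" "\<And>n. k n \<le> k1" "\<And>n. k n \<le> K n"
    and D: "0 < \<Delta>" "\<And>n. G n \<Longrightarrow> k (2 * n) + \<Delta> \<le> K (2 * n)"
  defines "\<epsilon> \<equiv> \<Delta> / (1 / t0 + k1) * (t0 * k0) / (1 + t0 * k0)"
  defines "S n \<equiv> card {j. j < n \<and> G j}"
  shows "(1 + \<epsilon>) ^ S n * fst (wavefront \<tau> k (2 * n)) \<le> fst (wavefront \<tau> K (2 * n)) \<and>
    (1 + \<epsilon>) ^ S n * snd (wavefront \<tau> k (2 * n)) \<le> snd (wavefront \<tau> K (2 * n))"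
proof (induction n)
  case 0
  then show ?case by (simp add: S_def)
next
  case (Suc n)
  have tp: "0 \<le> \<tau> m" and kp: "0 \<le> k m" for m using t(2)[of m] t(1) k(2)[of m] k(1) by linarith+
  have k1: "0 \<le> k1" using kp[of 0] k(3)[of 0] by linarith
  have e: "0 \<le> \<epsilon>" unfolding \<epsilon>_def using t k D k1 by (intro divide_nonneg_nonneg mult_nonneg_nonneg add_nonneg_nonneg) auto
  let ?p = "wavefront \<tau> k (2 * n)" let ?P = "wavefront \<tau> K (2 * n)"
  have w: "0 \<le> fst ?p" "0 \<le> snd ?p" using wavefront_ge_1[of \<tau> k "2 * n", OF tp kp] by linarith+
  have r: "0 \<le> (1 + \<epsilon>) ^ S n" using e by simp
  have two: "2 * Suc n = Suc (Suc (2 * n))" by simp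
  show ?case
  proof (cases "G n")
    case True
    have "{j. j < Suc n \<and> G j} = insert n {j. j < n \<and> G j}" using True by (auto simp: less_Suc_eq)
    then have "S (Suc n) = Suc (S n)" by (simp add: S_def)
    then have "(1 + \<epsilon>) ^ S (Suc n) = (1 + \<epsilon>) ^ S n * (1 + \<epsilon>)" by simp
    then show ?thesis unfolding two wavefront.simps Let_def fst_conv snd_conv
      using wavefront_gain[where \<tau> = "\<tau> (2 * n)" and \<tau>' = "\<tau> (Suc (2 * n))" and k = "k (2 * n)"
          and k' = "k (Suc (2 * n))" and K = "K (2 * n)" and K' = "K (Suc (2 * n))" and \<xi> = "fst ?P" and \<eta> = "snd ?P",
          OF t(1) t(2) t(2) k(1,2,3) k(2) k(4) D(1) D(2)[OF True] w r] Suc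
      unfolding \<epsilon>_def[symmetric] by simp
  next
    case False
    have "{j. j < Suc n \<and> G j} = {j. j < n \<and> G j}" using False by (auto simp: less_Suc_eq)
    then have s: "S (Suc n) = S n" by (simp add: S_def)
    let ?q = "wavefront \<tau> k (Suc (2 * n))" let ?Q = "wavefront \<tau> K (Suc (2 * n))"
    have 1: "(1 + \<epsilon>) ^ S n * fst ?q \<le> fst ?Q" "(1 + \<epsilon>) ^ S n * snd ?q \<le> snd ?Q"
      using wavefront_step_mono(1,3)[OF tp kp k(4) w r, of "fst ?P" "snd ?P"] Suc by (simp_all add: Let_def)
    have q: "0 \<le> fst ?q" "0 \<le> snd ?q" using wavefront_ge_1[of \<tau> k "Suc (2 * n)", OF tp kp] by linarith+
    show ?thesis unfolding two s
      using wavefront_step_mono(1,3)[OF tp kp k(4) q r 1] by (simp add: Let_def)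
  qed
qed

section \<open>Growth rates\<close>

lemma norm_ratio_limit:
  fixes a b :: "nat \<Rightarrow> real"
  assumes a: "(\<lambda>n. a n / real n) \<longlonglongrightarrow> l" and d: "\<forall>\<^sub>F n in sequentially. \<bar>b n - a n\<bar> \<le> C"
  shows "(\<lambda>n. b n / real n) \<longlonglongrightarrow> l"
proof -
  have "(\<lambda>n. (b n - a n) / real n) \<longlonglongrightarrow> 0"
  proof (rule Lim_null_comparison)
    show "\<forall>\<^sub>F n in sequentially. norm ((b n - a n) / real n) \<le> C / real n"
      using d by eventually_elim (simp add: divide_right_mono abs_divide)
    show "(\<lambda>n. C / real n) \<longlonglongrightarrow> 0" by (rule lim_const_over_n)
  qed
  from tendsto_add[OF a this] show ?thesis by (simp add: add_divide_distrib[symmetric])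
qed

text \<open>Since \<open>a n\<close> is eventually larger than 2, the perturbation changes its logarithm by at most \<open>ln 2\<close>.\<close>

lemma growth_rate_perturbed:
  fixes a b w :: "nat \<Rightarrow> real"
  assumes l: "0 < l" and a: "(\<lambda>n. ln (a n) / real n) \<longlonglongrightarrow> l" and a0: "\<And>n. 0 \<le> a n"
    and b: "\<forall>\<^sub>F n in sequentially. b n < 1" and w: "\<And>n. \<bar>w n - a n\<bar> \<le> b n"
  shows "(\<lambda>n. ln (w n) / real n) \<longlonglongrightarrow> l"
proof (rule norm_ratio_limit[OF a])
  have "\<forall>\<^sub>F n in sequentially. l / 2 < ln (a n) / real n" using order_tendstoD(1)[OF a, of "l / 2"] l by simp
  moreover have "\<forall>\<^sub>F n in sequentially. 2 * ln 2 / l < real n"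
    using filterlim_real_sequentially by (simp add: filterlim_at_top_dense)
  ultimately show "\<forall>\<^sub>F n in sequentially. \<bar>ln (w n) - ln (a n)\<bar> \<le> ln 2" using b
  proof eventually_elim
    case (elim n)
    have "0 < 2 * ln 2 / l" using l by simp
    then have n: "0 < real n" using elim by linarith
    then have "ln (a n) > l / 2 * real n" using elim(1) by (simp add: field_simps)
    moreover have "l / 2 * real n > ln 2" using elim(2) l by (simp add: field_simps)
    ultimately have la: "ln (a n) > ln 2" by linarith
    have "a n > 0"
    proof (rule ccontr)
      assume "\<not> a n > 0"
      then have "a n = 0" using a0[of n] by simp
      then show False using la by simp
    qed
    then have an: "a n > 2" using la by simp
    have wn: "a n / 2 \<le> w n" "w n \<le> 2 * a n" using w[of n] elim(3) an by linarith+
    have "ln (w n) \<le> ln (2 * a n)" using wn an by (subst ln_le_cancel_iff) auto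
    moreover have "ln (a n / 2) \<le> ln (w n)" using wn an by (subst ln_le_cancel_iff) auto
    ultimately show ?case using an by (simp add: ln_mult ln_div)
  qed
qed

text \<open>Only even places count, because the comparison of wave fronts proceeds in pairs of steps.\<close>

definition turns :: "(int \<Rightarrow> nat) \<Rightarrow> nat \<Rightarrow> nat" where
  "turns z n = card {j. j < n \<and> z (2 * int j) \<noteq> z (2 * int j + 2)}"

lemma count_list_double_exponent:
  fixes l k :: real
  assumes "k \<noteq> l" "k \<noteq> - l"
  shows "count_list [l, l, - l, - l] k = 0"
  using assms by simp

context planar_billiard
begin

lemma linear_dB: "x \<in> M0 \<Longrightarrow> linear (dB x)"
  using dB_formula[OF _ perp_tangent[of x "(0, 0)", unfolded perp_vector_def]] by blast

lemma billiard_map_iterate: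
  assumes x: "x \<in> M0"
  shows "(billiard_map ^^ n) x \<in> M0" "(billiard_map ^^ Suc n) x = nxt ((billiard_map ^^ n) x)"
    "billiard_map_pow (int n) x = (billiard_map ^^ n) x"
proof -
  show p: "billiard_map_pow (int n) x = (billiard_map ^^ n) x" for n by (simp add: billiard_map_pow_def)
  show m: "(billiard_map ^^ n) x \<in> M0" for n using billiard_map_pow_M0(1)[OF x, of "int n"] p by simp
  show "(billiard_map ^^ Suc n) x = nxt ((billiard_map ^^ n) x)" using M0_billiard_map[OF m] by simp
qed

lemma linear_dB_iter:
  assumes x: "x \<in> M0"
  shows "linear (dB_iter n x)"
proof (induction n)
  case 0
  show ?case unfolding dB_iter.simps by (rule linear_id)
next
  case (Suc n)
  show ?case unfolding dB_iter.simps by (rule linear_compose[OF Suc linear_dB[OF billiard_map_iterate(1)[OF x]]])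
qed

definition flight_time :: "phase \<Rightarrow> nat \<Rightarrow> real" where
  "flight_time x n = ret ((billiard_map ^^ n) x)"

definition radius_at :: "phase \<Rightarrow> nat \<Rightarrow> real" where
  "radius_at x n = rad (ball_index (fst ((billiard_map ^^ Suc n) x)))"

definition cosine_at :: "phase \<Rightarrow> nat \<Rightarrow> real" where
  "cosine_at x n = snd ((billiard_map ^^ Suc n) x) \<bullet> normal (fst ((billiard_map ^^ Suc n) x))"

definition perp_curvature :: "phase \<Rightarrow> nat \<Rightarrow> real" where
  "perp_curvature x n = 2 * cosine_at x n / radius_at x n"

definition inplane_curvature :: "phase \<Rightarrow> nat \<Rightarrow> real" where
  "inplane_curvature x n = 2 / (cosine_at x n * radius_at x n)"

lemma dB_iter_perp:
  assumes x: "x \<in> M0"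
  shows "dB_iter n x (perp_vector (1, 1)) = perp_vector (wavefront (flight_time x) (perp_curvature x) n)"
proof (induction n)
  case (Suc n)
  let ?y = "(billiard_map ^^ n) x" let ?p = "wavefront (flight_time x) (perp_curvature x) n"
  have nx: "nxt ?y = (billiard_map ^^ Suc n) x" using billiard_map_iterate(2)[OF x, of n] by simp
  have k: "2 * (snd (nxt ?y) \<bullet> normal (fst (nxt ?y))) / rad (ball_index (fst (nxt ?y))) = perp_curvature x n"
    unfolding nx perp_curvature_def cosine_at_def radius_at_def ..
  have t: "ret ?y = flight_time x n" by (simp add: flight_time_def)
  show ?case
    using Suc dB_perp[OF billiard_map_iterate(1)[OF x, of n], of "fst ?p" "snd ?p", unfolded k t]
    by (simp add: Let_def)
qed simp

lemma dB_iter_inplane: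
  assumes x: "x \<in> M0"
  shows "dB_iter n x (inplane_vector x (1, 1)) =
    ((- 1) ^ n) *\<^sub>R inplane_vector ((billiard_map ^^ n) x) (wavefront (flight_time x) (inplane_curvature x) n)"
proof (induction n)
  case (Suc n)
  let ?y = "(billiard_map ^^ n) x" let ?p = "wavefront (flight_time x) (inplane_curvature x) n"
  have nx: "nxt ?y = (billiard_map ^^ Suc n) x" using billiard_map_iterate(2)[OF x, of n] by simp
  have k: "2 / (snd (nxt ?y) \<bullet> normal (fst (nxt ?y)) * rad (ball_index (fst (nxt ?y)))) = inplane_curvature x n"
    unfolding nx inplane_curvature_def cosine_at_def radius_at_def ..
  have t: "ret ?y = flight_time x n" by (simp add: flight_time_def)
  have "dB ?y (inplane_vector ?y ?p) = - inplane_vector ((billiard_map ^^ Suc n) x) (wavefront (flight_time x) (inplane_curvature x) (Suc n))"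
    using dB_inplane[OF billiard_map_iterate(1)[OF x, of n], of "fst ?p" "snd ?p", unfolded k t, unfolded nx]
    by (simp add: Let_def)
  then show ?case using Suc by (simp add: linear_scale[OF linear_dB[OF billiard_map_iterate(1)[OF x]]])
qed simp

lemma norm_perp_vector: "norm (perp_vector p) = sqrt ((fst p)\<^sup>2 + (snd p)\<^sup>2)"
  using unit by (simp add: perp_vector_def norm_Pair)

lemma norm_inplane_vector_ge:
  assumes x: "x \<in> M0"
  shows "sqrt ((fst p)\<^sup>2 + (snd p)\<^sup>2) \<le> norm (inplane_vector x p)"
proof -
  let ?n = "normal (fst x)"
  have x1: "x \<in> M1" using M0_M1 x by blast
  have v: "norm (snd x) = 1" and n: "norm ?n = 1" using M1_D[OF x1] norm_normal by auto
  have c: "0 < snd x \<bullet> ?n" using M1_D[OF x1] by simp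
  have c1: "snd x \<bullet> ?n \<le> 1" using norm_cauchy_schwarz[of "snd x" ?n] v n by simp
  have "\<bar>fst p\<bar> \<le> \<bar>fst p\<bar> / (snd x \<bullet> ?n)" using c c1 by (simp add: field_simps mult_left_le)
  then have "(fst p)\<^sup>2 \<le> (\<bar>fst p\<bar> / (snd x \<bullet> ?n))\<^sup>2" using power_mono[of "\<bar>fst p\<bar>" _ 2] by simp
  moreover have "norm (cross3 e ?n) = 1" "norm (cross3 e (snd x)) = 1"
    using cross3_plane(4)[OF unit trapped_planar(2)[OF x] trapped_planar(2)[OF x]]
      cross3_plane(4)[OF unit trapped_planar(1)[OF x] trapped_planar(1)[OF x]] v n by simp_all
  ultimately show ?thesis using c by (simp add: inplane_vector_def norm_Pair)
qed

lemma radius_bounds: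
  obtains R0 R1 where "0 < R0" "\<And>i. i \<in> {1..k0} \<Longrightarrow> R0 \<le> rad i \<and> rad i \<le> R1" "0 < R1"
proof (cases "k0 = 0")
  case True
  then show thesis using that[of 1 1] by simp
next
  case False
  let ?S = "rad ` {1..k0}"
  have S: "finite ?S" "?S \<noteq> {}" using False by auto
  have "Min ?S \<in> ?S" "Max ?S \<in> ?S" using Min_in[OF S] Max_in[OF S] .
  then have "0 < Min ?S" "0 < Max ?S" using rad_pos by fastforce+
  then show thesis using that[of "Min ?S" "Max ?S"] S by simp
qed

text \<open>The in-plane curvature is never smaller than the perpendicular one. At a turn, where the ball after next differs
  from the present one, the reflection in between is oblique, and the difference \<open>2 (1 - c\<^sup>2) / (c r)\<close> is bounded below.\<close>

lemma inplane_beats_perp: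
  assumes c2: "0 < c2" "c2 < 1"
    and oblique: "\<forall>q1 q2 q3. successive_reflection_points q1 q2 q3 \<and> ball_index q1 \<noteq> ball_index q3 \<longrightarrow> cos_reflection q2 q3 \<le> c2"
  obtains \<epsilon> where "0 < \<epsilon>"
    "\<And>x n. x \<in> M0 \<Longrightarrow> (1 + \<epsilon>) ^ turns (coding x) n
        * norm (dB_iter (2 * n) x (perp_vector (1, 1))) \<le> norm (dB_iter (2 * n) x (inplane_vector x (1, 1)))"
    "\<And>x n. x \<in> M0 \<Longrightarrow> 1 \<le> norm (dB_iter n x (perp_vector (1, 1)))"
    "\<And>x n. x \<in> M0 \<Longrightarrow> 1 \<le> norm (dB_iter n x (inplane_vector x (1, 1)))"
proof -
  obtain R0 R1 where R: "0 < R0" "\<And>i. i \<in> {1..k0} \<Longrightarrow> R0 \<le> rad i \<and> rad i \<le> R1" "0 < R1" using radius_bounds by blast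
  obtain c1 where c1: "0 < c1" "\<And>z q j. orbit_chain z q \<Longrightarrow> c1 \<le> dir q j \<bullet> normal (q j)" using cos_bounded_below by blast
  define \<Delta> where "\<Delta> = 2 / R1 * (1 - c2\<^sup>2)"
  define \<epsilon> where "\<epsilon> = \<Delta> / (1 / gap + 2 / R0) * (gap * (2 * c1 / R1)) / (1 + gap * (2 * c1 / R1))"
  have "c2\<^sup>2 < 1" using c2 by (simp add: power_less_one_iff)
  then have D: "0 < \<Delta>" using R by (simp add: \<Delta>_def)
  have e: "0 < \<epsilon>" unfolding \<epsilon>_def using D gap_pos R c1
    by (intro divide_pos_pos mult_pos_pos add_pos_pos) auto
  have facts: "gap \<le> flight_time x n \<and> 2 * c1 / R1 \<le> perp_curvature x n \<and> perp_curvature x n \<le> 2 / R0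
      \<and> perp_curvature x n \<le> inplane_curvature x n
      \<and> (coding x (int n) \<noteq> coding x (int n + 2) \<longrightarrow> perp_curvature x n + \<Delta> \<le> inplane_curvature x n)"
    if x: "x \<in> M0" for x n
  proof -
    let ?q = "\<lambda>j. fst (billiard_map_pow j x)"
    let ?c = "cosine_at x n" let ?r = "radius_at x n"
    note ch = M0_orbit_chain[OF x]
    have n1: "billiard_map_pow (int n + 1) x = (billiard_map ^^ Suc n) x"
      using billiard_map_iterate(3)[OF x, of "Suc n"] by (simp add: add.commute)
    have ceq: "?c = dir ?q (int n + 1) \<bullet> normal (?q (int n + 1))"
      unfolding cosine_at_def ch(2) n1 ..
    have c: "c1 \<le> ?c" unfolding ceq by (rule c1(2)[OF ch(1)])
    have c0: "0 < ?c" using c c1(1) by linarith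
    have cle: "?c \<le> 1"
      using norm_cauchy_schwarz[of "dir ?q (int n + 1)" "normal (?q (int n + 1))"]
        orbit_chainD(10)[OF ch(1), of "int n + 1"] norm_normal[OF orbit_chainD(4)[OF ch(1), of "int n + 1"]] unfolding ceq by simp
    have "ball_index (fst ((billiard_map ^^ Suc n) x)) \<in> {1..k0}"
      using frontierE[OF M1_D(1)[OF M0_M1[OF billiard_map_iterate(1)[OF x, of "Suc n"]]]] by blast
    then have r: "R0 \<le> ?r" "?r \<le> R1" using R(2) by (simp_all add: radius_at_def)
    have r0: "0 < ?r" using r R by linarith
    have X: "(billiard_map ^^ n) x \<in> M1" "hits ((billiard_map ^^ n) x)"
      using M0_M1 M0_hits billiard_map_iterate(1)[OF x] by blast+
    have t: "gap \<le> flight_time x n" unfolding flight_time_def by (rule first_entry(1)[OF X])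
    have k0: "2 * c1 / R1 \<le> perp_curvature x n"
      unfolding perp_curvature_def using c c0 r r0 c1 R by (intro frac_le) auto
    have k1: "perp_curvature x n \<le> 2 / R0"
      unfolding perp_curvature_def using cle r r0 R c0 by (intro frac_le) auto
    have diff: "inplane_curvature x n - perp_curvature x n = 2 / ?r * ((1 - ?c\<^sup>2) / ?c)"
      unfolding inplane_curvature_def perp_curvature_def using c0 r0 by (simp add: field_simps power2_eq_square)
    have cc: "?c\<^sup>2 \<le> 1" using c0 cle by (simp add: power_le_one)
    have k2: "perp_curvature x n \<le> inplane_curvature x n"
    proof -
      have "0 \<le> 2 / ?r * ((1 - ?c\<^sup>2) / ?c)" using r0 c0 cc by (intro mult_nonneg_nonneg divide_nonneg_pos) auto
      then show ?thesis using diff by linarith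
    qed
    have "perp_curvature x n + \<Delta> \<le> inplane_curvature x n" if z: "coding x (int n) \<noteq> coding x (int n + 2)"
    proof -
      have "cos_reflection (?q (int n + 1)) (?q (int n + 2)) \<le> c2"
      proof -
        have "ball_index (?q (int n)) \<noteq> ball_index (?q (int n + 2))"
          using z unfolding orbit_chainD(5)[OF ch(1)] .
        then show ?thesis using oblique chain_successive_reflection[OF ch(1), of "int n"] by blast
      qed
      then have "?c \<le> c2" unfolding ceq chain_cos_reflection[OF ch(1)] .
      then have "?c\<^sup>2 \<le> c2\<^sup>2" using c0 by (intro power_mono) auto
      then have "1 - c2\<^sup>2 \<le> (1 - ?c\<^sup>2) / 1" by simp
      also have "\<dots> \<le> (1 - ?c\<^sup>2) / ?c" using cc c0 cle by (intro frac_le) auto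
      finally have a: "1 - c2\<^sup>2 \<le> (1 - ?c\<^sup>2) / ?c" .
      have b: "2 / R1 \<le> 2 / ?r" using r r0 by (intro frac_le) auto
      have "\<Delta> \<le> 2 / ?r * ((1 - ?c\<^sup>2) / ?c)"
        unfolding \<Delta>_def using a b r0 \<open>c2\<^sup>2 < 1\<close> by (intro mult_mono) auto
      then show ?thesis using diff by linarith
    qed
    then show ?thesis using t k0 k1 k2 by blast
  qed
  have kpos: "0 < 2 * c1 / R1" using c1 R by simp
  show thesis
  proof (rule that[OF e])
    fix x n assume x: "x \<in> M0"
    let ?\<tau> = "flight_time x" let ?k = "perp_curvature x" let ?K = "inplane_curvature x"
    note F = facts[OF x]
    have pos: "0 \<le> ?\<tau> m" "0 \<le> ?k m" "0 \<le> ?K m" for m using F[of m] gap_pos kpos by linarith+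
    have one: "1 \<le> sqrt ((fst (wavefront ?\<tau> k m))\<^sup>2 + (snd (wavefront ?\<tau> k m))\<^sup>2)" if "\<And>i. 0 \<le> k i" for k m
    proof -
      have "1 \<le> (fst (wavefront ?\<tau> k m))\<^sup>2"
        using wavefront_ge_1[of ?\<tau> k m, OF pos(1) that] by (simp add: one_le_power)
      then have "1 \<le> (fst (wavefront ?\<tau> k m))\<^sup>2 + (snd (wavefront ?\<tau> k m))\<^sup>2"
        using zero_le_power2[of "snd (wavefront ?\<tau> k m)"] by linarith
      then show ?thesis by simp
    qed
    show "1 \<le> norm (dB_iter n x (perp_vector (1, 1)))"
      unfolding dB_iter_perp[OF x] norm_perp_vector by (rule one[OF pos(2)])
    have ni: "sqrt ((fst (wavefront ?\<tau> ?K m))\<^sup>2 + (snd (wavefront ?\<tau> ?K m))\<^sup>2) \<le> norm (dB_iter m x (inplane_vector x (1, 1)))" for m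
      using norm_inplane_vector_ge[OF billiard_map_iterate(1)[OF x, of m], of "wavefront ?\<tau> ?K m"]
      unfolding dB_iter_inplane[OF x] by (simp add: power_abs[symmetric])
    show "1 \<le> norm (dB_iter n x (inplane_vector x (1, 1)))" using ni[of n] one[of ?K n, OF pos(3)] by linarith
    let ?G = "\<lambda>j. coding x (2 * int j) \<noteq> coding x (2 * int j + 2)"
    let ?p = "wavefront ?\<tau> ?k (2 * n)" let ?P = "wavefront ?\<tau> ?K (2 * n)"
    let ?\<rho> = "(1 + \<epsilon>) ^ card {j. j < n \<and> ?G j}"
    have "?\<rho> * fst ?p \<le> fst ?P \<and> ?\<rho> * snd ?p \<le> snd ?P"
    proof (rule wavefront_comparison[where ?t0.0 = gap and ?k0.0 = "2 * c1 / R1" and ?k1.0 = "2 / R0" and \<Delta> = \<Delta>, folded \<epsilon>_def])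
      show "?k (2 * j) + \<Delta> \<le> ?K (2 * j)" if "?G j" for j using F[of "2 * j"] that by simp
    qed (use F gap_pos kpos D in auto)
    moreover have "0 \<le> ?\<rho>" "0 \<le> fst ?p" "0 \<le> snd ?p"
      using e wavefront_ge_1[of ?\<tau> ?k "2 * n", OF pos(1,2)] by auto
    ultimately have "(?\<rho> * fst ?p)\<^sup>2 + (?\<rho> * snd ?p)\<^sup>2 \<le> (fst ?P)\<^sup>2 + (snd ?P)\<^sup>2"
      by (intro add_mono power_mono) auto
    then have "sqrt ((?\<rho> * fst ?p)\<^sup>2 + (?\<rho> * snd ?p)\<^sup>2) \<le> norm (dB_iter (2 * n) x (inplane_vector x (1, 1)))"
      using ni[of "2 * n"] by (meson order_trans real_sqrt_le_mono)
    moreover have "sqrt ((?\<rho> * fst ?p)\<^sup>2 + (?\<rho> * snd ?p)\<^sup>2) = ?\<rho> * sqrt ((fst ?p)\<^sup>2 + (snd ?p)\<^sup>2)"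
      using \<open>0 \<le> ?\<rho>\<close> by (simp add: power_mult_distrib real_sqrt_mult flip: distrib_left)
    ultimately show "(1 + \<epsilon>) ^ turns (coding x) n * norm (dB_iter (2 * n) x (perp_vector (1, 1))) \<le> norm (dB_iter (2 * n) x (inplane_vector x (1, 1)))"
      unfolding dB_iter_perp[OF x] norm_perp_vector turns_def by simp
  qed
qed

text \<open>The vector has a component in the expanding space, because it does not contract. Its component in the contracting
  space decays and does not influence the rate.\<close>

lemma growth_rate_of_non_contracting:
  assumes x: "x \<in> M0" and l: "0 < l"
    and span: "span (\<Union>k. E k) = tangent_space x"
    and sub: "\<And>k. subspace (E k)" and dim: "\<And>k. dim (E k) = count_list [l, l, - l, - l] k"
    and lim: "\<And>k w. w \<in> E k - {0} \<Longrightarrow> ((\<lambda>n. ln (norm (dB_pow n x w)) / real_of_int n) \<longlongrightarrow> k) at_top"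
    and w: "w \<in> tangent_space x" and grow: "\<And>n. 1 \<le> norm (dB_iter n x w)"
  shows "(\<lambda>n. ln (norm (dB_iter n x w)) / real n) \<longlonglongrightarrow> l"
proof -
  have lim': "(\<lambda>n. ln (norm (dB_iter n x u)) / real n) \<longlonglongrightarrow> k" if "u \<in> E k" "u \<noteq> 0" for u k
    using filterlim_compose[OF lim filterlim_int_sequentially, of u k] that by (simp add: dB_pow_def)
  have "(\<Union>k. E k) \<subseteq> {u + s |u s. u \<in> E l \<and> s \<in> E (- l)}"
  proof
    fix y assume "y \<in> (\<Union>k. E k)"
    then obtain k where k: "y \<in> E k" by blast
    have z: "0 \<in> E l" "0 \<in> E (- l)" using sub subspace_0 by blast+
    consider "k = l" | "k = - l" | "k \<noteq> l" "k \<noteq> - l" by blast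
    then show "y \<in> {u + s |u s. u \<in> E l \<and> s \<in> E (- l)}"
    proof cases
      case 1
      then have "y = y + 0 \<and> y \<in> E l \<and> 0 \<in> E (- l)" using k z by simp
      then show ?thesis by blast
    next
      case 2
      then have "y = 0 + y \<and> 0 \<in> E l \<and> y \<in> E (- l)" using k z by simp
      then show ?thesis by blast
    next
      case 3
      then have "dim (E k) = 0" using dim[of k] count_list_double_exponent by simp
      then have "y = 0" using k by (auto simp: dim_eq_0)
      then have "y = 0 + 0 \<and> 0 \<in> E l \<and> 0 \<in> E (- l)" using z by simp
      then show ?thesis by blast
    qed
  qed
  then have "tangent_space x \<subseteq> {u + s |u s. u \<in> E l \<and> s \<in> E (- l)}"
    unfolding span[symmetric] by (rule span_minimal) (rule subspace_sums[OF sub sub])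
  then obtain u s where us: "w = u + s" "u \<in> E l" "s \<in> E (- l)" using w by blast
  have lin: "linear (dB_iter n x)" for n by (rule linear_dB_iter[OF x])
  have s1: "\<forall>\<^sub>F n in sequentially. norm (dB_iter n x s) < 1"
  proof (cases "s = 0")
    case True
    then show ?thesis using linear_0[OF lin] by simp
  next
    case False
    have "\<forall>\<^sub>F n in sequentially. ln (norm (dB_iter n x s)) / real n < 0"
      using order_tendstoD(2)[OF lim'[OF us(3) False], of 0] l by simp
    then show ?thesis
    proof eventually_elim
      case (elim n)
      show ?case
      proof (rule ccontr)
        assume "\<not> norm (dB_iter n x s) < 1"
        then have "0 \<le> ln (norm (dB_iter n x s))" by simp
        then have "0 \<le> ln (norm (dB_iter n x s)) / real n" by simp
        then show False using elim by linarith
      qed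
    qed
  qed
  have "u \<noteq> 0"
  proof
    assume "u = 0"
    then have "w = s" using us by simp
    then show False using eventually_happens[OF s1] grow by (metis linorder_not_le sequentially_bot)
  qed
  show ?thesis
  proof (rule growth_rate_perturbed[OF l lim'[OF us(2) \<open>u \<noteq> 0\<close>] _ s1])
    fix n
    have "dB_iter n x w - dB_iter n x u = dB_iter n x s" unfolding us(1) linear_add[OF lin] by simp
    then show "\<bar>norm (dB_iter n x w) - norm (dB_iter n x u)\<bar> \<le> norm (dB_iter n x s)"
      using norm_triangle_ineq3[of "dB_iter n x w" "dB_iter n x u"] by simp
  qed simp
qed

end

section \<open>Frequency of turns\<close>

definition turn_set :: "nat \<Rightarrow> int \<Rightarrow> (int \<Rightarrow> nat) set" where
  "turn_set k0 i = {z \<in> Sigma_A k0. z i \<noteq> z (i + 2)}"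

lemma shift_Sigma_A: "z \<in> Sigma_A k0 \<Longrightarrow> shift z \<in> Sigma_A k0"
  unfolding Sigma_A_def shift_def mem_Collect_eq by (rule allI, erule allE)

lemma shift_apply: "shift z i = z (i + 1)"
  by (simp add: shift_def)

lemma continuous_coordinate: "continuous_on UNIV (\<lambda>z :: int \<Rightarrow> nat. z i)"
  by simp

context
  fixes k0 :: nat and \<mu> :: "(int \<Rightarrow> nat) measure"
  assumes sp: "space \<mu> = Sigma_A k0"
    and se: "sets \<mu> = sets (restrict_space borel (Sigma_A k0))"
begin

lemma closed_measurable:
  assumes "closed C"
  shows "{z \<in> Sigma_A k0. z \<in> C} \<in> sets \<mu>"
proof -
  have "C \<in> sets borel" using assms by (rule borel_closed)
  then have "Sigma_A k0 \<inter> C \<in> sets \<mu>" unfolding se sets_restrict_space by blast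
  moreover have "{z \<in> Sigma_A k0. z \<in> C} = Sigma_A k0 \<inter> C" by blast
  ultimately show ?thesis by (simp only:)
qed

lemma turn_set_measurable: "turn_set k0 i \<in> sets \<mu>"
proof -
  have "closed {z :: int \<Rightarrow> nat. z i = z (i + 2)}"
    by (rule closed_Collect_eq) (rule continuous_coordinate)+
  from sets.compl_sets[OF closed_measurable[OF this]]
  have "space \<mu> - {z \<in> Sigma_A k0. z \<in> {z. z i = z (i + 2)}} \<in> sets \<mu>" .
  moreover have "space \<mu> - {z \<in> Sigma_A k0. z \<in> {z. z i = z (i + 2)}} = turn_set k0 i"
    unfolding sp turn_set_def by blast
  ultimately show ?thesis by (simp only:)
qed

lemma shift_measurable: "shift \<in> measurable \<mu> \<mu>"
proof -
  have "continuous_on UNIV (shift :: (int \<Rightarrow> nat) \<Rightarrow> (int \<Rightarrow> nat))"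
    unfolding shift_def[abs_def] by (intro continuous_on_coordinatewise_then_product) simp
  then have "shift \<in> borel_measurable borel" by (rule borel_measurable_continuous_onI)
  then have "shift \<in> measurable (restrict_space borel (Sigma_A k0)) (restrict_space borel (Sigma_A k0))"
    by (intro measurable_restrict_space3) (auto intro: shift_Sigma_A)
  then show ?thesis by (subst measurable_cong_sets[OF se se])
qed

lemma turn_set_invariant:
  assumes inv: "distr \<mu> \<mu> shift = \<mu>"
  shows "measure \<mu> (turn_set k0 (int n)) = measure \<mu> (turn_set k0 0)"
proof (induction n)
  case (Suc n)
  have "shift -` turn_set k0 (int n) \<inter> space \<mu> = turn_set k0 (int (Suc n))"
  proof (rule set_eqI)
    fix z
    have e: "int (Suc n) = int n + 1" "int n + 1 + 2 = int n + 2 + 1" by simp_all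
    show "z \<in> shift -` turn_set k0 (int n) \<inter> space \<mu> \<longleftrightarrow> z \<in> turn_set k0 (int (Suc n))"
      unfolding e turn_set_def sp using shift_Sigma_A[of z k0] by (simp only: vimage_eq Int_iff mem_Collect_eq shift_apply e) blast
  qed
  then have "measure (distr \<mu> \<mu> shift) (turn_set k0 (int n)) = measure \<mu> (turn_set k0 (int (Suc n)))"
    using measure_distr[OF shift_measurable turn_set_measurable, of "int n"] by (simp only:)
  then show ?case unfolding inv using Suc by (simp only:)
qed simp

end

text \<open>The cylinder \<open>[1, 2, 3]\<close> contains a point of period 3 and therefore has positive measure.\<close>

lemma gibbs_turn_set_pos:
  assumes g: "gibbs_measure k0 \<phi> \<mu>" and k: "3 \<le> k0"
  shows "0 < measure \<mu> (turn_set k0 0)"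
proof -
  have G: "prob_space \<mu>" "space \<mu> = Sigma_A k0" "sets \<mu> = sets (restrict_space borel (Sigma_A k0))"
    using g by (auto simp: gibbs_measure_def)
  interpret prob_space \<mu> by fact
  let ?is = "[1, 2, 3] :: nat list"
  define z where "z j = nat (j mod 3) + 1" for j :: int
  have z: "z \<in> cylinder k0 ?is"
  proof -
    have r: "j mod 3 = 0 \<or> j mod 3 = 1 \<or> j mod 3 = 2" for j :: int by presburger
    have "z j \<in> {1..k0}" for j using r[of j] k by (auto simp: z_def)
    moreover have "z j \<noteq> z (j + 1)" for j
    proof -
      have "(j + 1) mod 3 = (if j mod 3 = 2 then 0 else j mod 3 + 1)" by presburger
      then show ?thesis using r[of j] by (auto simp: z_def)
    qed
    ultimately have "z \<in> Sigma_A k0" by (simp add: Sigma_A_def adj_def)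
    moreover have "z (int j) = ?is ! j" if "j < length ?is" for j
    proof -
      have "j < 3" using that by simp
      then consider "j = 0" | "j = 1" | "j = 2" by linarith
      then show ?thesis by cases (simp_all add: z_def)
    qed
    ultimately show ?thesis by (simp add: cylinder_def)
  qed
  obtain P C where C: "0 < C" "\<forall>is. \<forall>z\<in>cylinder k0 is.
     (let q = measure \<mu> (cylinder k0 is) / exp (birkhoff_sum (length is) \<phi> z - real (length is) * P) in 1 / C \<le> q \<and> q \<le> C)"
    using g unfolding gibbs_measure_def by blast
  let ?E = "exp (birkhoff_sum (length ?is) \<phi> z - real (length ?is) * P)"
  have "1 / C \<le> measure \<mu> (cylinder k0 ?is) / ?E" using bspec[OF spec[OF C(2), of ?is] z] unfolding Let_def by (rule conjunct1)
  moreover have "0 < 1 / C" using C by simp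
  ultimately have "0 < measure \<mu> (cylinder k0 ?is) / ?E" by linarith
  then have "0 < measure \<mu> (cylinder k0 ?is)" by (simp add: zero_less_divide_iff)
  moreover have "cylinder k0 ?is \<subseteq> turn_set k0 0"
  proof
    fix y assume y: "y \<in> cylinder k0 ?is"
    then have c: "y (int j) = ?is ! j" if "j < 3" for j using that by (simp add: cylinder_def)
    have "y \<in> Sigma_A k0" using y by (simp add: cylinder_def)
    then show "y \<in> turn_set k0 0" using c[of 0] c[of 2] by (simp add: turn_set_def)
  qed
  then have "measure \<mu> (cylinder k0 ?is) \<le> measure \<mu> (turn_set k0 0)"
    using turn_set_measurable[OF G(2,3)] by (intro finite_measure_mono)
  ultimately show ?thesis by linarith
qed

text \<open>By invariance the mean frequency of turns has the same positive integral for all lengths. By dominated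
  convergence it does not tend to 0 almost everywhere.\<close>

lemma turns_not_negligible:
  assumes g: "gibbs_measure k0 \<phi> \<mu>" and k: "3 \<le> k0"
  shows "\<not> (AE z in \<mu>. (\<lambda>n. real (turns z n) / real n) \<longlonglongrightarrow> 0)"
proof
  let ?f = "\<lambda>n z. real (turns z n) / real n"
  assume lim: "AE z in \<mu>. (\<lambda>n. ?f n z) \<longlonglongrightarrow> 0"
  have G: "prob_space \<mu>" "space \<mu> = Sigma_A k0" "sets \<mu> = sets (restrict_space borel (Sigma_A k0))" "distr \<mu> \<mu> shift = \<mu>"
    using g by (auto simp: gibbs_measure_def)
  interpret prob_space \<mu> by fact
  let ?T = "\<lambda>j. turn_set k0 (2 * int j)"
  define g' where "g' n z = (\<Sum>j<n. indicator (?T j) z) / real n" for n and z :: "int \<Rightarrow> nat"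
  have T: "?T j \<in> sets \<mu>" for j by (rule turn_set_measurable[OF G(2,3)])
  have fg: "g' n z = ?f n z" if "z \<in> space \<mu>" for n z
  proof -
    let ?J = "{j. z (2 * int j) \<noteq> z (2 * int j + 2)}"
    have "indicator (?T j) z = (indicator ?J j :: real)" for j
      using that by (simp add: turn_set_def G(2) indicator_def)
    then have "(\<Sum>j<n. indicator (?T j) z :: real) = (\<Sum>j<n. indicator ?J j)" by simp
    also have "\<dots> = real (card ({..<n} \<inter> ?J))" by (simp add: indicator_def sum.If_cases)
    also have "{..<n} \<inter> ?J = {j. j < n \<and> z (2 * int j) \<noteq> z (2 * int j + 2)}" by blast
    finally show ?thesis by (simp add: g'_def turns_def)
  qed
  have int: "integral\<^sup>L \<mu> (g' n) = measure \<mu> (turn_set k0 0)" if "n > 0" for n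
  proof -
    have ii: "integrable \<mu> (indicator (?T j) :: _ \<Rightarrow> real)" for j
      by (rule integrable_real_indicator[OF T]) (simp add: emeasure_eq_measure)
    have "integral\<^sup>L \<mu> (g' n) = (\<integral>z. (\<Sum>j<n. indicator (?T j) z) \<partial>\<mu>) / real n"
      unfolding g'_def[abs_def] by (rule integral_divide_zero)
    also have "(\<integral>z. (\<Sum>j<n. indicator (?T j) z) \<partial>\<mu>) = (\<Sum>j<n. integral\<^sup>L \<mu> (indicator (?T j) :: _ \<Rightarrow> real))"
      by (rule Bochner_Integration.integral_sum[OF ii])
    also have "\<dots> = (\<Sum>j<n. measure \<mu> (?T j))"
      using sets.sets_into_space[OF T] by (simp add: Int_absorb2)
    also have "(\<Sum>j<n. measure \<mu> (?T j)) = (\<Sum>j<n. measure \<mu> (turn_set k0 0))"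
    proof (rule sum.cong[OF refl])
      fix j
      show "measure \<mu> (?T j) = measure \<mu> (turn_set k0 0)"
        using turn_set_invariant[OF G(2,3,4), of "2 * j"] by simp
    qed
    finally show ?thesis using that by simp
  qed
  have "(\<lambda>n. integral\<^sup>L \<mu> (g' n)) \<longlonglongrightarrow> integral\<^sup>L \<mu> (\<lambda>z. 0)"
  proof (rule integral_dominated_convergence[where w = "\<lambda>_. 1"])
    show "g' n \<in> borel_measurable \<mu>" for n unfolding g'_def[abs_def]
      by (intro borel_measurable_divide borel_measurable_sum borel_measurable_indicator borel_measurable_const T)
    show "AE z in \<mu>. (\<lambda>n. g' n z) \<longlonglongrightarrow> 0" using lim AE_space by eventually_elim (simp add: fg)
    show "AE z in \<mu>. norm (g' n z) \<le> 1" for n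
    proof (rule AE_I2)
      fix z
      have "(\<Sum>j<n. indicator (?T j) z :: real) \<le> (\<Sum>j<n. 1)" by (intro sum_mono) (simp add: indicator_def)
      moreover have "0 \<le> (\<Sum>j<n. indicator (?T j) z :: real)" by (intro sum_nonneg) simp
      ultimately show "norm (g' n z) \<le> 1" unfolding g'_def by (cases "n = 0") (auto simp: divide_le_eq)
    qed
  qed auto
  then have "(\<lambda>n. integral\<^sup>L \<mu> (g' n)) \<longlonglongrightarrow> 0" by simp
  moreover have "(\<lambda>n. integral\<^sup>L \<mu> (g' n)) \<longlonglongrightarrow> measure \<mu> (turn_set k0 0)"
    by (rule tendsto_eventually) (use int in \<open>auto simp: eventually_sequentially intro!: exI[of _ 1]\<close>)
  ultimately have "measure \<mu> (turn_set k0 0) = 0" by (rule LIMSEQ_unique[symmetric])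
  then show False using gibbs_turn_set_pos[OF g k] by simp
qed

section \<open>The largest exponent is simple\<close>

text \<open>Each unit of \<open>S n\<close> contributes \<open>ln (1 + \<epsilon>)\<close> to the difference of the logarithms of the two growths.\<close>

lemma turns_negligible_of_equal_rates:
  assumes e: "0 < \<epsilon>"
    and r: "\<And>n. (1 + \<epsilon>) ^ S n * a (2 * n) \<le> b (2 * n)" and a1: "\<And>n. 1 \<le> a n"
    and a: "(\<lambda>n. ln (a n) / real n) \<longlonglongrightarrow> l" and b: "(\<lambda>n. ln (b n) / real n) \<longlonglongrightarrow> l"
  shows "(\<lambda>n. real (S n) / real n) \<longlonglongrightarrow> 0"
proof -
  have m: "strict_mono (\<lambda>n::nat. 2 * n)" by (simp add: strict_mono_def)
  have "(\<lambda>n. ln (b (2 * n)) / real (2 * n) - ln (a (2 * n)) / real (2 * n)) \<longlonglongrightarrow> l - l"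
    using LIMSEQ_subseq_LIMSEQ[OF a m] LIMSEQ_subseq_LIMSEQ[OF b m] by (intro tendsto_diff) (simp_all add: o_def)
  then have "(\<lambda>n. 2 / ln (1 + \<epsilon>) * (ln (b (2 * n)) / real (2 * n) - ln (a (2 * n)) / real (2 * n))) \<longlonglongrightarrow> 2 / ln (1 + \<epsilon>) * (l - l)"
    by (rule tendsto_mult_left)
  then have lim: "(\<lambda>n. 2 / ln (1 + \<epsilon>) * (ln (b (2 * n)) / real (2 * n) - ln (a (2 * n)) / real (2 * n))) \<longlonglongrightarrow> 0" by simp
  have le: "0 < ln (1 + \<epsilon>)" using e by simp
  show ?thesis
  proof (rule tendsto_sandwich[OF _ _ tendsto_const lim])
    show "\<forall>\<^sub>F n in sequentially. 0 \<le> real (S n) / real n" by simp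
    show "\<forall>\<^sub>F n in sequentially. real (S n) / real n \<le> 2 / ln (1 + \<epsilon>) * (ln (b (2 * n)) / real (2 * n) - ln (a (2 * n)) / real (2 * n))"
    proof (rule always_eventually, rule allI)
      fix n
      have p: "0 < (1 + \<epsilon>) ^ S n" using e by simp
      have ap: "0 < a (2 * n)" using a1[of "2 * n"] by linarith
      have "ln ((1 + \<epsilon>) ^ S n * a (2 * n)) \<le> ln (b (2 * n))"
        using r[of n] mult_pos_pos[OF p ap] by (subst ln_le_cancel_iff) auto
      moreover have "ln ((1 + \<epsilon>) ^ S n * a (2 * n)) = real (S n) * ln (1 + \<epsilon>) + ln (a (2 * n))"
        using p ap e by (simp add: ln_mult ln_realpow)
      ultimately have "real (S n) * ln (1 + \<epsilon>) \<le> ln (b (2 * n)) - ln (a (2 * n))" by linarith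
      then have "real (S n) \<le> (ln (b (2 * n)) - ln (a (2 * n))) / ln (1 + \<epsilon>)" using le by (simp add: pos_le_divide_eq)
      then have "real (S n) / real n \<le> (ln (b (2 * n)) - ln (a (2 * n))) / ln (1 + \<epsilon>) / real n" by (rule divide_right_mono) simp
      also have "\<dots> = 2 / ln (1 + \<epsilon>) * (ln (b (2 * n)) / real (2 * n) - ln (a (2 * n)) / real (2 * n))"
        using le by (cases "n = 0") (simp_all add: field_simps)
      finally show "real (S n) / real n \<le> 2 / ln (1 + \<epsilon>) * (ln (b (2 * n)) / real (2 * n) - ln (a (2 * n)) / real (2 * n))" .
    qed
  qed
qed

context planar_billiard
begin

lemma inv_coding_measurable:
  assumes se: "sets \<mu> = sets (restrict_space borel (Sigma_A k0))"
  shows "inv_into M0 coding \<in> measurable \<mu> (restrict_space borel M0)"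
proof -
  have "inv_into M0 coding \<in> borel_measurable (restrict_space borel (Sigma_A k0))"
    using continuous_on_inv_coding by (rule borel_measurable_continuous_on_restrict)
  moreover have "inv_into M0 coding z \<in> M0" if "z \<in> Sigma_A k0" for z
    using bij_betw_apply[OF bij_betw_inv_into[OF coding_bij] that] .
  ultimately have "inv_into M0 coding \<in> measurable (restrict_space borel (Sigma_A k0)) (restrict_space borel M0)"
    by (intro measurable_restrict_space2) (auto simp: space_restrict_space)
  then show ?thesis by (subst measurable_cong_sets[OF se refl])
qed

text \<open>Perpendicular and in-plane vectors that start with positive coordinates do not contract. If there were only one
  expanding rate, both would grow at this rate at almost every point, so that turns would be negligible there.\<close>

lemma no_double_exponent:
  assumes k: "3 \<le> k0" and g: "gibbs_measure k0 \<phi> \<mu>"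
    and c2: "0 < c2" "c2 < 1"
    and oblique: "\<forall>q1 q2 q3. successive_reflection_points q1 q2 q3 \<and> ball_index q1 \<noteq> ball_index q3 \<longrightarrow> cos_reflection q2 q3 \<le> c2"
    and l: "0 < l" and L: "lyapunov_exponents (phase_measure \<mu>) [l, l, - l, - l]"
  shows False
proof -
  let ?g = "inv_into M0 coding"
  have G: "space \<mu> = Sigma_A k0" "sets \<mu> = sets (restrict_space borel (Sigma_A k0))"
    using g by (auto simp: gibbs_measure_def)
  obtain \<epsilon> where eps: "0 < \<epsilon>"
    "\<And>x n. x \<in> M0 \<Longrightarrow> (1 + \<epsilon>) ^ turns (coding x) n
        * norm (dB_iter (2 * n) x (perp_vector (1, 1))) \<le> norm (dB_iter (2 * n) x (inplane_vector x (1, 1)))"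
    "\<And>x n. x \<in> M0 \<Longrightarrow> 1 \<le> norm (dB_iter n x (perp_vector (1, 1)))"
    "\<And>x n. x \<in> M0 \<Longrightarrow> 1 \<le> norm (dB_iter n x (inplane_vector x (1, 1)))"
  proof -
    show thesis by (rule inplane_beats_perp[OF c2 oblique]) (rule that)
  qed
  let ?P = "\<lambda>E x. span (\<Union>\<kappa>. E x \<kappa>) = tangent_space x \<and>
        (\<forall>\<kappa>. subspace (E x \<kappa>) \<and> dim (E x \<kappa>) = count_list [l, l, - l, - l] \<kappa> \<and>
             dB x ` E x \<kappa> = E (billiard_map x) \<kappa> \<and>
             (\<forall>w\<in>E x \<kappa> - {0}.
                ((\<lambda>n. ln (norm (dB_pow n x w)) / real_of_int n) \<longlongrightarrow> \<kappa>) at_top \<and>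
                ((\<lambda>n. ln (norm (dB_pow n x w)) / real_of_int n) \<longlongrightarrow> \<kappa>) at_bot))"
  obtain E :: "phase \<Rightarrow> real \<Rightarrow> phase set" where E: "AE x in phase_measure \<mu>. ?P E x"
    using L unfolding lyapunov_exponents_def by (rule exE)
  have "AE z in \<mu>. ?P E (?g z)"
    using AE_distrD[OF inv_coding_measurable[OF G(2)] E[unfolded phase_measure_def]] .
  moreover have "AE z in \<mu>. z \<in> Sigma_A k0" using AE_space[of \<mu>] unfolding G(1) .
  ultimately have "AE z in \<mu>. (\<lambda>n. real (turns z n) / real n) \<longlonglongrightarrow> 0"
  proof eventually_elim
    case (elim z)
    define x where "x = ?g z"
    have x: "x \<in> M0" unfolding x_def using bij_betw_apply[OF bij_betw_inv_into[OF coding_bij] elim(2)] .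
    have cz: "coding x = z" unfolding x_def using bij_betw_inv_into_right[OF coding_bij elim(2)] .
    have P: "?P E x" using elim(1) unfolding x_def .
    have P1: "span (\<Union>\<kappa>. E x \<kappa>) = tangent_space x" using P by (rule conjunct1)
    note Q = spec[OF conjunct2[OF P]]
    have P2: "subspace (E x \<kappa>)" "dim (E x \<kappa>) = count_list [l, l, - l, - l] \<kappa>" for \<kappa>
      by (rule conjunct1[OF Q]) (rule conjunct1[OF conjunct2[OF Q]])
    have P3: "((\<lambda>n. ln (norm (dB_pow n x w)) / real_of_int n) \<longlongrightarrow> \<kappa>) at_top" if "w \<in> E x \<kappa> - {0}" for \<kappa> w
      by (rule conjunct1[OF bspec[OF conjunct2[OF conjunct2[OF conjunct2[OF Q]]] that]])
    have rate: "(\<lambda>n. ln (norm (dB_iter n x w)) / real n) \<longlonglongrightarrow> l"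
      if "w \<in> tangent_space x" "\<And>n. 1 \<le> norm (dB_iter n x w)" for w
      by (rule growth_rate_of_non_contracting[of x l "E x", OF x l P1 P2 P3 that])
    show ?case
      using turns_negligible_of_equal_rates[OF eps(1) eps(2)[OF x] eps(3)[OF x]
          rate[OF perp_tangent[OF x] eps(3)[OF x]] rate[OF inplane_tangent[OF x] eps(4)[OF x]]]
      unfolding cz .
  qed
  then show False using turns_not_negligible[OF g k] by blast
qed

end

theorem theorem1p1:
  fixes k0 :: nat and cen :: "nat \<Rightarrow> real^3" and rad :: "nat \<Rightarrow> real"
    and \<Gamma> :: "(real^3) set" and d0 r0 c2 :: real
    and \<phi> :: "(int \<Rightarrow> nat) \<Rightarrow> real" and \<mu> :: "(int \<Rightarrow> nat) measure"
    and lam1 lam2 :: real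
  assumes "k0 \<ge> 3"
    and "\<forall>i\<in>{1..k0}. rad i > 0"
    and "affine \<Gamma>" and "aff_dim \<Gamma> = 2" and "\<forall>i\<in>{1..k0}. cen i \<in> \<Gamma>"
    and "ball_billiard.no_eclipse k0 cen rad"
    and "d0 > 0" and "r0 < d0 / 3"
    and "\<forall>i\<in>{1..k0}. \<forall>j\<in>{1..k0}. i \<noteq> j \<longrightarrow> d0 < dist (cen i) (cen j) \<and> dist (cen i) (cen j) \<le> 1"
    and "\<forall>i\<in>{1..k0}. rad i \<le> r0"
    and "c2 < 1"
    and "\<forall>q1 q2 q3. ball_billiard.successive_reflection_points k0 cen rad q1 q2 q3 \<and>
           ball_billiard.ball_index k0 cen rad q1 \<noteq> ball_billiard.ball_index k0 cen rad q3 \<longrightarrow>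
           ball_billiard.cos_reflection k0 cen rad q2 q3 \<le> c2"
    and "c2 * d0 > 2 * r0"
    and "holder_potential k0 \<phi>"
    and "gibbs_measure k0 \<phi> \<mu>"
    and "lam1 \<ge> lam2" and "lam2 > 0"
    and "ball_billiard.lyapunov_exponents k0 cen rad
           (ball_billiard.phase_measure k0 cen rad \<mu>) [lam1, lam2, - lam2, - lam1]"
  shows "lam1 > lam2"
proof (rule ccontr)
  assume "\<not> lam1 > lam2"
  then have l: "lam1 = lam2" using assms(16) by simp
  have "aff_dim \<Gamma> < DIM(real^3)" using assms(4) by simp
  then obtain a b where a: "a \<noteq> 0" "\<Gamma> \<subseteq> {x. a \<bullet> x = b}" using aff_lowdim_subset_hyperplane by blast
  define e where "e = a /\<^sub>R norm a"
  define h where "h = b / norm a"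
  have "1 \<in> {1..k0}" using assms(1) by simp
  then have "0 < rad 1" "rad 1 \<le> r0" using assms(2,10) by blast+
  then have "0 < c2 * d0" using assms(13) by linarith
  then have c20: "0 < c2" using assms(7) by (simp add: zero_less_mult_iff)
  interpret planar_billiard k0 cen rad "d0 - 2 * r0" e h
  proof unfold_locales
    show "0 < d0 - 2 * r0" using assms(7,8) by linarith
    show "0 < rad i" if "i \<in> {1..k0}" for i using assms(2) that by blast
    show "rad i + rad j + (d0 - 2 * r0) \<le> dist (cen i) (cen j)" if "i \<in> {1..k0}" "j \<in> {1..k0}" "i \<noteq> j" for i j
    proof -
      have "rad i \<le> r0" "rad j \<le> r0" "d0 < dist (cen i) (cen j)" using assms(9,10) that by blast+
      then show ?thesis by linarith
    qed
    show "ball_billiard.no_eclipse k0 cen rad" by fact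
    show "norm e = 1" using a by (simp add: e_def)
    show "cen i \<bullet> e = h" if "i \<in> {1..k0}" for i
    proof -
      have "a \<bullet> cen i = b" using a(2) assms(5) that by blast
      then show ?thesis by (simp add: e_def h_def inner_commute divide_inverse)
    qed
  qed
  show False
    using no_double_exponent[OF assms(1,15) c20 assms(11,12,17) assms(18)[unfolded l]] .
qed

end
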